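(* Consider the planar system $\dot z = Z(z,\phi(y\epsilon^{-1}),\alpha)$, $z=(x,y)\in\mathbb R^2$, $\epsilon\in(0,\epsilon_0]$, $\alpha\in I\subset\mathbb R$, where $Z(z,p,\alpha)=pZ^+(z,\alpha)+(1-p)Z^-(z,\alpha)$ with $Z^\pm:\mathbb R^2\times I\to\mathbb R^2$ smooth, and where $\phi:\mathbb R\to\mathbb R$ is smooth with $\phi'(s)>0$ for all $s\in\mathbb R$, $\phi(s)\to1$ as $s\to\infty$ and $\phi(s)\to0$ as $s\to-\infty$. Assume that the piecewise-smooth (PWS) system obtained in the limit $\epsilon\to0$ (namely $\dot z=Z^+(z,\alpha)$ for $y>0$, $\dot z=Z^-(z,\alpha)$ for $y<0$) has a boundary equilibrium bifurcation (BEB) of type BF, BN or BS at $z_{bf}\in\Sigma=\{y=0\}$ when $\alpha=\alpha_{bf}$. Then there exist constants $$\tau\in\mathbb R\setminus\{0\},\qquad \delta\in\mathbb R\setminus\{0,\tau^2/4\},\qquad \gamma\in\mathbb R,$$ such that the system can be smoothly transformed, up to a reversal of orientation, into the local normal form $$\begin{pmatrix}\dot x\\ \dot y\end{pmatrix}=\begin{pmatrix}\tau-\gamma+\phi(y\epsilon^{-1})\left(\gamma-\tau+\mu+\tau x-\delta y+\theta_1(x,y,\mu)\right)\\ 1+\phi(y\epsilon^{-1})\left(-1+x+\theta_2(x,y,\mu)\right)\end{pmatrix},$$ where $\theta_1,\theta_2$ are real-valued smooth functions such that $$\theta_1(x,y,\mu)=\mathcal O(x^2,xy,y^2,x\mu,y\mu,\mu^2),\qquad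 \theta_2(x,y,\mu)=\mathcal O(x^2,xy,y^2,x\mu,y\mu),$$ and $\mu$ is a new bifurcation parameter related to $\alpha$ via $\mu=g(\alpha)$, where $g:I_\alpha\to\mathbb R$ is a smooth function with $g(\alpha_{bf})=0$ and $g'(\alpha_{bf})\neq0$. Moreover, the PWS system $$\begin{pmatrix}\dot x\\ \dot y\end{pmatrix}=\begin{cases}X^+(x,y,\mu):=\begin{pmatrix}\mu+\tau x-\delta y+\theta_1(x,y,\mu)\\ x+\theta_2(x,y,\mu)\end{pmatrix}, & y>0,\\[2ex] X^-(x,y,\mu):=\begin{pmatrix}\tau-\gamma\\1\end{pmatrix}, & y<0,\end{cases}$$ obtained from the normal form in the limit $\epsilon\to0^+$ has a BEB at the origin for $\mu=0$, and a Filippov/sliding vector field given by $$\dot x=\frac{\mu+\gamma x+\theta_1(x,0,\mu)-(\tau-\gamma)\theta_2(x,0,\mu)}{1-x-\theta_2(x,0,\mu)}=:X_{sl}(x,\mu),\qquad (x,0)\in\Sigma_{sl}.$$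
   Context: "Smoothly transformed" means: locally near $(z_{bf},\alpha_{bf})$, by a smooth invertible ($\alpha$-dependent) change of coordinates, a smooth reparametrization of time, and the parameter change $\mu=g(\alpha)$ defined on an interval $I_\alpha$ around $\alpha_{bf}$. "Up to a reversal of orientation": time orientation is reversed if the second component $Z_2^-$ of $Z^-$ is negative at $(z_{bf},\alpha_{bf})$. Crossing and sliding: with $f(x,y)=y$ and Lie derivatives $Z^\pm f=\langle\nabla f,Z^\pm\rangle=Z^\pm_2$, a point $p\in\Sigma=\{y=0\}$ is a sliding point if $(Z^+f(p))(Z^-f(p))<0$ (a crossing point if this product is positive); $\Sigma_{sl}$ denotes the set of sliding points. The Filippov/sliding vector field on $\Sigma_{sl}$, in the $x$-coordinate, is $$\dot x=Z_{sl}(x,0)=\frac{\det(Z^+(x,0)\,|\,Z^-(x,0))}{Z_2^-(x,0)-Z_2^+(x,0)}.$$ BEB: the PWS system has a BEB at $z_{bf}=(x_{bf},0)\in\Sigma$ for $\alpha=\alpha_{bf}$ if $Z^+(z_{bf},\alpha_{bf})=(0,0)^T$ and $$Z_2^-(z_{bf},\alpha_{bf})\neq0,\quad \det\left(\frac{\partial Z^+}{\partial\alpha}\Big|\frac{\partial Z^+}{\partial x}\right)\Big|_{(z_{bf},\alpha_{bf})}\neq0,\quad \frac{\partial Z_{sl}}{\partial x}\Big|_{(x_{bf},\alpha_{bf})}\neq0,$$ where $(X|Y)$ denotes the matrix with columns $X,Y$. Let $\lambda_\pm$ and $v_\pm$ be the eigenvalues and corresponding eigenvectors of the Jacobian $(\partial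 Z^+/\partial z)|_{(z_{bf},\alpha_{bf})}$. Types: (BF, boundary-focus) $\lambda_\pm=A\pm iB$ with $A,B\in\mathbb R\setminus\{0\}$; (BN, boundary-node) $\lambda_+/\lambda_->0$ and $v_\pm$ transversal to $\Sigma$; (BS, boundary-saddle) $\lambda_+/\lambda_-<0$ and $v_\pm$ transversal to $\Sigma$.
   Formalization: τ≠0 is not asserted for a boundary saddle with λ₊ = −λ₋ (there τ=0 is forced; the rest is proved), and type BN requires λ₊≠λ₋, since a double eigenvalue forces δ=τ²/4; the English claim fails in both cases. *)

theory Defs
  imports "HOL-Analysis.Analysis" "HOL-Library.Landau_Symbols"
begin

section \<open>Smooth maps on open sets\<close>

text \<open>
  For open \<open>S\<close>, \<open>Ck_on k S f\<close> says that \<open>f\<close> is of class \<open>C\<^sup>k\<close> on \<open>S\<close>: derivatives are taken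
  in every fixed direction \<open>v\<close>, so that all iterated derivatives keep the type of \<open>f\<close>.
\<close>

primrec Ck_on ::
  "nat \<Rightarrow> 'a::real_normed_vector set \<Rightarrow> ('a \<Rightarrow> 'b::real_normed_vector) \<Rightarrow> bool" where
  "Ck_on 0 S f \<longleftrightarrow> continuous_on S f"
| "Ck_on (Suc k) S f \<longleftrightarrow> (\<forall>x\<in>S. f differentiable (at x)) \<and>
     (\<forall>v. Ck_on k S (\<lambda>x. frechet_derivative f (at x) v))"

definition smooth_on ::
  "'a::real_normed_vector set \<Rightarrow> ('a \<Rightarrow> 'b::real_normed_vector) \<Rightarrow> bool" where
  "smooth_on S f \<longleftrightarrow> (\<forall>k. Ck_on k S f)"

definition diffeomorphism_between ::
  "'a::real_normed_vector set \<Rightarrow> 'b::real_normed_vector set \<Rightarrow> ('a \<Rightarrow> 'b) \<Rightarrow> bool" where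
  "diffeomorphism_between S T f \<longleftrightarrow> open S \<and> open T \<and> bij_betw f S T \<and>
     smooth_on S f \<and> smooth_on T (inv_into S f)"


section \<open>Planar piecewise-smooth systems with a switching line\<close>

text \<open>
  A family of planar vector fields is a function \<open>Z :: real^2 \<Rightarrow> real \<Rightarrow> real^2\<close> of the state
  \<open>z = (x, y)\<close> and of the parameter. A piecewise-smooth system is given by such a pair
  \<open>Zp\<close> (for \<open>y > 0\<close>) and \<open>Zm\<close> (for \<open>y < 0\<close>).
\<close>

type_synonym vfield = "real^2 \<Rightarrow> real \<Rightarrow> real^2"

definition switching_line :: "(real^2) set" where
  "switching_line = {z. z $ 2 = 0}"

definition combined_field :: "vfield \<Rightarrow> vfield \<Rightarrow> real^2 \<Rightarrow> real \<Rightarrow> real \<Rightarrow> real^2" where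
  "combined_field Zp Zm z p \<alpha> = p *\<^sub>R Zp z \<alpha> + (1 - p) *\<^sub>R Zm z \<alpha>"

definition columns2 :: "real^2 \<Rightarrow> real^2 \<Rightarrow> real^2^2" where
  "columns2 X Y = transpose (vector [X, Y])"

text \<open>The second components are the Lie derivatives of \<open>f (x, y) = y\<close> along the two fields.\<close>

definition sliding_set :: "vfield \<Rightarrow> vfield \<Rightarrow> real \<Rightarrow> (real^2) set" where
  "sliding_set Zp Zm \<alpha> = {p \<in> switching_line. Zp p \<alpha> $ 2 * Zm p \<alpha> $ 2 < 0}"

definition sliding_field :: "vfield \<Rightarrow> vfield \<Rightarrow> real \<Rightarrow> real \<Rightarrow> real" where
  "sliding_field Zp Zm x \<alpha> =
     det (columns2 (Zp (vector [x, 0]) \<alpha>) (Zm (vector [x, 0]) \<alpha>)) /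
     (Zm (vector [x, 0]) \<alpha> $ 2 - Zp (vector [x, 0]) \<alpha> $ 2)"

definition jacobian_at :: "vfield \<Rightarrow> real^2 \<Rightarrow> real \<Rightarrow> real^2^2" where
  "jacobian_at Z z \<alpha> = jacobian (\<lambda>w. Z w \<alpha>) (at z)"

definition partial_x :: "vfield \<Rightarrow> real^2 \<Rightarrow> real \<Rightarrow> real^2" where
  "partial_x Z z \<alpha> = vector_derivative (\<lambda>x. Z (vector [x, z $ 2]) \<alpha>) (at (z $ 1))"

definition partial_param :: "vfield \<Rightarrow> real^2 \<Rightarrow> real \<Rightarrow> real^2" where
  "partial_param Z z \<alpha> = vector_derivative (\<lambda>a. Z z a) (at \<alpha>)"

definition BEB :: "vfield \<Rightarrow> vfield \<Rightarrow> real^2 \<Rightarrow> real \<Rightarrow> bool" where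
  "BEB Zp Zm z \<alpha> \<longleftrightarrow>
     z \<in> switching_line \<and> Zp z \<alpha> = 0 \<and> Zm z \<alpha> $ 2 \<noteq> 0 \<and>
     det (columns2 (partial_param Zp z \<alpha>) (partial_x Zp z \<alpha>)) \<noteq> 0 \<and>
     deriv (\<lambda>x. sliding_field Zp Zm x \<alpha>) (z $ 1) \<noteq> 0"

definition eigenpair :: "'a::field^'n^'n \<Rightarrow> 'a \<Rightarrow> 'a^'n \<Rightarrow> bool" where
  "eigenpair M l v \<longleftrightarrow> v \<noteq> 0 \<and> M *v v = l *s v"

definition transversal_to_line :: "real^2 \<Rightarrow> bool" where
  "transversal_to_line v \<longleftrightarrow> v $ 2 \<noteq> 0"

definition boundary_focus :: "vfield \<Rightarrow> real^2 \<Rightarrow> real \<Rightarrow> bool" where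
  "boundary_focus Zp z \<alpha> \<longleftrightarrow>
     (let J = map_matrix complex_of_real (jacobian_at Zp z \<alpha>) in
      \<exists>A B vp vm. A \<noteq> 0 \<and> B \<noteq> 0 \<and>
        eigenpair J (Complex A B) vp \<and> eigenpair J (Complex A (- B)) vm)"

text \<open>
  The two eigenvalues of a node are required to be distinct: a double eigenvalue would make the
  discriminant \<open>\<tau>\<^sup>2 - 4 * \<delta>\<close> of the normal form vanish.
\<close>

definition boundary_node :: "vfield \<Rightarrow> real^2 \<Rightarrow> real \<Rightarrow> bool" where
  "boundary_node Zp z \<alpha> \<longleftrightarrow>
     (let J = jacobian_at Zp z \<alpha> in
      \<exists>lp lm vp vm. eigenpair J lp vp \<and> eigenpair J lm vm \<and> lp \<noteq> lm \<and> lp / lm > 0 \<and>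
        transversal_to_line vp \<and> transversal_to_line vm)"

definition boundary_saddle :: "vfield \<Rightarrow> real^2 \<Rightarrow> real \<Rightarrow> bool" where
  "boundary_saddle Zp z \<alpha> \<longleftrightarrow>
     (let J = jacobian_at Zp z \<alpha> in
      \<exists>lp lm vp vm. eigenpair J lp vp \<and> eigenpair J lm vm \<and> lp / lm < 0 \<and>
        transversal_to_line vp \<and> transversal_to_line vm)"

text \<open>
  The trace of the Jacobian at an equilibrium of \<open>Zp\<close> is multiplied by a nonzero constant under
  coordinate changes and time rescalings, so that a saddle with eigenvalues \<open>l\<close> and \<open>- l\<close>
  can only be transformed into the normal form below with \<open>\<tau> = 0\<close>.
\<close>

definition neutral_boundary_saddle :: "vfield \<Rightarrow> real^2 \<Rightarrow> real \<Rightarrow> bool" where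
  "neutral_boundary_saddle Zp z \<alpha> \<longleftrightarrow>
     boundary_saddle Zp z \<alpha> \<and> trace (jacobian_at Zp z \<alpha>) = 0"


section \<open>Smooth transformations and the normal form\<close>

text \<open>
  \<open>F\<close> and \<open>N\<close> are fields \<open>(z, p, parameter) \<mapsto> velocity\<close>, used with \<open>p = \<phi> (y / \<epsilon>)\<close>.
  With \<open>w = H z \<alpha>\<close>, \<open>\<mu> = g \<alpha>\<close> and the new time \<open>s\<close> given by \<open>ds = \<sigma> * h z \<alpha> * dt\<close>, the
  last conjunct says that the system \<open>dz/dt = F\<close> becomes \<open>dw/ds = N\<close>; here \<open>h > 0\<close>, and
  \<open>\<sigma>\<close> is \<open>1\<close> or \<open>-1\<close> according to whether the orientation of time is kept or reversed. The
  neighbourhoods \<open>U\<close> and \<open>J\<close> and the maps \<open>H\<close>, \<open>h\<close>, \<open>g\<close> do not depend on \<open>\<epsilon>\<close>. The set \<open>W\<close> is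
  the resulting domain of \<open>N\<close> in the \<open>(w, \<mu>)\<close> space.
\<close>

definition smoothly_transforms ::
  "(real \<Rightarrow> real) \<Rightarrow> real \<Rightarrow>
   (real^2 \<Rightarrow> real \<Rightarrow> real \<Rightarrow> real^2) \<Rightarrow> (real^2 \<Rightarrow> real \<Rightarrow> real \<Rightarrow> real^2) \<Rightarrow> real \<Rightarrow>
   (real^2) set \<Rightarrow> real set \<Rightarrow> ((real^2) \<times> real) set \<Rightarrow>
   vfield \<Rightarrow> (real^2 \<Rightarrow> real \<Rightarrow> real) \<Rightarrow> (real \<Rightarrow> real) \<Rightarrow> bool" where
  "smoothly_transforms \<phi> \<epsilon>0 F N \<sigma> U J W H h g \<longleftrightarrow>
     diffeomorphism_between J (g ` J) g \<and>
     diffeomorphism_between (U \<times> J) W (\<lambda>(z, \<alpha>). (H z \<alpha>, g \<alpha>)) \<and>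
     smooth_on (U \<times> J) (\<lambda>(z, \<alpha>). h z \<alpha>) \<and>
     (\<forall>z\<in>U. \<forall>\<alpha>\<in>J. h z \<alpha> > 0) \<and>
     (\<forall>\<epsilon>\<in>{0<..\<epsilon>0}. \<forall>z\<in>U. \<forall>\<alpha>\<in>J.
        frechet_derivative (\<lambda>w. H w \<alpha>) (at z) (F z (\<phi> (z $ 2 / \<epsilon>)) \<alpha>) =
        (\<sigma> * h z \<alpha>) *\<^sub>R N (H z \<alpha>) (\<phi> (H z \<alpha> $ 2 / \<epsilon>)) (g \<alpha>))"

definition normal_form ::
  "real \<Rightarrow> real \<Rightarrow> real \<Rightarrow> (real \<Rightarrow> real \<Rightarrow> real \<Rightarrow> real) \<Rightarrow> (real \<Rightarrow> real \<Rightarrow> real \<Rightarrow> real) \<Rightarrow>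
   real^2 \<Rightarrow> real \<Rightarrow> real \<Rightarrow> real^2" where
  "normal_form \<tau> \<delta> \<gamma> \<theta>1 \<theta>2 z p \<mu> =
     (let x = z $ 1; y = z $ 2 in
      vector [\<tau> - \<gamma> + p * (\<gamma> - \<tau> + \<mu> + \<tau> * x - \<delta> * y + \<theta>1 x y \<mu>),
              1 + p * (- 1 + x + \<theta>2 x y \<mu>)])"

definition X_plus ::
  "real \<Rightarrow> real \<Rightarrow> (real \<Rightarrow> real \<Rightarrow> real \<Rightarrow> real) \<Rightarrow> (real \<Rightarrow> real \<Rightarrow> real \<Rightarrow> real) \<Rightarrow> vfield" where
  "X_plus \<tau> \<delta> \<theta>1 \<theta>2 z \<mu> =
     (let x = z $ 1; y = z $ 2 in
      vector [\<mu> + \<tau> * x - \<delta> * y + \<theta>1 x y \<mu>, x + \<theta>2 x y \<mu>])"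

definition X_minus :: "real \<Rightarrow> real \<Rightarrow> vfield" where
  "X_minus \<tau> \<gamma> z \<mu> = vector [\<tau> - \<gamma>, 1]"

end

theory Submission
  imports Defs
begin

text \<open>
  The switching function \<open>\<phi> (y / \<epsilon>)\<close> has to be preserved for every \<open>\<epsilon>\<close>, so the second coordinate is
  kept, and the \<open>p\<close>-free part of the second component forces the time change to be
  \<open>Z\<^sup>-\<^sub>2\<close> up to its sign, which is the orientation.
  What remains is a new first coordinate \<open>X\<close>. The \<open>p\<close>-free part of the first component
  requires \<open>X\<close> to grow at a constant rate \<open>c = \<tau> - \<gamma>\<close> along \<open>Z\<^sup>- / Z\<^sup>-\<^sub>2\<close>, which is a transport
  equation; its initial values on \<open>y = 0\<close> and the number \<open>c\<close> are free. Choosing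
  \<open>X = q := Z\<^sup>+\<^sub>2 / Z\<^sup>-\<^sub>2\<close> on \<open>y = 0\<close> makes \<open>\<theta>\<^sub>2 = q - X\<close> vanish there, and \<open>c\<close> is fixed by
  requiring that \<open>X\<close> and \<open>q\<close> have the same gradient at the bifurcation point. The remaining
  constants are then the trace and the determinant of the Jacobian, rescaled, and a linear
  reparametrization \<open>g\<close> normalizes the coefficient of \<open>\<mu>\<close>. The transport equation is solved by
  characteristics, which needs smooth dependence of scalar differential equations on parameters.
\<close>


section \<open>Maps of class \<open>C\<^sup>k\<close>\<close>

text \<open>The demanding requirement is that \<open>\<theta>\<^sub>2\<close> has no pure
  \<open>\<mu>\<^sup>2\<close> term. Its bound vanishes at \<open>x = y = 0\<close>, so
  \<open>\<theta>\<^sub>2\<close> must vanish there for all small \<open>\<mu>\<close>, which no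
  matching of finitely many Taylor coefficients at one point can guarantee. Vanishing on the whole
  line \<open>y = 0\<close> provides a factor \<open>y\<close>, and the equal gradients provide a
  second small factor. The hypotheses enter through single numbers. Each nondegeneracy condition of
  the bifurcation becomes the nonvanishing of one constant of the normal form. The type (focus, node
  or saddle) ensures that \<open>q\<close> has nonzero slope in \<open>x\<close>, without which it
  could not serve as a coordinate, and controls determinant, discriminant and trace. Only the trace
  can still vanish, for a saddle with opposite eigenvalues; hence the alternative to
  \<open>\<tau> \<noteq> 0\<close> in the conclusion. Smoothness of solutions and of inverse maps is
  obtained in one way: the derivative of the unknown map is expressed through the map itself, so
  each order of differentiability yields the next.\<close>

abbreviation D :: "('a::real_normed_vector \<Rightarrow> 'b::real_normed_vector) \<Rightarrow> 'a \<Rightarrow> 'a \<Rightarrow> 'b" where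
  "D f x \<equiv> frechet_derivative f (at x)"

lemma Ck_on_cong:
  assumes "open S" "\<And>x. x \<in> S \<Longrightarrow> f x = g x"
  shows "Ck_on k S f \<longleftrightarrow> Ck_on k S g"
  using assms(2)
proof (induction k arbitrary: f g)
  case 0
  then show ?case by (auto cong: continuous_on_cong)
next
  case (Suc k)
  have der: "(f has_derivative d) (at x) \<longleftrightarrow> (g has_derivative d) (at x)" if "x \<in> S" for x d
    using Suc.prems that assms(1) has_derivative_transform_within_open[of f d x UNIV S g]
      has_derivative_transform_within_open[of g d x UNIV S f] by auto
  then have eq: "D f x = D g x" if "x \<in> S" for x
    using that unfolding frechet_derivative_def by simp
  have "f differentiable at x \<longleftrightarrow> g differentiable at x" if "x \<in> S" for x
    using der[OF that] by (auto simp: differentiable_def)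
  moreover have "Ck_on k S (\<lambda>x. D f x v) \<longleftrightarrow> Ck_on k S (\<lambda>x. D g x v)" for v
    using eq by (intro Suc.IH) auto
  ultimately show ?case by auto
qed

text \<open>\<open>D f x\<close> is defined by choice and carries no formula. Here any explicit
  family of derivatives may take its place; most inductions on \<open>k\<close> below go through
  this rule.\<close>

lemma Ck_on_SucI:
  assumes "open S" "\<And>x. x \<in> S \<Longrightarrow> (f has_derivative f' x) (at x)"
    "\<And>v. Ck_on k S (\<lambda>x. f' x v)"
  shows "Ck_on (Suc k) S f"
proof -
  have "D f x = f' x" if "x \<in> S" for x
    using assms(2)[OF that] frechet_derivative_at by metis
  then have "Ck_on k S (\<lambda>x. D f x v)" for v
    using assms(3)[of v] Ck_on_cong[OF assms(1), of "\<lambda>x. D f x v" "\<lambda>x. f' x v"] by auto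
  then show ?thesis using assms(2) by (auto simp: differentiable_def)
qed

lemma Ck_on_SucD:
  assumes "Ck_on (Suc k) S f" "x \<in> S"
  shows "(f has_derivative D f x) (at x)"
  using assms frechet_derivative_works by auto

lemma Ck_on_Suc_continuous:
  assumes "Ck_on (Suc k) S f"
  shows "continuous_on S f"
  using assms
  by (auto intro!: continuous_at_imp_continuous_on differentiable_imp_continuous_within)

lemma Ck_on_lower: "Ck_on (Suc k) S f \<Longrightarrow> Ck_on k S f"
proof (induction k arbitrary: f)
  case 0
  then show ?case using Ck_on_Suc_continuous[of 0 S f] by simp
next
  case (Suc k)
  then show ?case by (metis Ck_on.simps(2))
qed

lemma Ck_on_continuous: "Ck_on k S f \<Longrightarrow> continuous_on S f"
  by (cases k) (auto dest: Ck_on_Suc_continuous simp del: Ck_on.simps(2))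

lemma Ck_on_subset:
  assumes "Ck_on k T f" "S \<subseteq> T"
  shows "Ck_on k S f"
  using assms(1)
  by (induction k arbitrary: f) (use assms(2) in \<open>auto intro: continuous_on_subset\<close>)

lemma Ck_on_const: "Ck_on k S (\<lambda>x. c)"
proof (induction k arbitrary: c)
  case (Suc k)
  have "D (\<lambda>x::'a. c) x = (\<lambda>v. 0)" for x
    by (rule frechet_derivative_at[symmetric]) simp
  then show ?case using Suc[of 0] by simp
qed simp

lemma Ck_on_linear_comp:
  assumes "open S" "bounded_linear L" "Ck_on k S f"
  shows "Ck_on k S (\<lambda>x. L (f x))"
  using assms(3)
proof (induction k arbitrary: f)
  case 0
  then show ?case using bounded_linear.continuous_on[OF assms(2), of S f] by simp
next
  case (Suc k)
  show ?case
  proof (rule Ck_on_SucI[OF assms(1)])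
    show "((\<lambda>x. L (f x)) has_derivative (\<lambda>v. L (D f x v))) (at x)" if "x \<in> S" for x
      using bounded_linear.has_derivative[OF assms(2) Ck_on_SucD[OF Suc.prems that]] .
    show "Ck_on k S (\<lambda>x. L (D f x v))" for v
      using Suc by auto
  qed
qed

lemma Ck_on_linear:
  assumes "open S" "bounded_linear L"
  shows "Ck_on k S L"
proof -
  have "Ck_on k S (\<lambda>x. x)"
  proof (cases k)
    case (Suc n)
    show ?thesis unfolding Suc
      by (rule Ck_on_SucI[OF assms(1), of _ "\<lambda>x v. v"]) (auto intro: Ck_on_const)
  qed auto
  from Ck_on_linear_comp[OF assms this] show ?thesis .
qed

lemma Ck_on_add:
  assumes "open S" "Ck_on k S f" "Ck_on k S g"
  shows "Ck_on k S (\<lambda>x. f x + g x)"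
  using assms(2,3)
proof (induction k arbitrary: f g)
  case 0
  then show ?case by (auto intro: continuous_intros)
next
  case (Suc k)
  show ?case
    by (rule Ck_on_SucI[OF assms(1), of _ "\<lambda>x v. D f x v + D g x v"])
      (use Suc in \<open>auto intro: Suc.IH has_derivative_add Ck_on_SucD simp del: Ck_on.simps(2)\<close>,
       use Suc in auto)
qed

text \<open>The product rule yields products with one factor differentiated, so the induction has to
  range over both factors at once, and the undifferentiated factor is used with one order given
  up.\<close>

lemma Ck_on_bilinear:
  assumes "bounded_bilinear P" "open S" "Ck_on k S f" "Ck_on k S g"
  shows "Ck_on k S (\<lambda>x. P (f x) (g x))"
  using assms(3,4)
proof (induction k arbitrary: f g)
  case 0
  then show ?case using bounded_bilinear.continuous_on[OF assms(1)] by auto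
next
  case (Suc k)
  have "Ck_on k S f" "Ck_on k S g" "\<And>v. Ck_on k S (\<lambda>x. D f x v)" "\<And>v. Ck_on k S (\<lambda>x. D g x v)"
    using Suc.prems Ck_on_lower by (blast, blast, auto)
  then have "Ck_on k S (\<lambda>x. P (f x) (D g x v) + P (D f x v) (g x))" for v
    by (intro Ck_on_add[OF assms(2)] Suc.IH)
  then show ?case
    using bounded_bilinear.FDERIV[OF assms(1) Ck_on_SucD[OF Suc.prems(1)] Ck_on_SucD[OF Suc.prems(2)]]
    by (intro Ck_on_SucI[OF assms(2), of _ "\<lambda>x v. P (f x) (D g x v) + P (D f x v) (g x)"]) auto
qed

lemmas Ck_on_mult = Ck_on_bilinear[OF bounded_bilinear_mult]
lemmas Ck_on_scaleR = Ck_on_bilinear[OF bounded_bilinear_scaleR]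

lemma Ck_on_sum:
  assumes "open S" "\<And>i. i \<in> A \<Longrightarrow> Ck_on k S (f i)"
  shows "Ck_on k S (\<lambda>x. \<Sum>i\<in>A. f i x)"
  using assms(2)
  by (induction A rule: infinite_finite_induct) (auto intro: Ck_on_const Ck_on_add[OF assms(1)])

text \<open>\<open>Ck_on\<close> controls derivatives in fixed directions only, whereas the chain
  rule differentiates \<open>f\<close> in the direction \<open>D g x v\<close>, which moves with
  \<open>x\<close>. Expansion in the basis leaves fixed directions with scalar coefficients.\<close>

lemma derivative_eq_sum_Basis:
  fixes f :: "'a::euclidean_space \<Rightarrow> 'b::real_normed_vector"
  assumes "f differentiable at x"
  shows "D f x v = (\<Sum>b\<in>Basis. (v \<bullet> b) *\<^sub>R D f x b)"
proof -
  have l: "linear (D f x)" using assms linear_frechet_derivative by blast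
  have "D f x v = D f x (\<Sum>b\<in>Basis. (v \<bullet> b) *\<^sub>R b)"
    by (simp add: euclidean_representation)
  also have "\<dots> = (\<Sum>b\<in>Basis. (v \<bullet> b) *\<^sub>R D f x b)"
    by (simp add: linear_sum[OF l] linear_cmul[OF l])
  finally show ?thesis .
qed

lemma Ck_on_compose:
  fixes f :: "'b::euclidean_space \<Rightarrow> 'c::real_normed_vector" and g :: "'a::real_normed_vector \<Rightarrow> 'b"
  assumes "open S" "open T" "g ` S \<subseteq> T" "Ck_on k T f" "Ck_on k S g"
  shows "Ck_on k S (\<lambda>x. f (g x))"
  using assms(4,5)
proof (induction k arbitrary: f)
  case 0
  then show ?case using assms(3) by (auto intro: continuous_on_compose2)
next
  case (Suc k)
  have gT: "g x \<in> T" if "x \<in> S" for x using that assms(3) by auto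
  have lin: "D f (g x) (D g x v) = (\<Sum>b\<in>Basis. (D g x v \<bullet> b) *\<^sub>R D f (g x) b)" if "x \<in> S" for x v
    using gT[OF that] Suc.prems(1) by (intro derivative_eq_sum_Basis) auto
  have "Ck_on k S (\<lambda>x. D f (g x) b)" for b
    using Suc.prems Ck_on_lower by (intro Suc.IH) auto
  moreover have "Ck_on k S (\<lambda>x. D g x v \<bullet> b)" for v b
    using Suc.prems(2) by (intro Ck_on_linear_comp[OF assms(1) bounded_linear_inner_left]) auto
  ultimately have "Ck_on k S (\<lambda>x. \<Sum>b\<in>Basis. (D g x v \<bullet> b) *\<^sub>R D f (g x) b)" for v
    by (intro Ck_on_sum Ck_on_scaleR assms(1))
  then have "Ck_on k S (\<lambda>x. D f (g x) (D g x v))" for v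
    using lin Ck_on_cong[OF assms(1), of "\<lambda>x. D f (g x) (D g x v)"] by simp
  moreover have "((\<lambda>x. f (g x)) has_derivative (\<lambda>v. D f (g x) (D g x v))) (at x)" if "x \<in> S" for x
    using has_derivative_compose[OF Ck_on_SucD[OF Suc.prems(2) that]
        Ck_on_SucD[OF Suc.prems(1) gT[OF that]]] .
  ultimately show ?case
    by (intro Ck_on_SucI[OF assms(1)])
qed

lemma Ck_on_Pair:
  assumes "open S" "Ck_on k S f" "Ck_on k S g"
  shows "Ck_on k S (\<lambda>x. (f x, g x))"
proof -
  have "Ck_on k S (\<lambda>x. (f x, 0))"
    by (rule Ck_on_linear_comp[OF assms(1) bounded_linear_Pair[OF bounded_linear_ident bounded_linear_zero] assms(2)])
  moreover have "Ck_on k S (\<lambda>x. (0, g x))"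
    by (rule Ck_on_linear_comp[OF assms(1) bounded_linear_Pair[OF bounded_linear_zero bounded_linear_ident] assms(3)])
  ultimately have "Ck_on k S (\<lambda>x. (f x, 0) + (0, g x))"
    by (rule Ck_on_add[OF assms(1)])
  then show ?thesis by simp
qed

lemma Ck_on_fst: "open S \<Longrightarrow> Ck_on k S f \<Longrightarrow> Ck_on k S (\<lambda>x. fst (f x))"
  by (rule Ck_on_linear_comp[OF _ bounded_linear_fst])

lemma Ck_on_snd: "open S \<Longrightarrow> Ck_on k S f \<Longrightarrow> Ck_on k S (\<lambda>x. snd (f x))"
  by (rule Ck_on_linear_comp[OF _ bounded_linear_snd])

lemma Ck_on_ident: "open S \<Longrightarrow> Ck_on k S (\<lambda>x. x)"
  by (rule Ck_on_linear[OF _ bounded_linear_ident])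

lemma Ck_on_minus: "open S \<Longrightarrow> Ck_on k S f \<Longrightarrow> Ck_on k S (\<lambda>x. - f x)"
  by (rule Ck_on_linear_comp[OF _ bounded_linear_minus[OF bounded_linear_ident]])

lemma Ck_on_diff: "open S \<Longrightarrow> Ck_on k S f \<Longrightarrow> Ck_on k S g \<Longrightarrow> Ck_on k S (\<lambda>x. f x - g x)"
  using Ck_on_add[OF _ _ Ck_on_minus, of S k f g] by simp

section \<open>Exponential, reciprocal and quotient\<close>

lemma Ck_on_exp_real: "Ck_on k S (exp :: real \<Rightarrow> real)"
proof -
  have "Ck_on k UNIV (exp :: real \<Rightarrow> real)"
  proof (induction k)
    case (Suc k)
    have "Ck_on k UNIV (\<lambda>x::real. v * exp x)" for v
      by (intro Ck_on_mult Ck_on_const Suc open_UNIV)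
    moreover have "(exp has_derivative (\<lambda>v. v * exp x)) (at x)" for x :: real
      by (auto intro!: derivative_eq_intros)
    ultimately show ?case by (intro Ck_on_SucI) auto
  qed (auto intro: continuous_intros)
  then show ?thesis by (rule Ck_on_subset) simp
qed

text \<open>The derivative is a product of reciprocals and constants, so the induction hypothesis
  applies to it directly.\<close>

lemma Ck_on_inverse_real: "Ck_on k (- {0}) (inverse :: real \<Rightarrow> real)"
proof (induction k)
  case (Suc k)
  have o: "open (- {0::real})" by auto
  have "Ck_on k (- {0}) (\<lambda>x::real. - (inverse x * v * inverse x))" for v
    by (intro Ck_on_minus Ck_on_mult Ck_on_const Suc o)
  moreover have "(inverse has_derivative (\<lambda>v. - (inverse x * v * inverse x))) (at x)"
    if "x \<in> - {0}" for x :: real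
    using has_derivative_inverse'[of x] that by simp
  ultimately show ?case by (intro Ck_on_SucI[OF o]) auto
qed (auto intro: continuous_intros)

lemma Ck_on_exp:
  fixes f :: "'a::real_normed_vector \<Rightarrow> real"
  shows "open S \<Longrightarrow> Ck_on k S f \<Longrightarrow> Ck_on k S (\<lambda>x. exp (f x))"
  by (rule Ck_on_compose[OF _ open_UNIV]) (auto intro: Ck_on_exp_real)

lemma Ck_on_divide:
  fixes f g :: "'a::real_normed_vector \<Rightarrow> real"
  assumes "open S" "Ck_on k S f" "Ck_on k S g" "\<And>x. x \<in> S \<Longrightarrow> g x \<noteq> 0"
  shows "Ck_on k S (\<lambda>x. f x / g x)"
proof -
  have "Ck_on k S (\<lambda>x. inverse (g x))"
    by (rule Ck_on_compose[OF assms(1) _ _ Ck_on_inverse_real assms(3)]) (use assms(4) in auto)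
  then show ?thesis unfolding divide_inverse by (intro Ck_on_mult assms)
qed

section \<open>Differentiation under the integral sign\<close>

lemma has_derivative_integral_unit_interval:
  fixes f :: "real \<times> 'a::euclidean_space \<Rightarrow> real"
  assumes "open T" "open S" "{0..1} \<times> S \<subseteq> T" "Ck_on (Suc k) T f" "x \<in> S"
  shows "((\<lambda>x. integral {0..1} (\<lambda>s. f (s, x))) has_derivative
           (\<lambda>v. integral {0..1} (\<lambda>s. D f (s, x) (0, v)))) (at x)"
proof -
  obtain e where e: "e > 0" "ball x e \<subseteq> S" using assms(2,5) openE by blast
  have dT: "(f has_derivative D f z) (at z)" if "z \<in> T" for z
    using Ck_on_SucD[OF assms(4) that] .
  \<comment> \<open>The Leibniz rule asks for a partial derivative that is continuous as a map into
    bounded operators. In finite dimension continuity in each basis direction suffices.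
    \<open>Blinfun\<close> has its meaning only where the map is bounded linear, hence the
    restriction to points of \<open>T\<close> below.\<close>
  define fx where "fx y s = Blinfun (\<lambda>v. D f (s, y) (0, v))" for y s
  have bl: "bounded_linear (\<lambda>v. D f (s, y) (0, v))" if "(s, y) \<in> T" for s y
    using bounded_linear_compose[OF has_derivative_bounded_linear[OF dT[OF that]]
      bounded_linear_Pair[OF bounded_linear_zero bounded_linear_ident]] .
  have fx: "blinfun_apply (fx y s) = (\<lambda>v. D f (s, y) (0, v))" if "(s, y) \<in> T" for s y
    unfolding fx_def by (rule bounded_linear_Blinfun_apply[OF bl[OF that]])
  have inT: "(s, y) \<in> T" if "y \<in> ball x e" "s \<in> {0..1}" for s y
    using that e(2) assms(3) by blast
  have "((\<lambda>x. integral (cbox 0 1) (\<lambda>s. f (s, x))) has_derivative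
           blinfun_apply (integral (cbox 0 1) (fx x))) (at x within ball x e)"
  proof (rule leibniz_rule)
    fix y s assume ys: "y \<in> ball x e" "s \<in> cbox 0 (1::real)"
    have 1: "((\<lambda>y. (s, y)) has_derivative (\<lambda>v. (0, v))) (at y within ball x e)"
      by (auto intro!: derivative_eq_intros)
    show "((\<lambda>x. f (s, x)) has_derivative blinfun_apply (fx y s)) (at y within ball x e)"
      using has_derivative_compose[OF 1 dT] inT ys fx by auto
  next
    fix y assume y: "y \<in> ball x e"
    have "continuous_on {0..1} (\<lambda>s. f (s, y))"
      by (rule continuous_on_compose2[OF Ck_on_continuous[OF assms(4)]])
        (use inT y in \<open>auto intro!: continuous_intros\<close>)
    then show "(\<lambda>s. f (s, y)) integrable_on cbox 0 1"
      by (simp add: integrable_continuous_interval)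
  next
    have "continuous_on (ball x e \<times> cbox 0 1) (\<lambda>p. fx (fst p) (snd p))"
    proof (rule continuous_on_blinfun_componentwise)
      fix i :: 'a
      have "continuous_on T (\<lambda>z. D f z (0, i))"
        using assms(4) Ck_on_continuous[of k T "\<lambda>z. D f z (0, i)"] by auto
      then have "continuous_on (ball x e \<times> cbox 0 1) (\<lambda>p. D f (snd p, fst p) (0, i))"
        by (rule continuous_on_compose2) (use inT in \<open>auto intro!: continuous_intros\<close>)
      then show "continuous_on (ball x e \<times> cbox 0 1) (\<lambda>p. blinfun_apply (fx (fst p) (snd p)) i)"
        by (rule continuous_on_eq) (use inT fx in auto)
    qed
    then show "continuous_on (ball x e \<times> cbox 0 1) (\<lambda>(y, s). fx y s)"
      by (simp add: case_prod_unfold)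
  qed (use e in auto)
  moreover have "blinfun_apply (integral (cbox 0 1) (fx x)) v =
      integral {0..1} (\<lambda>s. D f (s, x) (0, v))" for v
  proof -
    have "continuous_on (cbox 0 1) (fx x)"
    proof (rule continuous_on_blinfun_componentwise)
      fix i :: 'a
      have "continuous_on T (\<lambda>z. D f z (0, i))"
        using assms(4) Ck_on_continuous[of k T "\<lambda>z. D f z (0, i)"] by auto
      then have "continuous_on (cbox 0 1) (\<lambda>s. D f (s, x) (0, i))"
        by (rule continuous_on_compose2) (use inT e in \<open>auto intro!: continuous_intros\<close>)
      then show "continuous_on (cbox 0 1) (\<lambda>s. blinfun_apply (fx x s) i)"
        by (rule continuous_on_eq) (use inT fx e in auto)
    qed
    then have i: "fx x integrable_on cbox 0 1" by (rule integrable_continuous)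
    have "blinfun_apply (integral (cbox 0 1) (fx x)) v = integral (cbox 0 1) (\<lambda>s. blinfun_apply (fx x s) v)"
      by (rule blinfun_apply_integral[OF i])
    also have "\<dots> = integral {0..1} (\<lambda>s. D f (s, x) (0, v))"
      using fx inT e unfolding cbox_interval by (intro integral_cong) auto
    finally show ?thesis .
  qed
  ultimately have "((\<lambda>x. integral {0..1} (\<lambda>s. f (s, x))) has_derivative
      (\<lambda>v. integral {0..1} (\<lambda>s. D f (s, x) (0, v)))) (at x within ball x e)"
    unfolding cbox_interval
    by (metis (no_types, lifting) ext)
  then show ?thesis using e at_within_open[of x "ball x e"] by auto
qed

text \<open>With fixed limits the derivative is an integral of the same kind, so the induction
  closes. The open set \<open>T\<close> gives room beyond the end points 0 and 1, where
  \<open>f\<close> must be differentiable in all variables too.\<close>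

lemma Ck_on_integral_unit_interval:
  fixes f :: "real \<times> 'a::euclidean_space \<Rightarrow> real"
  assumes "open T" "open S" "{0..1} \<times> S \<subseteq> T" "Ck_on k T f"
  shows "Ck_on k S (\<lambda>x. integral {0..1} (\<lambda>s. f (s, x)))"
  using assms(4)
proof (induction k arbitrary: f)
  case 0
  have "continuous_on (S \<times> cbox 0 1) (\<lambda>(x, s). f (s, x))"
    unfolding case_prod_unfold
    by (rule continuous_on_compose2[of T f]) (use 0 assms(3) in \<open>auto intro!: continuous_intros\<close>)
  from integral_continuous_on_param[OF this] show ?case by simp
next
  case (Suc k)
  show ?case
  proof (rule Ck_on_SucI[OF assms(2)])
    fix x assume "x \<in> S"
    then show "((\<lambda>x. integral {0..1} (\<lambda>s. f (s, x))) has_derivative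
           (\<lambda>v. integral {0..1} (\<lambda>s. D f (s, x) (0, v)))) (at x)"
      by (rule has_derivative_integral_unit_interval[OF assms(1-3) Suc.prems])
  next
    fix v
    show "Ck_on k S (\<lambda>x. integral {0..1} (\<lambda>s. D f (s, x) (0, v)))"
      using Suc by auto
  qed
qed

section \<open>Calculus of smooth maps\<close>

lemma smooth_on_Ck: "smooth_on S f \<Longrightarrow> Ck_on k S f"
  by (simp add: smooth_on_def)

lemma smooth_on_has_derivative:
  "smooth_on S f \<Longrightarrow> x \<in> S \<Longrightarrow> (f has_derivative D f x) (at x)"
  by (rule Ck_on_SucD[OF smooth_on_Ck])

lemma smooth_on_derivative: "smooth_on S f \<Longrightarrow> smooth_on S (\<lambda>x. D f x v)"
  unfolding smooth_on_def using Ck_on.simps(2) by blast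

lemma smooth_on_continuous: "smooth_on S f \<Longrightarrow> continuous_on S f"
  by (rule Ck_on_continuous[OF smooth_on_Ck])

lemma smooth_on_subset: "smooth_on T f \<Longrightarrow> S \<subseteq> T \<Longrightarrow> smooth_on S f"
  unfolding smooth_on_def using Ck_on_subset by blast

lemma smooth_on_compose:
  fixes f :: "'b::euclidean_space \<Rightarrow> 'c::real_normed_vector" and g :: "'a::real_normed_vector \<Rightarrow> 'b"
  assumes "smooth_on T f" "smooth_on S g" "open S" "open T" "\<And>x. x \<in> S \<Longrightarrow> g x \<in> T"
  shows "smooth_on S (\<lambda>x. f (g x))"
  unfolding smooth_on_def
proof
  show "Ck_on k S (\<lambda>x. f (g x))" for k
    by (rule Ck_on_compose[OF assms(3,4) _ smooth_on_Ck[OF assms(1)] smooth_on_Ck[OF assms(2)]])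
      (use assms(5) in auto)
qed

lemma smooth_on_linear_comp: "open S \<Longrightarrow> bounded_linear L \<Longrightarrow> smooth_on S f \<Longrightarrow> smooth_on S (\<lambda>x. L (f x))"
  by (simp add: smooth_on_def Ck_on_linear_comp)

lemma smooth_on_cong: "open S \<Longrightarrow> (\<And>x. x \<in> S \<Longrightarrow> f x = g x) \<Longrightarrow> smooth_on S f \<Longrightarrow> smooth_on S g"
  by (simp add: smooth_on_def Ck_on_cong[of S f g])

named_theorems smooth_intros

lemma [smooth_intros]:
  fixes f g :: "'a::real_normed_vector \<Rightarrow> real"
  shows smooth_on_mult: "open S \<Longrightarrow> smooth_on S f \<Longrightarrow> smooth_on S g \<Longrightarrow> smooth_on S (\<lambda>x. f x * g x)"
  and smooth_on_divide: "open S \<Longrightarrow> smooth_on S f \<Longrightarrow> smooth_on S g \<Longrightarrow> (\<And>x. x \<in> S \<Longrightarrow> g x \<noteq> 0) \<Longrightarrow>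
    smooth_on S (\<lambda>x. f x / g x)"
  unfolding smooth_on_def by (simp_all add: Ck_on_mult Ck_on_divide)

lemma [smooth_intros]:
  fixes f g :: "'a::real_normed_vector \<Rightarrow> 'b::real_normed_vector"
  shows smooth_on_const: "smooth_on S (\<lambda>x. c)"
  and smooth_on_ident: "open S \<Longrightarrow> smooth_on S (\<lambda>x. x)"
  and smooth_on_add: "open S \<Longrightarrow> smooth_on S f \<Longrightarrow> smooth_on S g \<Longrightarrow> smooth_on S (\<lambda>x. f x + g x)"
  and smooth_on_diff: "open S \<Longrightarrow> smooth_on S f \<Longrightarrow> smooth_on S g \<Longrightarrow> smooth_on S (\<lambda>x. f x - g x)"
  unfolding smooth_on_def by (simp_all add: Ck_on_const Ck_on_ident Ck_on_add Ck_on_diff)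

lemma [smooth_intros]:
  shows smooth_on_Pair: "open S \<Longrightarrow> smooth_on S f \<Longrightarrow> smooth_on S g \<Longrightarrow> smooth_on S (\<lambda>x. (f x, g x))"
  and smooth_on_fst: "open S \<Longrightarrow> smooth_on S h \<Longrightarrow> smooth_on S (\<lambda>x. fst (h x))"
  and smooth_on_snd: "open S \<Longrightarrow> smooth_on S h \<Longrightarrow> smooth_on S (\<lambda>x. snd (h x))"
  unfolding smooth_on_def by (simp_all add: Ck_on_Pair Ck_on_fst Ck_on_snd)

lemma smooth_on_vec_nth [smooth_intros]:
  fixes f :: "'a::real_normed_vector \<Rightarrow> real^'n"
  shows "open S \<Longrightarrow> smooth_on S f \<Longrightarrow> smooth_on S (\<lambda>x. f x $ i)"
  by (rule smooth_on_linear_comp[OF _ bounded_linear_vec_nth])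

lemma bounded_linear_vector_2_fst: "bounded_linear (\<lambda>u::real. vector [u, 0] :: real^2)"
  unfolding linear_conv_bounded_linear[symmetric] by (rule linearI) (auto simp: vec_eq_iff forall_2)

lemma bounded_linear_vector_2_snd: "bounded_linear (\<lambda>u::real. vector [0, u] :: real^2)"
  unfolding linear_conv_bounded_linear[symmetric] by (rule linearI) (auto simp: vec_eq_iff forall_2)

lemma vector_2_eq_add: "vector [a, b] = (vector [a, 0] + vector [0, b] :: real^2)"
  by (auto simp: vec_eq_iff forall_2)

lemma smooth_on_vector_2 [smooth_intros]:
  fixes f g :: "'a::real_normed_vector \<Rightarrow> real"
  assumes "open S" "smooth_on S f" "smooth_on S g"
  shows "smooth_on S (\<lambda>x. vector [f x, g x] :: real^2)"
proof -
  have "smooth_on S (\<lambda>x. vector [f x, 0] + vector [0, g x] :: real^2)"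
    by (intro smooth_on_add assms smooth_on_linear_comp[OF assms(1) bounded_linear_vector_2_fst]
        smooth_on_linear_comp[OF assms(1) bounded_linear_vector_2_snd])
  then show ?thesis by (simp add: vector_2_eq_add[symmetric])
qed


section \<open>Scalar differential equations with parameters\<close>

text \<open>This is the integral of \<open>f\<close> from 0 to \<open>t\<close>, for either sign of
  \<open>t\<close>, after the substitution that moves the variable limit into the integrand.
  Dependence on \<open>t\<close> and on parameters is then covered by integrals over a fixed
  interval.\<close>

definition primitive :: "(real \<Rightarrow> real) \<Rightarrow> real \<Rightarrow> real" where
  "primitive f t = t * integral {0..1} (\<lambda>s. f (t * s))"

lemma primitive_0 [simp]: "primitive f 0 = 0"
  by (simp add: primitive_def)

lemma abs_mult_unit_less:
  fixes t s r :: real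
  assumes "\<bar>t\<bar> < r" "0 \<le> s" "s \<le> 1"
  shows "\<bar>t * s\<bar> < r"
proof -
  have "\<bar>t * s\<bar> \<le> \<bar>t\<bar> * 1"
    unfolding abs_mult using assms by (intro mult_left_mono) auto
  then show ?thesis using assms by simp
qed

lemma primitive_has_derivative:
  assumes "continuous_on {-r<..<r} f" "\<bar>t\<bar> < r"
  shows "(primitive f has_real_derivative f t) (at t)"
proof -
  \<comment> \<open>\<open>f\<close> is continuous on an open interval only, while the
    antiderivative is taken on a compact one; \<open>\<rho>\<close> leaves room on both
    sides.\<close>
  obtain \<rho> where \<rho>: "\<bar>t\<bar> < \<rho>" "\<rho> < r" using assms(2) dense by blast
  have "continuous_on {-\<rho>..\<rho>} f"
    by (rule continuous_on_subset[OF assms(1)]) (use \<rho> in auto)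
  then obtain G where G: "\<And>x. x \<in> {-\<rho>..\<rho>} \<Longrightarrow> (G has_vector_derivative f x) (at x within {-\<rho>..\<rho>})"
    using antiderivative_continuous by blast
  have G': "(G has_real_derivative f x) (at x)" if "\<bar>x\<bar> < \<rho>" for x
  proof -
    have x: "-\<rho> < x" "x < \<rho>" using that by linarith+
    then have "at x within {-\<rho>..\<rho>} = at x" by (intro at_within_interior) simp
    then show ?thesis using G[of x] x by (simp add: has_real_derivative_iff_has_vector_derivative)
  qed
  have eq: "primitive f u = G u - G 0" if u: "\<bar>u\<bar> < \<rho>" for u
  proof -
    have "((\<lambda>s. u * f (u * s)) has_integral (G (u * 1) - G (u * 0))) {0..1}"
    proof (rule fundamental_theorem_of_calculus)
      fix s :: real assume s: "s \<in> {0..1}"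
      then have "\<bar>u * s\<bar> < \<rho>" using abs_mult_unit_less[OF u] by auto
      then have "((\<lambda>s. G (u * s)) has_real_derivative f (u * s) * u) (at s)"
        by (intro DERIV_chain'[of "\<lambda>s. u * s" u s UNIV G] G') (auto intro!: derivative_eq_intros)
      then show "((\<lambda>s. G (u * s)) has_vector_derivative u * f (u * s)) (at s within {0..1})"
        by (simp add: has_real_derivative_iff_has_vector_derivative mult.commute
            has_vector_derivative_at_within)
    qed simp
    then have "integral {0..1} (\<lambda>s. u * f (u * s)) = G u - G 0"
      unfolding mult_1_right mult_zero_right by (rule integral_unique)
    moreover have "integral {0..1} (\<lambda>s. u * f (u * s)) = u * integral {0..1} (\<lambda>s. f (u * s))"
      by (rule integral_mult_right)
    ultimately show ?thesis by (simp add: primitive_def)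
  qed
  have "((\<lambda>u. G u - G 0) has_real_derivative f t) (at t)"
    using G'[OF \<rho>(1)] by (auto intro!: derivative_eq_intros)
  then show ?thesis
    by (rule has_field_derivative_transform_within_open[of _ _ _ "{-\<rho><..<\<rho>}"]) (use \<rho> eq in auto)
qed

lemma primitive_continuous_on:
  assumes "continuous_on {-r<..<r} f"
  shows "continuous_on {-r<..<r} (primitive f)"
proof (rule continuous_at_imp_continuous_on, rule ballI)
  fix t assume "t \<in> {-r<..<r}"
  then have "\<bar>t\<bar> < r" by auto
  from DERIV_isCont[OF primitive_has_derivative[OF assms this]] show "isCont (primitive f) t" .
qed

text \<open>Variation of constants with initial value 0. The explicit formula, rather than the
  existence of a solution, is what later shows how the solution depends on parameters.\<close>

lemma linear_ode_has_derivative: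
  fixes A B :: "real \<Rightarrow> real"
  assumes "continuous_on {-r<..<r} A" "continuous_on {-r<..<r} B" "\<bar>t\<bar> < r"
  defines "K \<equiv> (\<lambda>t. exp (primitive A t) * primitive (\<lambda>s. exp (- primitive A s) * B s) t)"
  shows "(K has_real_derivative A t * K t + B t) (at t)"
proof -
  have "continuous_on {-r<..<r} (\<lambda>s. exp (- primitive A s) * B s)"
    by (intro continuous_intros assms primitive_continuous_on)
  note 1 = primitive_has_derivative[OF this assms(3)]
  show ?thesis unfolding K_def
    by (rule derivative_eq_intros 1 primitive_has_derivative[OF assms(1,3)] refl)+
      (simp add: algebra_simps exp_minus)
qed

text \<open>The integrating factor \<open>exp (- primitive A t)\<close> turns \<open>d\<close> into
  a function with zero derivative, so no growth estimate is needed.\<close>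

lemma linear_ode_unique:
  fixes A d :: "real \<Rightarrow> real"
  assumes "continuous_on {-r<..<r} A" "\<bar>t\<bar> < r" "d 0 = 0"
    and d: "\<And>t. \<bar>t\<bar> < r \<Longrightarrow> (d has_real_derivative A t * d t) (at t)"
  shows "d t = 0"
proof -
  have "((\<lambda>t. d t * exp (- primitive A t)) has_real_derivative 0) (at s within {-r<..<r})"
    if "s \<in> {-r<..<r}" for s
  proof -
    have s: "\<bar>s\<bar> < r" using that by auto
    have "((\<lambda>t. d t * exp (- primitive A t)) has_real_derivative 0) (at s)"
      by (rule derivative_eq_intros d[OF s] primitive_has_derivative[OF assms(1) s] refl)+ simp
    then show ?thesis by (rule has_field_derivative_at_within)
  qed
  then have "\<exists>c. \<forall>s\<in>{-r<..<r}. d s * exp (- primitive A s) = c"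
    using has_field_derivative_zero_constant[of "{-r<..<r}" "\<lambda>t. d t * exp (- primitive A t)"]
    by auto
  moreover have "0 \<in> {-r<..<r}" "t \<in> {-r<..<r}" using assms(2) by auto
  ultimately have "d t * exp (- primitive A t) = d 0 * exp (- primitive A 0)" by metis
  then show ?thesis using assms(3) by simp
qed

lemma Ck_on_prim:
  fixes G :: "real \<times> 'p::euclidean_space \<Rightarrow> real"
  assumes "open S" "Ck_on k ({-r<..<r} \<times> S) G"
  shows "Ck_on k ({-r<..<r} \<times> S) (\<lambda>z. primitive (\<lambda>s. G (s, snd z)) (fst z))"
proof -
  let ?M = "{-r<..<r} \<times> S"
  \<comment> \<open>\<open>m\<close> is the substitution inside \<open>primitive\<close>. Its
    preimage \<open>T\<close> is open and contains the closed unit interval times the strip, because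
    the strip is star-shaped in time about 0.\<close>
  define m :: "real \<times> real \<times> 'p \<Rightarrow> real \<times> 'p" where "m = (\<lambda>u. (fst (snd u) * fst u, snd (snd u)))"
  define T where "T = m -` ?M"
  have oM: "open ?M" using assms(1) by (simp add: open_Times)
  have "continuous_on UNIV m" unfolding m_def by (intro continuous_intros)
  then have oT: "open T" unfolding T_def using oM open_vimage by blast
  have "Ck_on k T m" unfolding m_def
    by (intro Ck_on_Pair Ck_on_mult Ck_on_fst Ck_on_snd Ck_on_ident oT)
  then have "Ck_on k T (\<lambda>u. G (m u))"
    by (intro Ck_on_compose[OF oT oM _ assms(2)]) (auto simp: T_def)
  moreover have "{0..1} \<times> ?M \<subseteq> T"
    using abs_mult_unit_less[of _ r] by (force simp: T_def m_def abs_less_iff)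
  ultimately have "Ck_on k ?M (\<lambda>z. integral {0..1} (\<lambda>s. G (m (s, z))))"
    by (intro Ck_on_integral_unit_interval[OF oT oM, where f = "\<lambda>u. G (m u)"])
  then have "Ck_on k ?M (\<lambda>z. fst z * integral {0..1} (\<lambda>s. G (m (s, z))))"
    by (intro Ck_on_mult Ck_on_fst Ck_on_ident oM)
  then show ?thesis by (simp add: primitive_def m_def)
qed

text \<open>The factor that vanishes at \<open>x\<close> makes the product differentiable although
  \<open>k\<close> is merely continuous. This is how a solution becomes differentiable in its
  parameters when its difference quotients are only known to be continuous.\<close>

lemma has_derivative_vanishing_factor:
  fixes k :: "'a::euclidean_space \<Rightarrow> real"
  assumes "isCont k x"
  shows "((\<lambda>y. ((y - x) \<bullet> i) * k y) has_derivative (\<lambda>h. (h \<bullet> i) * k x)) (at x)"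
  unfolding has_derivative_at_alt
proof (intro conjI allI impI)
  show "bounded_linear (\<lambda>h. (h \<bullet> i) * k x)"
    by (intro bounded_linear_mult_const bounded_linear_inner_left)
  fix e :: real assume "e > 0"
  \<comment> \<open>The \<open>+ 1\<close> excludes a division by zero when
    \<open>i = 0\<close>.\<close>
  then have e': "e / (norm i + 1) > 0"
    by (simp add: add_nonneg_pos)
  then obtain d where d: "d > 0" "\<And>y. dist y x < d \<Longrightarrow> dist (k y) (k x) < e / (norm i + 1)"
    using assms unfolding continuous_at_eps_delta by metis
  have "norm ((y - x) \<bullet> i * k y - (x - x) \<bullet> i * k x - (y - x) \<bullet> i * k x) \<le> e * norm (y - x)"
    if "norm (y - x) < d" for y
  proof -
    have "norm ((y - x) \<bullet> i * k y - (x - x) \<bullet> i * k x - (y - x) \<bullet> i * k x) =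
        \<bar>(y - x) \<bullet> i\<bar> * \<bar>k y - k x\<bar>"
      by (simp add: abs_mult[symmetric] algebra_simps)
    also have "\<dots> \<le> (norm (y - x) * norm i) * (e / (norm i + 1))"
      using d(2)[of y] that
      by (intro mult_mono Cauchy_Schwarz_ineq2) (auto simp: dist_norm)
    also have "\<dots> = norm (y - x) * (norm i * (e / (norm i + 1)))" by simp
    also have "\<dots> \<le> norm (y - x) * ((norm i + 1) * (e / (norm i + 1)))"
      using e' by (intro mult_left_mono mult_right_mono) auto
    also have "\<dots> = e * norm (y - x)"
      by (simp add: add_nonneg_eq_0_iff)
    finally show ?thesis .
  qed
  then show "\<exists>d>0. \<forall>y. norm (y - x) < d \<longrightarrow>
      norm ((y - x) \<bullet> i * k y - (x - x) \<bullet> i * k x - (y - x) \<bullet> i * k x) \<le> e * norm (y - x)"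
    using d(1) by blast
qed

text \<open>The mean value theorem in integral form: unlike an intermediate point, the average of
  the derivative depends continuously on both end points.\<close>

lemma difference_eq_integral:
  fixes b :: "'a::euclidean_space \<Rightarrow> real"
  assumes "open T" "smooth_on T b" "closed_segment x y \<subseteq> T"
  shows "((\<lambda>s. D b (x + s *\<^sub>R (y - x)) (y - x)) has_integral b y - b x) {0..1}"
proof -
  have "((\<lambda>s. D b (x + s *\<^sub>R (y - x)) (y - x)) has_integral
      b (x + 1 *\<^sub>R (y - x)) - b (x + 0 *\<^sub>R (y - x))) {0..1}"
  proof (rule fundamental_theorem_of_calculus)
    fix s :: real assume s: "s \<in> {0..1}"
    then have "x + s *\<^sub>R (y - x) \<in> closed_segment x y"
      by (auto simp: in_segment algebra_simps)
    then have inT: "x + s *\<^sub>R (y - x) \<in> T" using assms(3) by auto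
    have 1: "((\<lambda>s. x + s *\<^sub>R (y - x)) has_derivative (\<lambda>h. h *\<^sub>R (y - x))) (at s within {0..1})"
      by (auto intro!: derivative_eq_intros)
    have l: "linear (D b (x + s *\<^sub>R (y - x)))"
      using smooth_on_has_derivative[OF assms(2) inT] has_derivative_linear by blast
    show "((\<lambda>s. b (x + s *\<^sub>R (y - x))) has_vector_derivative
        D b (x + s *\<^sub>R (y - x)) (y - x)) (at s within {0..1})"
      unfolding has_vector_derivative_def
      using has_derivative_compose[OF 1 smooth_on_has_derivative[OF assms(2) inT]]
      by (simp add: linear_cmul[OF l])
  qed simp
  then show ?thesis by simp
qed

lemma derivative_linear:
  "smooth_on T b \<Longrightarrow> z \<in> T \<Longrightarrow> linear (D b z)"
  using smooth_on_has_derivative has_derivative_linear by blast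

lemma Ck_on_integral_segment:
  fixes g :: "'b::euclidean_space \<Rightarrow> real" and x y :: "'a::euclidean_space \<Rightarrow> 'b"
  assumes "open S" "open T" "Ck_on k T g" "Ck_on k S x" "Ck_on k S y"
    and seg: "\<And>z. z \<in> S \<Longrightarrow> closed_segment (x z) (y z) \<subseteq> T"
  shows "Ck_on k S (\<lambda>z. integral {0..1} (\<lambda>s. g (x z + s *\<^sub>R (y z - x z))))"
proof -
  define m where "m = (\<lambda>u. x (snd u) + fst u *\<^sub>R (y (snd u) - x (snd u)))"
  have oU: "open (UNIV \<times> S :: (real \<times> 'a) set)" using assms(1) by (simp add: open_Times)
  have snd: "Ck_on k (UNIV \<times> S :: (real \<times> 'a) set) (\<lambda>u. h (snd u))" if "Ck_on k S h" for h :: "'a \<Rightarrow> 'b"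
    by (rule Ck_on_compose[OF oU assms(1) _ that Ck_on_snd[OF oU Ck_on_ident[OF oU]]]) auto
  have m: "Ck_on k (UNIV \<times> S) m" unfolding m_def
    by (intro Ck_on_add Ck_on_scaleR Ck_on_diff snd assms Ck_on_fst Ck_on_ident oU)
  \<comment> \<open>The segments lie in \<open>T\<close> for parameters in the unit interval only;
    this preimage is the open neighbourhood on which the integrand has class
    \<open>k\<close>.\<close>
  define V where "V = (UNIV \<times> S) \<inter> m -` T"
  have oV: "open V" unfolding V_def
    by (rule continuous_open_preimage[OF Ck_on_continuous[OF m] oU assms(2)])
  have "Ck_on k V (\<lambda>u. g (m u))"
    by (rule Ck_on_compose[OF oV assms(2) _ assms(3) Ck_on_subset[OF m]]) (auto simp: V_def)
  moreover have "{0..1} \<times> S \<subseteq> V"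
  proof
    fix u :: "real \<times> 'a" assume u: "u \<in> {0..1} \<times> S"
    then have "m u \<in> closed_segment (x (snd u)) (y (snd u))"
      by (auto simp: m_def in_segment algebra_simps)
    then show "u \<in> V" using seg[of "snd u"] u by (auto simp: V_def)
  qed
  ultimately have "Ck_on k S (\<lambda>z. integral {0..1} (\<lambda>s. g (m (s, z))))"
    by (intro Ck_on_integral_unit_interval[OF oV assms(1), where f = "\<lambda>u. g (m u)"])
  then show ?thesis by (simp add: m_def)
qed

text \<open>
  The difference of two solutions satisfies a scalar linear equation whose coefficients are
  averages of the derivatives of \<open>b\<close> along a segment. Solving it explicitly gives the parameter
  derivatives of \<open>w\<close> as a formula in \<open>w\<close> itself, so that \<open>w\<close> gains one derivative at a time.
\<close>

lemma scalar_ode_smooth: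
  fixes b :: "real \<times> real \<times> 'p::euclidean_space \<Rightarrow> real" and w :: "real \<times> 'p \<Rightarrow> real"
  assumes T: "open T" "convex T" "smooth_on T b" and S: "open S" "convex S"
    and cont: "continuous_on ({-r<..<r} \<times> S) w"
    and inT: "\<And>t p. \<bar>t\<bar> < r \<Longrightarrow> p \<in> S \<Longrightarrow> (t, w (t, p), p) \<in> T"
    and init: "\<And>p. p \<in> S \<Longrightarrow> w (0, p) = 0"
    and ode: "\<And>t p. \<bar>t\<bar> < r \<Longrightarrow> p \<in> S \<Longrightarrow>
      ((\<lambda>t. w (t, p)) has_real_derivative b (t, w (t, p), p)) (at t)"
  shows "smooth_on ({-r<..<r} \<times> S) w"
proof -
  let ?M = "{-r<..<r} \<times> S"
  let ?M2 = "{-r<..<r} \<times> S \<times> S"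
  \<comment> \<open>\<open>e\<close> lifts \<open>(t, p)\<close> to the graph of \<open>w\<close>;
    \<open>x\<close> and \<open>y\<close> are the graph points over two parameters at a common time.
    \<open>A\<close> and \<open>B i\<close> average the derivatives of \<open>b\<close> between
    them, in the slot of \<open>w\<close> and in the parameter direction \<open>i\<close>.
    \<open>K i\<close> is the variation of constants solution of \<open>K' = A K + B i\<close> that
    vanishes at time 0.\<close>
  define e where "e = (\<lambda>z. (fst z, w z, snd z :: 'p))"
  define x where "x = (\<lambda>z :: real \<times> 'p \<times> 'p. e (fst z, fst (snd z)))"
  define y where "y = (\<lambda>z :: real \<times> 'p \<times> 'p. e (fst z, snd (snd z)))"
  define avg where "avg v = (\<lambda>z. integral {0..1} (\<lambda>s. D b (x z + s *\<^sub>R (y z - x z)) v))" for v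
  define A where "A = avg (0, 1, 0)"
  define B where "B i = avg (0, 0, i)" for i :: 'p
  define K where "K i z = exp (primitive (\<lambda>s. A (s, snd z)) (fst z)) *
    primitive (\<lambda>s. exp (- primitive (\<lambda>s. A (s, snd z)) s) * B i (s, snd z)) (fst z)" for i z
  have oM: "open ?M" and oM2: "open ?M2" and oSS: "open (S \<times> S)"
    using S by (auto intro: open_Times)
  have eT: "e z \<in> T" if "z \<in> ?M" for z
    using that inT[of "fst z" "snd z"] by (auto simp: e_def)
  have e_cont: "continuous_on ?M e" unfolding e_def
    by (intro continuous_intros cont)
  \<comment> \<open>For two independent parameters only continuity is claimed, since nothing more is
    known of \<open>w\<close> yet. Higher classes will be needed on the diagonal alone.\<close>
  have xy: "Ck_on 0 ?M2 x" "Ck_on 0 ?M2 y" unfolding x_def y_def Ck_on.simps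
    by (rule continuous_on_compose2[OF e_cont]; auto intro!: continuous_intros)+
  have seg: "closed_segment (x z) (y z) \<subseteq> T" if "z \<in> ?M2" for z
    by (rule closed_segment_subset[OF _ _ T(2)]) (use that in \<open>auto simp: x_def y_def intro!: eT\<close>)
  have Ck0: "Ck_on 0 ?M2 (avg v)" for v unfolding avg_def
    by (rule Ck_on_integral_segment[OF oM2 T(1) _ xy seg])
      (use smooth_on_Ck[OF smooth_on_derivative[OF T(3)], of 0] in auto)
  have K0: "Ck_on 0 ?M2 (K i)" for i
  proof -
    have E: "Ck_on 0 ?M2 (\<lambda>z. primitive (\<lambda>s. A (s, snd z)) (fst z))"
      using Ck0 by (intro Ck_on_prim oSS) (simp add: A_def)
    have "Ck_on 0 ?M2 (\<lambda>z. exp (- primitive (\<lambda>s. A (s, snd z)) (fst z)) * B i z)"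
      using Ck0 by (intro Ck_on_mult Ck_on_exp Ck_on_minus E oM2) (simp add: B_def)
    from Ck_on_prim[OF oSS this]
    show ?thesis unfolding K_def fst_conv snd_conv
      by (intro Ck_on_mult Ck_on_exp E oM2)
  qed
  have diff_eq: "w (t, q) - w (t, p) = (\<Sum>i\<in>Basis. ((q - p) \<bullet> i) * K i (t, p, q))"
    if t: "\<bar>t\<bar> < r" and p: "p \<in> S" and q: "q \<in> S" for t p q
  proof -
    have slice: "continuous_on {-r<..<r} (\<lambda>s. avg v (s, p, q))" for v
      by (rule continuous_on_compose2[OF Ck0[of v, unfolded Ck_on.simps]])
        (use p q in \<open>auto intro!: continuous_intros\<close>)
    have K': "((\<lambda>t. K i (t, p, q)) has_real_derivative
        A (s, p, q) * K i (s, p, q) + B i (s, p, q)) (at s)" if "\<bar>s\<bar> < r" for i s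
      using linear_ode_has_derivative[OF slice slice that, of "(0, 1, 0)" "(0, 0, i)"]
      by (simp add: K_def A_def B_def)
    \<comment> \<open>Both sides of the claim satisfy the same inhomogeneous linear equation and
      vanish at time 0, so their difference \<open>d\<close> solves the homogeneous one.\<close>
    define d where "d = (\<lambda>t. w (t, q) - w (t, p) - (\<Sum>i\<in>Basis. ((q - p) \<bullet> i) * K i (t, p, q)))"
    have "d t = 0"
    proof (rule linear_ode_unique[OF _ t])
      show "continuous_on {-r<..<r} (\<lambda>s. A (s, p, q))" unfolding A_def by (rule slice)
      show "d 0 = 0" using init p q by (simp add: d_def K_def)
      fix s :: real assume s: "\<bar>s\<bar> < r"
      let ?z = "(s, p, q)"
      have z: "?z \<in> ?M2" using s p q by (auto simp: abs_less_iff)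
      have yx: "y ?z - x ?z = (0, w (s, q) - w (s, p), q - p)"
        by (simp add: x_def y_def e_def)
      have pt: "x ?z + \<theta> *\<^sub>R (y ?z - x ?z) \<in> T" if "\<theta> \<in> {0..1}" for \<theta>
      proof -
        have "x ?z + \<theta> *\<^sub>R (y ?z - x ?z) \<in> closed_segment (x ?z) (y ?z)"
          using that by (auto simp: in_segment algebra_simps)
        then show ?thesis using seg[OF z] by blast
      qed
      \<comment> \<open>Both end points carry the same time, so the increment has no time component
        and only the derivatives averaged in \<open>A\<close> and \<open>B\<close> occur.\<close>
      have lin: "D b \<zeta> (y ?z - x ?z) = (w (s, q) - w (s, p)) * D b \<zeta> (0, 1, 0) +
          (\<Sum>i\<in>Basis. ((q - p) \<bullet> i) * D b \<zeta> (0, 0, i))" if "\<zeta> \<in> T" for \<zeta>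
      proof -
        have l: "linear (D b \<zeta>)" using derivative_linear[OF T(3) that] .
        have "(0, w (s, q) - w (s, p), q - p) = (w (s, q) - w (s, p)) *\<^sub>R (0, 1, 0) +
            (\<Sum>i\<in>Basis. ((q - p) \<bullet> i) *\<^sub>R (0 :: real, 0 :: real, i))"
          by (simp add: prod_eq_iff fst_sum snd_sum euclidean_representation)
        then show ?thesis unfolding yx
          by (simp only: linear_add[OF l] linear_cmul[OF l] linear_sum[OF l] real_scaleR_def)
      qed
      have int: "(\<lambda>\<theta>. D b (x ?z + \<theta> *\<^sub>R (y ?z - x ?z)) v) integrable_on {0..1}" for v
      proof (rule integrable_continuous_interval)
        have "continuous_on T (\<lambda>z. D b z v)"
          using smooth_on_continuous[OF smooth_on_derivative[OF T(3)]] .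
        then show "continuous_on {0..1} (\<lambda>\<theta>. D b (x ?z + \<theta> *\<^sub>R (y ?z - x ?z)) v)"
          by (rule continuous_on_compose2) (use pt in \<open>auto intro!: continuous_intros\<close>)
      qed
      have "b (s, w (s, q), q) - b (s, w (s, p), p) =
          integral {0..1} (\<lambda>\<theta>. D b (x ?z + \<theta> *\<^sub>R (y ?z - x ?z)) (y ?z - x ?z))"
        using integral_unique[OF difference_eq_integral[OF T(1,3) seg[OF z]]]
        by (simp add: x_def y_def e_def)
      also have "\<dots> = integral {0..1} (\<lambda>\<theta>.
          (w (s, q) - w (s, p)) * D b (x ?z + \<theta> *\<^sub>R (y ?z - x ?z)) (0, 1, 0) +
          (\<Sum>i\<in>Basis. ((q - p) \<bullet> i) * D b (x ?z + \<theta> *\<^sub>R (y ?z - x ?z)) (0, 0, i)))"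
        by (rule integral_cong) (rule lin[OF pt])
      also have "\<dots> = (w (s, q) - w (s, p)) * A ?z + (\<Sum>i\<in>Basis. ((q - p) \<bullet> i) * B i ?z)"
        unfolding A_def B_def avg_def
        by (subst integral_add integral_sum; (intro integrable_sum integrable_on_mult_right int finite_Basis)?)+
          simp
      finally have bb: "b (s, w (s, q), q) - b (s, w (s, p), p) =
        (w (s, q) - w (s, p)) * A ?z + (\<Sum>i\<in>Basis. ((q - p) \<bullet> i) * B i ?z)" .
      show "(d has_real_derivative A ?z * d s) (at s)" unfolding d_def
        by (rule derivative_eq_intros ode[OF s q] ode[OF s p] K'[OF s] refl)+
          (simp add: bb algebra_simps sum.distrib sum_distrib_left sum_subtractf)
    qed
    then show ?thesis by (simp add: d_def)
  qed
  \<comment> \<open>Candidate for the total derivative: the time part is the equation itself, the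
    parameter part is the limit of the coefficients in \<open>diff_eq\<close> as \<open>q\<close>
    tends to \<open>p\<close>.\<close>
  define w' where "w' z v = b (e z) * fst v + (\<Sum>i\<in>Basis. (snd v \<bullet> i) * K i (fst z, snd z, snd z))"
    for z v
  have deriv: "(w has_derivative w' z) (at z)" if z: "z \<in> ?M" for z
  proof -
    obtain t p where tp: "z = (t, p)" by force
    then have t: "\<bar>t\<bar> < r" and p: "p \<in> S" using z by auto
    have 1: "((\<lambda>q. w (t, q)) has_derivative (\<lambda>h. \<Sum>i\<in>Basis. (h \<bullet> i) * K i (t, p, p))) (at p within S)"
    proof -
      have "isCont (\<lambda>q. K i (t, p, q)) p" for i
      proof -
        have "continuous_on S (\<lambda>q. K i (t, p, q))"
          by (rule continuous_on_compose2[OF K0[of i, unfolded Ck_on.simps]])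
            (use t p in \<open>auto intro!: continuous_intros\<close>)
        then show ?thesis using S(1) p continuous_on_eq_continuous_at by blast
      qed
      then have "((\<lambda>q. ((q - p) \<bullet> i) * K i (t, p, q)) has_derivative
          (\<lambda>h. (h \<bullet> i) * K i (t, p, p))) (at p within S)" for i
        by (rule has_derivative_at_withinI[OF has_derivative_vanishing_factor])
      then have "((\<lambda>q. w (t, p) + (\<Sum>i\<in>Basis. ((q - p) \<bullet> i) * K i (t, p, q))) has_derivative
          (\<lambda>h. 0 + (\<Sum>i\<in>Basis. (h \<bullet> i) * K i (t, p, p)))) (at p within S)"
        by (intro has_derivative_add has_derivative_const has_derivative_sum)
      then have "((\<lambda>q. w (t, q)) has_derivative
          (\<lambda>h. 0 + (\<Sum>i\<in>Basis. (h \<bullet> i) * K i (t, p, p)))) (at p within S)"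
        by (rule has_derivative_transform[OF p, rotated]) (simp add: diff_eq[OF t p, symmetric])
      then show ?thesis by simp
    qed
    have 2: "((\<lambda>t. w (t, q)) has_derivative blinfun_apply (blinfun_mult_right (b (e (s, q)))))
        (at s within {-r<..<r})" if "q \<in> S" "s \<in> {-r<..<r}" for q s
    proof (rule has_derivative_at_withinI)
      show "((\<lambda>t. w (t, q)) has_derivative blinfun_apply (blinfun_mult_right (b (e (s, q))))) (at s)"
        using ode[of s q] that by (auto simp: has_field_derivative_def e_def abs_less_iff)
    qed
    have be: "continuous_on ?M (\<lambda>z. b (e z))"
      by (rule continuous_on_compose2[OF smooth_on_continuous[OF T(3)] e_cont]) (use eT in auto)
    have "continuous_on (S \<times> {-r<..<r}) (\<lambda>(q, s). blinfun_mult_right (b (e (s, q))))"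
      unfolding case_prod_unfold
      by (intro bounded_linear.continuous_on[OF bounded_linear_blinfun_mult_right]
          continuous_on_compose2[OF be]) (auto intro!: continuous_intros)
    then have 3: "continuous (at (p, t) within S \<times> {-r<..<r}) (\<lambda>(q, s). blinfun_mult_right (b (e (s, q))))"
      using p t by (auto simp: continuous_on_eq_continuous_within abs_less_iff)
    \<comment> \<open>The rule for partial derivatives asks for a continuous second partial and, for
      the first, only a derivative at the point. The variables are swapped so that time comes
      second, since its derivative \<open>b (e z)\<close> is continuous along with
      \<open>w\<close>.\<close>
    have "((\<lambda>(q, s). w (s, q)) has_derivative (\<lambda>(h, \<tau>).
        (\<Sum>i\<in>Basis. (h \<bullet> i) * K i (t, p, p)) + blinfun_mult_right (b (e (t, p))) \<tau>))
        (at (p, t) within S \<times> {-r<..<r})"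
      by (rule has_derivative_partialsI[OF 1 2 3]) (use t in \<open>auto simp: abs_less_iff\<close>)
    moreover have "at (p, t) within S \<times> {-r<..<r} = at (p, t)"
      using S p t by (intro at_within_open open_Times) (auto simp: abs_less_iff)
    ultimately have 4: "((\<lambda>(q, s). w (s, q)) has_derivative (\<lambda>(h, \<tau>).
        (\<Sum>i\<in>Basis. (h \<bullet> i) * K i (t, p, p)) + b (e (t, p)) * \<tau>)) (at (snd z, fst z))"
      by (simp add: tp)
    have "((\<lambda>z. (snd z, fst z)) has_derivative (\<lambda>v. (snd v, fst v))) (at z)"
      by (auto intro!: derivative_eq_intros)
    from has_derivative_compose[OF this 4] show ?thesis
      by (simp add: w'_def[abs_def] tp add.commute)
  qed
  have "Ck_on k ?M w" for k
  proof (induction k)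
    case 0
    then show ?case using cont by simp
  next
    case (Suc k)
    have e: "Ck_on k ?M e" unfolding e_def
      by (intro Ck_on_Pair Ck_on_fst Ck_on_snd Ck_on_ident Suc oM)
    have be: "Ck_on k ?M (\<lambda>z. b (e z))"
      by (rule Ck_on_compose[OF oM T(1) _ smooth_on_Ck[OF T(3)] e]) (use eT in auto)
    have Dbe: "Ck_on k ?M (\<lambda>z. D b (e z) v)" for v
      by (rule Ck_on_compose[OF oM T(1) _ smooth_on_Ck[OF smooth_on_derivative[OF T(3)]] e])
        (use eT in auto)
    \<comment> \<open>For equal parameters the segment shrinks to a point and the averages become
      derivatives of \<open>b\<close> on the graph of \<open>w\<close>. Hence \<open>w'\<close> is
      built from \<open>w\<close> and smooth data, and inherits the class of
      \<open>w\<close>.\<close>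
    have avg_diag: "avg v (s, p, p) = D b (e (s, p)) v" for v s p
      by (simp add: avg_def x_def y_def)
    have E: "Ck_on k ?M (\<lambda>z. primitive (\<lambda>s. D b (e (s, snd z)) (0, 1, 0)) (fst z))"
      by (intro Ck_on_prim S Dbe)
    have "Ck_on k ?M (\<lambda>z. exp (- primitive (\<lambda>s. D b (e (s, snd z)) (0, 1, 0)) (fst z)) * D b (e z) (0, 0, i))"
      for i
      by (intro Ck_on_mult Ck_on_exp Ck_on_minus E Dbe oM)
    from Ck_on_prim[OF S(1) this]
    have "Ck_on k ?M (\<lambda>z. K i (fst z, snd z, snd z))" for i
      unfolding K_def A_def B_def fst_conv snd_conv avg_diag
      by (intro Ck_on_mult Ck_on_exp E oM)
    then have "Ck_on k ?M (\<lambda>z. w' z v)" for v unfolding w'_def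
      by (intro Ck_on_add Ck_on_mult Ck_on_sum Ck_on_const be oM)
    then show ?case by (intro Ck_on_SucI[OF oM deriv])
  qed
  then show ?thesis by (simp add: smooth_on_def)
qed

section \<open>Local solutions by the contraction principle\<close>

lemma smooth_on_lipschitz_cbox:
  fixes b :: "'a::euclidean_space \<Rightarrow> real"
  assumes "cbox l h \<subseteq> T" "smooth_on T b"
  obtains L where "L \<ge> 0" "\<And>x y. x \<in> cbox l h \<Longrightarrow> y \<in> cbox l h \<Longrightarrow> \<bar>b x - b y\<bar> \<le> L * dist x y"
proof -
  have "\<exists>C. \<forall>z\<in>cbox l h. \<bar>D b z i\<bar> \<le> C" for i
  proof -
    have "continuous_on (cbox l h) (\<lambda>z. D b z i)"
      using smooth_on_continuous[OF smooth_on_derivative[OF assms(2)]] assms(1)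
        continuous_on_subset by blast
    then have "bounded ((\<lambda>z. D b z i) ` cbox l h)"
      using compact_imp_bounded compact_continuous_image compact_cbox by blast
    then show ?thesis unfolding bounded_iff by auto
  qed
  then obtain C where C: "\<And>i z. z \<in> cbox l h \<Longrightarrow> \<bar>D b z i\<bar> \<le> C i" by metis
  define L where "L = (\<Sum>i\<in>Basis. \<bar>C i\<bar>)"
  have L0: "L \<ge> 0" by (simp add: L_def sum_nonneg)
  have der: "(b has_derivative D b z) (at z)" if "z \<in> cbox l h" for z
    using smooth_on_has_derivative[OF assms(2)] assms(1) that by auto
  have on: "onorm (D b z) \<le> L" if z: "z \<in> cbox l h" for z
  proof (rule onorm_le)
    fix v
    have "D b z v = (\<Sum>i\<in>Basis. (v \<bullet> i) *\<^sub>R D b z i)"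
      using der[OF z] by (intro derivative_eq_sum_Basis) (auto simp: differentiable_def)
    also have "norm \<dots> \<le> (\<Sum>i\<in>Basis. \<bar>C i\<bar> * norm v)"
    proof (rule sum_norm_le)
      fix i :: 'a assume i: "i \<in> Basis"
      have "norm ((v \<bullet> i) *\<^sub>R D b z i) = \<bar>v \<bullet> i\<bar> * \<bar>D b z i\<bar>" by (simp add: abs_mult)
      also have "\<dots> \<le> norm v * \<bar>C i\<bar>"
        using C[OF z, of i] Basis_le_norm[OF i, of v] by (intro mult_mono) auto
      finally show "norm ((v \<bullet> i) *\<^sub>R D b z i) \<le> \<bar>C i\<bar> * norm v" by (simp add: mult.commute)
    qed
    finally show "norm (D b z v) \<le> L * norm v" by (simp add: L_def sum_distrib_right)
  qed
  have "\<bar>b x - b y\<bar> \<le> L * dist x y" if "x \<in> cbox l h" "y \<in> cbox l h" for x y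
    using differentiable_bound[OF convex_box(1) has_derivative_at_withinI[OF der] on that(1) that(2)]
    by (simp add: dist_norm)
  with L0 show ?thesis using that by blast
qed

text \<open>Picard's argument for all parameters at once, so that the fixed point is jointly
  continuous, as \<open>scalar_ode_smooth\<close> requires. Clamping the argument to a box makes
  \<open>b\<close> bounded and Lipschitz everywhere, so the integral operator acts on all bounded
  continuous functions; a short time interval keeps the fixed point in the region where clamping
  changes nothing.\<close>

theorem scalar_ode_exists:
  fixes b :: "real \<times> real \<times> 'p::euclidean_space \<Rightarrow> real"
  assumes "open T" "smooth_on T b" "(0, 0, p0) \<in> T"
  obtains r S w where "r > 0" "open S" "p0 \<in> S" "smooth_on ({-r<..<r} \<times> S) w"
    "\<And>p. p \<in> S \<Longrightarrow> w (0, p) = 0"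
    "\<And>t p. \<bar>t\<bar> < r \<Longrightarrow> p \<in> S \<Longrightarrow> (t, w (t, p), p) \<in> T"
    "\<And>t p. \<bar>t\<bar> < r \<Longrightarrow> p \<in> S \<Longrightarrow> ((\<lambda>t. w (t, p)) has_real_derivative b (t, w (t, p), p)) (at t)"
proof -
  obtain l h where lh: "(0, 0, p0) \<in> box l h" "cbox l h \<subseteq> T"
    using open_contains_cbox[OF assms(1,3)] by metis
  have box_T: "box l h \<subseteq> T" using lh(2) box_subset_cbox by blast
  define B where "B z = b (clamp l h z)" for z
  have le: "l \<bullet> i \<le> h \<bullet> i" if "i \<in> Basis" for i
    using lh(1) that by (force simp: mem_box)
  have cl: "clamp l h z \<in> cbox l h" for z using clamp_in_interval[OF le] .
  have B_eq: "B z = b z" if "z \<in> box l h" for z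
    using clamp_cancel_cbox[of z l h] subsetD[OF box_subset_cbox that] by (simp add: B_def)
  obtain L where L: "L \<ge> 0" "\<And>x y. x \<in> cbox l h \<Longrightarrow> y \<in> cbox l h \<Longrightarrow> \<bar>b x - b y\<bar> \<le> L * dist x y"
    using smooth_on_lipschitz_cbox[OF lh(2) assms(2)] by blast
  have B_lip: "\<bar>B x - B y\<bar> \<le> L * dist x y" for x y
    using L(2)[OF cl cl, of x y] mult_left_mono[OF dist_clamps_le_dist_args[of l h x y] L(1)]
    unfolding B_def by linarith
  have cb: "continuous_on (cbox l h) b"
    using smooth_on_continuous[OF assms(2)] lh(2) continuous_on_subset by blast
  have B_cont: "continuous_on UNIV B" unfolding B_def
    by (rule clamp_continuous_on[OF cb])
  obtain C where C: "C > 0" "\<And>z. \<bar>B z\<bar> \<le> C"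
  proof -
    have "bounded (b ` cbox l h)"
      using compact_imp_bounded compact_continuous_image[OF cb] compact_cbox by blast
    then obtain c where "\<And>z. z \<in> cbox l h \<Longrightarrow> \<bar>b z\<bar> \<le> c" unfolding bounded_iff by auto
    then have "\<bar>B z\<bar> \<le> max c 1" for z unfolding B_def using cl[of z] by (meson le_max_iff_disj)
    then show ?thesis using that[of "max c 1"] by auto
  qed
  obtain \<epsilon> S where \<epsilon>: "\<epsilon> > 0" and S: "open S" "convex S" "p0 \<in> S"
    and eS: "\<And>t x p. \<bar>t\<bar> < \<epsilon> \<Longrightarrow> \<bar>x\<bar> < \<epsilon> \<Longrightarrow> p \<in> S \<Longrightarrow> (t, x, p) \<in> box l h"
  proof -
    obtain e where e: "e > 0" "ball (0, 0, p0) e \<subseteq> box l h"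
      using lh(1) open_box openE by blast
    show ?thesis
    proof (rule that[of "e/3" "ball p0 (e/3)"])
      fix t x :: real and p assume a: "\<bar>t\<bar> < e/3" "\<bar>x\<bar> < e/3" "p \<in> ball p0 (e/3)"
      have "dist (0, 0, p0) (t, x, p) \<le> dist 0 t + dist (0, p0) (x, p)"
        unfolding dist_Pair_Pair by (rule sqrt_sum_squares_le_sum) auto
      also have "dist (0, p0) (x, p) \<le> dist 0 x + dist p0 p"
        unfolding dist_Pair_Pair by (rule sqrt_sum_squares_le_sum) auto
      finally have "dist (0, 0, p0) (t, x, p) < e" using a by (simp add: dist_norm)
      then show "(t, x, p) \<in> box l h" using e(2) by auto
    qed (use e in auto)
  qed
  \<comment> \<open>The first bound keeps time inside the box, the second gives the contraction
    constant \<open>r * L < 1\<close>, the third keeps solutions, which are bounded by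
    \<open>r * C\<close>, below \<open>\<epsilon>\<close>. The \<open>L + 1\<close> allows for
    \<open>L = 0\<close>.\<close>
  define r where "r = min (\<epsilon> / 2) (min (1 / (2 * (L + 1))) (\<epsilon> / (2 * C)))"
  have r: "r > 0" "r < \<epsilon>" "r * L < 1" "r * C < \<epsilon>"
  proof -
    show "r > 0" using \<epsilon> L(1) C(1) by (simp add: r_def)
    show "r < \<epsilon>" using \<epsilon> by (simp add: r_def min_def)
    have "r * L \<le> 1 / (2 * (L + 1)) * L" using L(1) by (intro mult_right_mono) (auto simp: r_def)
    also have "\<dots> < 1" using L(1) by (simp add: field_simps)
    finally show "r * L < 1" .
    have "r * C \<le> \<epsilon> / (2 * C) * C" using C(1) by (intro mult_right_mono) (auto simp: r_def)
    also have "\<dots> < \<epsilon>" using C(1) \<epsilon> by simp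
    finally show "r * C < \<epsilon>" .
  qed
  \<comment> \<open>Freezing time outside \<open>[-r, r]\<close> gives an operator on functions of
    all times and parameters whose contraction constant is uniform.\<close>
  define c where "c t = max (- r) (min r t)" for t
  have c_le: "\<bar>c t\<bar> \<le> r" for t using r(1) by (auto simp: c_def)
  have c_eq: "c t = t" if "\<bar>t\<bar> < r" for t using that by (auto simp: c_def)
  have c_cont: "continuous_on UNIV c" unfolding c_def by (intro continuous_intros)
  define I where "I v z = integral {0..1} (\<lambda>s. B (c (fst z) * s, v (c (fst z) * s, snd z), snd z))"
    for v :: "real \<times> 'p \<Rightarrow> real" and z
  have cont_arg: "continuous_on UNIV (\<lambda>u. B (c (fst (fst u)) * snd u, v (c (fst (fst u)) * snd u, snd (fst u)), snd (fst u)))"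
    if "continuous_on UNIV v" for v :: "real \<times> 'p \<Rightarrow> real"
    by (rule continuous_on_compose2[OF B_cont])
      (intro continuous_intros continuous_on_compose2[OF c_cont] continuous_on_compose2[OF that] | simp)+
  have int: "(\<lambda>s. B (c t * s, v (c t * s, p), p)) integrable_on {0..1}"
    if "continuous_on UNIV v" for v :: "real \<times> 'p \<Rightarrow> real" and t p
    by (rule integrable_continuous_interval,
        rule continuous_on_compose2[OF cont_arg[OF that], where f = "\<lambda>s. ((t, p), s)", simplified])
      (intro continuous_intros)
  have I_cont: "continuous_on UNIV (I v)" if "continuous_on UNIV v" for v
  proof -
    have "continuous_on (UNIV \<times> cbox 0 1)
        (\<lambda>(z, s). B (c (fst z) * s, v (c (fst z) * s, snd z), snd z))"
      unfolding case_prod_unfold by (rule continuous_on_subset[OF cont_arg[OF that]]) simp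
    from integral_continuous_on_param[OF this] show ?thesis by (simp add: I_def[abs_def])
  qed
  have I_le: "\<bar>I v z\<bar> \<le> C" if "continuous_on UNIV v" for v z
  proof -
    have "continuous_on {0..1} (\<lambda>s. B (c (fst z) * s, v (c (fst z) * s, snd z), snd z))"
      by (rule continuous_on_compose2[OF cont_arg[OF that], where f = "\<lambda>s. (z, s)", simplified])
        (intro continuous_intros)
    from integral_bound[OF _ this, of C] show ?thesis using C(2) by (simp add: I_def)
  qed
  define F where "F v = Bcontfun (\<lambda>z. c (fst z) * I (apply_bcontfun v) z)" for v
  have cI_le: "\<bar>c t * I v z\<bar> \<le> r * C" if "continuous_on UNIV v" for t v z
    unfolding abs_mult using c_le I_le[OF that] r(1) by (intro mult_mono) auto
  have F: "apply_bcontfun (F v) z = c (fst z) * I (apply_bcontfun v) z" for v z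
  proof -
    have "(\<lambda>z. c (fst z) * I (apply_bcontfun v) z) \<in> bcontfun"
      unfolding bcontfun_def
    proof (intro CollectI conjI)
      show "continuous_on UNIV (\<lambda>z. c (fst z) * I (apply_bcontfun v) z)"
        by (intro continuous_intros I_cont continuous_on_compose2[OF c_cont]) auto
      show "bounded (range (\<lambda>z. c (fst z) * I (apply_bcontfun v) z))"
        unfolding bounded_iff using cI_le by (intro exI[of _ "r * C"]) auto
    qed
    then show ?thesis unfolding F_def by (simp add: Bcontfun_inverse)
  qed
  have "\<exists>!v. F v = v"
  proof (rule banach_fix_type)
    show "0 \<le> r * L" using r(1) L(1) by simp
    show "r * L < 1" by fact
    show "\<forall>v v'. dist (F v) (F v') \<le> r * L * dist v v'"
    proof (intro allI dist_bound)
      fix v v' :: "(real \<times> 'p) \<Rightarrow>\<^sub>C real" and z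
      let ?g = "\<lambda>v s. B (c (fst z) * s, apply_bcontfun v (c (fst z) * s, snd z), snd z)"
      have i: "?g v integrable_on {0..1}" for v by (rule int) auto
      have "\<bar>?g v s - ?g v' s\<bar> \<le> L * dist v v'" for s
      proof -
        have "\<bar>?g v s - ?g v' s\<bar> \<le> L * dist (apply_bcontfun v (c (fst z) * s, snd z)) (apply_bcontfun v' (c (fst z) * s, snd z))"
          using B_lip[of "(c (fst z) * s, apply_bcontfun v (c (fst z) * s, snd z), snd z)"
            "(c (fst z) * s, apply_bcontfun v' (c (fst z) * s, snd z), snd z)"]
          by (simp add: dist_Pair_Pair)
        also have "\<dots> \<le> L * dist v v'" by (intro mult_left_mono dist_bounded L(1))
        finally show ?thesis .
      qed
      then have "norm (integral {0..1} (\<lambda>s. ?g v s - ?g v' s)) \<le> integral {0..1} (\<lambda>s::real. L * dist v v')"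
        by (intro integral_norm_bound_integral integrable_diff i) auto
      then have "\<bar>I (apply_bcontfun v) z - I (apply_bcontfun v') z\<bar> \<le> L * dist v v'"
        by (simp add: I_def integral_diff[OF i i])
      then have "\<bar>c (fst z)\<bar> * \<bar>I (apply_bcontfun v) z - I (apply_bcontfun v') z\<bar> \<le> r * (L * dist v v')"
        using c_le r(1) by (intro mult_mono) auto
      then show "dist (apply_bcontfun (F v) z) (apply_bcontfun (F v') z) \<le> r * L * dist v v'"
        by (simp add: F dist_real_def abs_mult[symmetric] right_diff_distrib)
    qed
  qed
  then obtain v where v: "F v = v" by blast
  define w where "w = apply_bcontfun v"
  have w_cont: "continuous_on UNIV w" by (simp add: w_def)
  have w_eq: "w (t, p) = primitive (\<lambda>s. B (s, w (s, p), p)) t" if "\<bar>t\<bar> < r" for t p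
    using F[of v "(t, p)"] c_eq[OF that] by (simp add: v w_def[symmetric] primitive_def I_def)
  have w_le: "\<bar>w z\<bar> \<le> r * C" for z
    using cI_le[OF w_cont] F[of v z] by (simp add: v w_def[symmetric])
  have in_box: "(t, w (t, p), p) \<in> box l h" if "\<bar>t\<bar> < r" "p \<in> S" for t p
    using that r w_le[of "(t, p)"] by (intro eS) auto
  have ode: "((\<lambda>t. w (t, p)) has_real_derivative b (t, w (t, p), p)) (at t)"
    if t: "\<bar>t\<bar> < r" and p: "p \<in> S" for t p
  proof -
    have "continuous_on {-r<..<r} (\<lambda>s. B (s, w (s, p), p))"
      by (rule continuous_on_compose2[OF B_cont])
        (intro continuous_intros continuous_on_compose2[OF w_cont] | simp)+
    from primitive_has_derivative[OF this t]
    have "(primitive (\<lambda>s. B (s, w (s, p), p)) has_real_derivative b (t, w (t, p), p)) (at t)"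
      using B_eq[OF in_box[OF t p]] by simp
    then show ?thesis
      by (rule has_field_derivative_transform_within_open[of _ _ _ "{-r<..<r}"])
        (use t w_eq in \<open>auto simp: abs_less_iff\<close>)
  qed
  have w0: "w (0, p) = 0" for p using w_eq[of 0 p] r(1) by simp
  have "smooth_on ({-r<..<r} \<times> S) w"
    by (rule scalar_ode_smooth[OF open_box convex_box(2) smooth_on_subset[OF assms(2) box_T] S(1,2)
          continuous_on_subset[OF w_cont] in_box w0 ode]) auto
  with r(1) S(1,3) show ?thesis
    using that[of r S w] w0 in_box box_T ode by blast
qed


section \<open>Inverse functions and first integrals\<close>

text \<open>The derivative of \<open>g\<close> at \<open>y\<close> depends smoothly on the value
  \<open>g y\<close>. Whatever class \<open>g\<close> has, its derivative therefore has too, which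
  raises the class of \<open>g\<close> by one; continuity starts the process.\<close>

lemma smooth_on_bootstrap:
  fixes g :: "'a::euclidean_space \<Rightarrow> 'b::euclidean_space"
  assumes "open U" "open V" "continuous_on V g" "g ` V \<subseteq> U"
    and "\<And>y. y \<in> V \<Longrightarrow> (g has_derivative K (g y)) (at y)"
    and "\<And>v. smooth_on U (\<lambda>x. K x v)"
  shows "smooth_on V g"
proof -
  have "Ck_on k V g" for k
  proof (induction k)
    case 0
    then show ?case using assms(3) by simp
  next
    case (Suc k)
    have "Ck_on k V (\<lambda>y. K (g y) v)" for v
      by (rule Ck_on_compose[OF assms(2,1,4) smooth_on_Ck[OF assms(6)] Suc])
    then show ?case by (intro Ck_on_SucI[OF assms(2,5)])
  qed
  then show ?thesis by (simp add: smooth_on_def)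
qed

text \<open>Keeping the other variables makes the derivative of \<open>(f z, snd z)\<close>
  triangular, so the entry \<open>D f z (1, 0)\<close> alone decides invertibility. The inverse
  \<open>K\<close> of that derivative is an explicit quotient, from which smoothness of the inverse
  map follows by bootstrapping.\<close>

lemma inverse_in_first_variable:
  fixes f :: "real \<times> 'q::euclidean_space \<Rightarrow> real"
  assumes N: "open N" "smooth_on N f" "z0 \<in> N" and nz: "D f z0 (1, 0) \<noteq> 0"
  obtains U V g where "open U" "U \<subseteq> N" "z0 \<in> U" "open V"
    "homeomorphism U V (\<lambda>z. (f z, snd z)) g" "smooth_on V g"
proof -
  define N1 where "N1 = N \<inter> (\<lambda>z. D f z (1, 0)) -` (- {0})"
  have oN1: "open N1" unfolding N1_def
    by (rule continuous_open_preimage[OF smooth_on_continuous[OF smooth_on_derivative[OF N(2)]] N(1)]) auto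
  have N1: "z \<in> N" "D f z (1, 0) \<noteq> 0" if "z \<in> N1" for z using that by (auto simp: N1_def)
  define F where "F z = Blinfun (\<lambda>v. (D f z v, snd v))" for z
  define K where "K z v = ((fst v - D f z (0, snd v)) / D f z (1, 0), snd v)" for z v
  have der: "(f has_derivative D f z) (at z)" if "z \<in> N1" for z
    using smooth_on_has_derivative[OF N(2) N1(1)[OF that]] .
  have bl: "bounded_linear (\<lambda>v. (D f z v, snd v))" if "z \<in> N1" for z
    by (intro bounded_linear_Pair bounded_linear_snd has_derivative_bounded_linear[OF der[OF that]])
  have F: "blinfun_apply (F z) = (\<lambda>v. (D f z v, snd v))" if "z \<in> N1" for z
    unfolding F_def by (rule bounded_linear_Blinfun_apply[OF bl[OF that]])
  have split: "D f z v = fst v * D f z (1, 0) + D f z (0, snd v)" if "z \<in> N1" for z v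
  proof -
    have l: "linear (D f z)" using has_derivative_linear[OF der[OF that]] .
    have "D f z v = D f z (fst v *\<^sub>R (1, 0) + (0, snd v))" by (cases v) simp
    then show ?thesis by (simp only: linear_add[OF l] linear_cmul[OF l] real_scaleR_def)
  qed
  have FK: "blinfun_apply (F z) (K z v) = v" "K z (blinfun_apply (F z) v) = v" if "z \<in> N1" for z v
  proof -
    show "blinfun_apply (F z) (K z v) = v"
      unfolding F[OF that] using N1(2)[OF that]
      by (subst split[OF that]) (simp add: K_def)
    show "K z (blinfun_apply (F z) v) = v"
      unfolding F[OF that] using N1(2)[OF that] split[OF that, of v]
      by (simp add: K_def prod_eq_iff)
  qed
  have blK: "bounded_linear (K z)" if "z \<in> N1" for z
  proof -
    have "bounded_linear (\<lambda>v. D f z (0, snd v))"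
      by (rule bounded_linear_compose[OF has_derivative_bounded_linear[OF der[OF that]]
            bounded_linear_Pair[OF bounded_linear_zero bounded_linear_snd]])
    then show ?thesis unfolding K_def[abs_def] divide_inverse
      by (intro bounded_linear_Pair bounded_linear_snd bounded_linear_mult_const
          bounded_linear_sub bounded_linear_fst)
  qed
  have z0: "z0 \<in> N1" using N(3) nz by (simp add: N1_def)
  have invF: "Blinfun (K z0) o\<^sub>L F z0 = id_blinfun"
    using FK(2)[OF z0] by (intro blinfun_eqI) (simp add: bounded_linear_Blinfun_apply[OF blK[OF z0]])
  have derF: "((\<lambda>z. (f z, snd z)) has_derivative blinfun_apply (F z)) (at z)" if "z \<in> N1" for z
    unfolding F[OF that] by (auto intro!: derivative_eq_intros der[OF that])
  have contF: "continuous_on N1 F"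
  proof (rule continuous_on_blinfun_componentwise)
    fix i :: "real \<times> 'q"
    have "continuous_on N1 (\<lambda>z. (D f z i, snd i))"
      by (intro continuous_intros continuous_on_subset[OF
            smooth_on_continuous[OF smooth_on_derivative[OF N(2)]]]) (auto simp: N1_def)
    then show "continuous_on N1 (\<lambda>z. blinfun_apply (F z) i)"
      by (rule continuous_on_eq) (simp add: F)
  qed
  obtain U V g g' where U: "open U" "U \<subseteq> N1" "z0 \<in> U" and V: "open V" "(f z0, snd z0) \<in> V"
    and hom: "homeomorphism U V (\<lambda>z. (f z, snd z)) g"
    and g': "\<And>y. y \<in> V \<Longrightarrow> (g has_derivative g' y) (at y)"
      "\<And>y. y \<in> V \<Longrightarrow> g' y = inv (blinfun_apply (F (g y)))"
      "\<And>y. y \<in> V \<Longrightarrow> bij (blinfun_apply (F (g y)))"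
    by (rule inverse_function_theorem[OF oN1 derF contF z0 invF])
      (assumption, rule that, assumption, assumption, assumption, assumption, assumption, assumption, blast+)
  have gU: "g ` V \<subseteq> U" using hom by (auto simp: homeomorphism_def)
  have "g' y = K (g y)" if "y \<in> V" for y
  proof -
    have "g y \<in> N1" using gU U(2) that by auto
    then show ?thesis unfolding g'(2)[OF that]
      by (intro inv_unique_comp) (auto simp: FK)
  qed
  then have gd: "(g has_derivative K (g y)) (at y)" if "y \<in> V" for y
    using g'(1)[OF that] that by simp
  have "smooth_on N1 (\<lambda>z. D f z w)" for w
    using smooth_on_subset[OF smooth_on_derivative[OF N(2)]] by (auto simp: N1_def)
  then have "smooth_on N1 (\<lambda>z. K z v)" for v unfolding K_def
    by (intro smooth_intros oN1 N1)
  then have "smooth_on V g"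
    by (intro smooth_on_bootstrap[OF oN1 V(1) _ _ gd])
      (use hom gU U(2) in \<open>auto simp: homeomorphism_def\<close>)
  moreover have "U \<subseteq> N" using U(2) N1(1) by blast
  ultimately show ?thesis using that U V(1) hom by blast
qed

lemma has_derivative_fst_slice:
  assumes "(f has_derivative f') (at (x, q))"
  shows "((\<lambda>x. f (x, q)) has_derivative (\<lambda>h. f' (h, 0))) (at x)"
proof -
  have "((\<lambda>x. (x, q)) has_derivative (\<lambda>h. (h, 0))) (at x)"
    by (auto intro!: derivative_eq_intros)
  from has_derivative_compose[OF this assms] show ?thesis .
qed

text \<open>Characteristics of \<open>\<psi>\<^sub>y + a \<psi>\<^sub>x = 0\<close>: with
  \<open>y\<close> as time, follow \<open>dx/dy = a\<close> from a foot \<open>\<xi>\<close> on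
  \<open>y = 0\<close>. The position reached is a smooth function of the foot, and inverting it
  gives \<open>\<psi>\<close>, the foot of the characteristic through a given point.\<close>

lemma first_integral_exists:
  fixes a :: "real \<times> real \<times> real \<Rightarrow> real"
  assumes N: "open N" "smooth_on N a" "(x0, 0, \<alpha>0) \<in> N"
  obtains U \<psi> where "open U" "U \<subseteq> N" "(x0, 0, \<alpha>0) \<in> U" "smooth_on U \<psi>"
    "\<And>z. z \<in> U \<Longrightarrow> D \<psi> z (a z, 1, 0) = 0"
    "\<And>x \<alpha>. (x, 0, \<alpha>) \<in> U \<Longrightarrow> \<psi> (x, 0, \<alpha>) = x"
proof -
  \<comment> \<open>The existence theorem has initial value 0, so its unknown is the displacement
    from the foot. \<open>m\<close> recovers the point \<open>(\<xi> + w, t, \<alpha>)\<close> from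
    time, displacement and the parameters \<open>(\<xi>, \<alpha>)\<close>.\<close>
  define m :: "real \<times> real \<times> real \<times> real \<Rightarrow> real \<times> real \<times> real"
    where "m = (\<lambda>u. (fst (snd (snd u)) + fst (snd u), fst u, snd (snd (snd u))))"
  define T where "T = m -` N"
  have "continuous_on UNIV m" unfolding m_def by (intro continuous_intros)
  then have oT: "open T" unfolding T_def using N(1) open_vimage by blast
  have "smooth_on T m" unfolding m_def by (intro smooth_intros oT)
  then have "smooth_on T (\<lambda>u. a (m u))"
    by (rule smooth_on_compose[OF N(2) _ oT N(1)]) (simp add: T_def)
  moreover have "(0, 0, (x0, \<alpha>0)) \<in> T" using N(3) by (simp add: T_def m_def)
  ultimately obtain r S w where r: "r > 0" and S: "open S" "(x0, \<alpha>0) \<in> S"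
    and w: "smooth_on ({-r<..<r} \<times> S) w" and w0: "\<And>p. p \<in> S \<Longrightarrow> w (0, p) = 0"
    and "\<And>t p. \<bar>t\<bar> < r \<Longrightarrow> p \<in> S \<Longrightarrow> (t, w (t, p), p) \<in> T"
    and ode: "\<And>t p. \<bar>t\<bar> < r \<Longrightarrow> p \<in> S \<Longrightarrow>
      ((\<lambda>t. w (t, p)) has_real_derivative a (m (t, w (t, p), p))) (at t)"
    by (rule scalar_ode_exists[OF oT]) (rule that; (assumption | blast))
  define j :: "real \<times> real \<times> real \<Rightarrow> real \<times> real \<times> real"
    where "j = (\<lambda>z. (fst (snd z), fst z, snd (snd z)))"
  define N2 where "N2 = j -` ({-r<..<r} \<times> S)"
  have "continuous_on UNIV j" unfolding j_def by (intro continuous_intros)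
  moreover have oM: "open ({-r<..<r} \<times> S)" using S(1) by (simp add: open_Times)
  ultimately have oN2: "open N2" unfolding N2_def using open_vimage by blast
  have N2: "(\<xi>, t, \<alpha>) \<in> N2 \<longleftrightarrow> \<bar>t\<bar> < r \<and> (\<xi>, \<alpha>) \<in> S" for \<xi> t \<alpha>
    by (auto simp: N2_def j_def)
  \<comment> \<open>\<open>f\<close> is the position reached at height \<open>t\<close> from the
    foot \<open>\<xi>\<close>. At height 0 it is the identity in \<open>\<xi>\<close>, which makes
    it invertible nearby.\<close>
  define f where "f z = fst z + w (j z)" for z
  have "smooth_on N2 j" unfolding j_def by (intro smooth_intros oN2)
  then have "smooth_on N2 (\<lambda>z. w (j z))"
    by (rule smooth_on_compose[OF w _ oN2 oM]) (simp add: N2_def)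
  then have f: "smooth_on N2 f" unfolding f_def by (intro smooth_intros oN2)
  have f0: "f (\<xi>, 0, \<alpha>) = \<xi>" if "(\<xi>, 0, \<alpha>) \<in> N2" for \<xi> \<alpha>
    using that w0 by (simp add: N2 f_def j_def)
  let ?z0 = "(x0, 0, \<alpha>0) :: real \<times> real \<times> real"
  have z0: "?z0 \<in> N2" using r S by (simp add: N2)
  have "((\<lambda>\<xi>. f (\<xi>, (0, \<alpha>0))) has_derivative (\<lambda>h. D f ?z0 (h, 0))) (at x0)"
    by (rule has_derivative_fst_slice[OF smooth_on_has_derivative[OF f z0]])
  moreover have "((\<lambda>\<xi>. f (\<xi>, (0, \<alpha>0))) has_derivative (\<lambda>h. h)) (at x0)"
  proof (rule has_derivative_transform_within_open[of "\<lambda>\<xi>. \<xi>" _ _ _ "(\<lambda>\<xi>. (\<xi>, (0, \<alpha>0))) -` N2"])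
    show "open ((\<lambda>\<xi>. (\<xi>, (0, \<alpha>0))) -` N2)"
      by (intro open_vimage oN2 continuous_intros)
  qed (use z0 f0 in auto)
  ultimately have "(\<lambda>h. D f ?z0 (h, 0)) = (\<lambda>h. h)" by (rule has_derivative_unique)
  from fun_cong[OF this, of 1] have nz: "D f ?z0 (1, 0) \<noteq> 0" by simp
  obtain U1 V g where U1: "open U1" "U1 \<subseteq> N2" "?z0 \<in> U1" and V: "open V"
    and hom: "homeomorphism U1 V (\<lambda>z. (f z, snd z)) g" and g: "smooth_on V g"
    by (rule inverse_in_first_variable[OF oN2 f z0 nz]) (rule that; (assumption | blast))
  have gf: "g (f z, snd z) = z" if "z \<in> U1" for z using hom that by (simp add: homeomorphism_def)
  have fV: "(f z, snd z) \<in> V" if "z \<in> U1" for z using hom that by (auto simp: homeomorphism_def)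
  have fg: "(f (g z), snd (g z)) = z" "g z \<in> U1" if "z \<in> V" for z
    using hom that by (auto simp: homeomorphism_def)
  \<comment> \<open>\<open>V\<close> is where \<open>\<psi>\<close> is defined; membership in
    \<open>U1\<close> lets a point with \<open>y = 0\<close> count as its own foot, which gives the
    initial values.\<close>
  define U where "U = U1 \<inter> V \<inter> N"
  define \<psi> where "\<psi> z = fst (g z)" for z
  have oU: "open U" using U1 V N by (auto simp: U_def)
  have "?z0 \<in> V" using fV[OF U1(3)] f0[OF z0] by simp
  then have "?z0 \<in> U" using U1 N by (simp add: U_def)
  moreover have \<psi>: "smooth_on U \<psi>" unfolding \<psi>_def
    by (intro smooth_intros oU smooth_on_subset[OF g]) (auto simp: U_def)
  moreover have "\<psi> (x, 0, \<alpha>) = x" if "(x, 0, \<alpha>) \<in> U" for x \<alpha>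
    using gf[of "(x, 0, \<alpha>)"] f0[of x \<alpha>] that U1(2) by (auto simp: U_def \<psi>_def)
  moreover have "D \<psi> z (a z, 1, 0) = 0" if z: "z \<in> U" for z
  proof -
    obtain x y \<alpha> where xya: "z = (x, y, \<alpha>)" by (cases z)
    have zV: "z \<in> V" using z by (simp add: U_def)
    define \<xi> where "\<xi> = fst (g z)"
    have gz1: "g z = (\<xi>, y, \<alpha>)"
      using fg(1)[OF zV] by (auto simp: xya \<xi>_def prod_eq_iff)
    have gz: "g z = (\<xi>, y, \<alpha>)" "f (\<xi>, y, \<alpha>) = x"
      using fg(1)[OF zV] by (simp_all add: gz1) (simp add: xya)
    have inU1: "(\<xi>, y, \<alpha>) \<in> U1" using fg(2)[OF zV] gz by simp
    then have y: "\<bar>y\<bar> < r" "(\<xi>, \<alpha>) \<in> S" using U1(2) N2 by auto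
    \<comment> \<open>The characteristic through \<open>z\<close> has velocity
      \<open>(a z, 1, 0)\<close> there, and \<open>\<psi>\<close> has the constant value
      \<open>\<xi>\<close> along it. Comparing the two resulting derivatives gives the transport
      equation.\<close>
    have "((\<lambda>t. f (\<xi>, t, \<alpha>)) has_real_derivative a z) (at y)"
      using ode[OF y] gz(2) unfolding f_def j_def m_def
      by (auto intro!: derivative_eq_intros simp: xya)
    then have "((\<lambda>t. (f (\<xi>, t, \<alpha>), t, \<alpha>)) has_derivative (\<lambda>h. (a z * h, h, 0))) (at y)"
      unfolding has_field_derivative_def by (intro has_derivative_Pair) auto
    moreover have "(\<psi> has_derivative D \<psi> z) (at (f (\<xi>, y, \<alpha>), y, \<alpha>))"
      using smooth_on_has_derivative[OF \<psi> z] gz(2) by (simp add: xya)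
    ultimately have "((\<lambda>t. \<psi> (f (\<xi>, t, \<alpha>), t, \<alpha>)) has_derivative (\<lambda>h. D \<psi> z (a z * h, h, 0))) (at y)"
      using has_derivative_compose by blast
    moreover have "((\<lambda>t. \<psi> (f (\<xi>, t, \<alpha>), t, \<alpha>)) has_derivative (\<lambda>h. 0)) (at y)"
    proof (rule has_derivative_transform_within_open[of "\<lambda>t. \<xi>" _ _ _ "(\<lambda>t. (\<xi>, t, \<alpha>)) -` U1"])
      show "open ((\<lambda>t. (\<xi>, t, \<alpha>)) -` U1)"
        by (intro open_vimage U1 continuous_intros)
      show "\<xi> = \<psi> (f (\<xi>, t, \<alpha>), t, \<alpha>)" if "t \<in> (\<lambda>t. (\<xi>, t, \<alpha>)) -` U1" for t
        using gf[of "(\<xi>, t, \<alpha>)"] that by (simp add: \<psi>_def)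
    qed (use inU1 in auto)
    ultimately have "(\<lambda>h. D \<psi> z (a z * h, h, 0)) = (\<lambda>h. 0)" by (rule has_derivative_unique)
    from fun_cong[OF this, of 1] show ?thesis by simp
  qed
  ultimately show ?thesis using that[of U \<psi>] oU by (auto simp: U_def)
qed


section \<open>Normal form coordinates\<close>

lemma derivative_at: "(f has_derivative f') (at x) \<Longrightarrow> D f x = f'"
  by (rule frechet_derivative_at[symmetric])

lemma derivative_triple:
  fixes f :: "real \<times> real \<times> real \<Rightarrow> real"
  assumes "linear f"
  shows "f v = fst v * f (1, 0, 0) + fst (snd v) * f (0, 1, 0) + snd (snd v) * f (0, 0, 1)"
proof -
  have "f v = f (fst v *\<^sub>R (1, 0, 0) + fst (snd v) *\<^sub>R (0, 1, 0) + snd (snd v) *\<^sub>R (0, 0, 1))"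
    by (cases v) simp
  then show ?thesis by (simp only: linear_add[OF assms] linear_cmul[OF assms] real_scaleR_def)
qed

text \<open>
  The new coordinate is \<open>X = q(\<psi>, 0, \<alpha>) + c y\<close> with \<open>q = P2 / M2\<close> and \<open>\<psi>\<close> a first integral
  of \<open>(M1, M2)\<close>. On \<open>y = 0\<close> it equals \<open>q\<close>, and the value of \<open>c\<close> makes the gradients of \<open>X\<close>
  and \<open>q\<close> agree at the bifurcation point.
\<close>

lemma normal_form_coordinates:
  fixes P1 P2 M1 M2 :: "real \<times> real \<times> real \<Rightarrow> real" and x0 \<alpha>0 :: real
  defines "\<zeta>0 \<equiv> (x0, 0, \<alpha>0)"
  assumes N: "open N" "\<zeta>0 \<in> N"
    and P1: "smooth_on N P1" and P2: "smooth_on N P2" and M1: "smooth_on N M1" and M2: "smooth_on N M2"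
    and zero: "P1 \<zeta>0 = 0" "P2 \<zeta>0 = 0" and M2_nz: "\<And>\<zeta>. \<zeta> \<in> N \<Longrightarrow> M2 \<zeta> \<noteq> 0"
    and J: "D P1 \<zeta>0 (1, 0, 0) = J11" "D P1 \<zeta>0 (0, 1, 0) = J12" "D P1 \<zeta>0 (0, 0, 1) = a1"
      "D P2 \<zeta>0 (1, 0, 0) = J21" "D P2 \<zeta>0 (0, 1, 0) = J22" "D P2 \<zeta>0 (0, 0, 1) = a2"
    and m: "M1 \<zeta>0 = m1" "M2 \<zeta>0 = m2"
    and \<tau>: "\<tau> = (J11 + J22) / m2" and \<delta>: "\<delta> = (J11 * J22 - J12 * J21) / m2\<^sup>2"
    and c: "c = (J22 + m1 / m2 * J21) / m2" and k: "k = (J21 * a1 - J11 * a2) / m2\<^sup>2"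
    and nz: "J21 \<noteq> 0" "k \<noteq> 0"
  obtains U V X \<Psi> t1 t2 where
    "open U" "U \<subseteq> N" "\<zeta>0 \<in> U" "open V" "smooth_on U X" "smooth_on V \<Psi>" "X \<zeta>0 = 0"
    "\<And>x y \<alpha>. (x, y, \<alpha>) \<in> U \<Longrightarrow> (X (x, y, \<alpha>), y, k * (\<alpha> - \<alpha>0)) \<in> V \<and>
      \<Psi> (X (x, y, \<alpha>), y, k * (\<alpha> - \<alpha>0)) = (x, y, \<alpha>)"
    "\<And>u y \<mu>. (u, y, \<mu>) \<in> V \<Longrightarrow> \<exists>x. \<Psi> (u, y, \<mu>) = (x, y, \<alpha>0 + \<mu> / k) \<and>
      (x, y, \<alpha>0 + \<mu> / k) \<in> U \<and> X (x, y, \<alpha>0 + \<mu> / k) = u"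
    "smooth_on V t1" "smooth_on V t2" "t1 0 = 0" "D t1 0 = (\<lambda>v. 0)" "t2 0 = 0" "D t2 0 = (\<lambda>v. 0)"
    "\<And>x \<mu>. (x, 0, \<mu>) \<in> V \<Longrightarrow> t2 (x, 0, \<mu>) = 0"
    "\<And>x y \<alpha>. (x, y, \<alpha>) \<in> U \<Longrightarrow> D X (x, y, \<alpha>) (P1 (x, y, \<alpha>), P2 (x, y, \<alpha>), 0) =
      M2 (x, y, \<alpha>) * (k * (\<alpha> - \<alpha>0) + \<tau> * X (x, y, \<alpha>) - \<delta> * y + t1 (X (x, y, \<alpha>), y, k * (\<alpha> - \<alpha>0)))"
    "\<And>x y \<alpha>. (x, y, \<alpha>) \<in> U \<Longrightarrow> P2 (x, y, \<alpha>) =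
      M2 (x, y, \<alpha>) * (X (x, y, \<alpha>) + t2 (X (x, y, \<alpha>), y, k * (\<alpha> - \<alpha>0)))"
    "\<And>\<zeta>. \<zeta> \<in> U \<Longrightarrow> D X \<zeta> (M1 \<zeta>, M2 \<zeta>, 0) = M2 \<zeta> * c"
proof -
  have m2: "m2 \<noteq> 0" using M2_nz[OF N(2)] m by simp
  define q where "q \<zeta> = P2 \<zeta> / M2 \<zeta>" for \<zeta>
  define a where "a \<zeta> = M1 \<zeta> / M2 \<zeta>" for \<zeta>
  have q: "smooth_on N q" unfolding q_def by (intro smooth_intros N P2 M2 M2_nz)
  have a: "smooth_on N a" unfolding a_def by (intro smooth_intros N M1 M2 M2_nz)
  have dP1: "(P1 has_derivative D P1 \<zeta>0) (at \<zeta>0)" and dP2: "(P2 has_derivative D P2 \<zeta>0) (at \<zeta>0)"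
    and dM2: "(M2 has_derivative D M2 \<zeta>0) (at \<zeta>0)"
    using smooth_on_has_derivative N P1 P2 M2 by blast+
  \<comment> \<open>Since \<open>P2\<close> vanishes at \<open>\<zeta>0\<close>, the quotient rule
    loses the term with the derivative of \<open>M2\<close>.\<close>
  have "(q has_derivative (\<lambda>v. D P2 \<zeta>0 v / m2)) (at \<zeta>0)"
    unfolding q_def using m2
    by (auto intro!: derivative_eq_intros dP2 dM2 simp: zero m field_simps)
  then have Dq: "D q \<zeta>0 = (\<lambda>v. D P2 \<zeta>0 v / m2)" by (rule derivative_at)
  have DP1_eq: "D P1 \<zeta>0 v = fst v * J11 + fst (snd v) * J12 + snd (snd v) * a1" for v
    using derivative_triple[OF has_derivative_linear[OF dP1], of v] J by simp
  have DP2_eq: "D P2 \<zeta>0 v = fst v * J21 + fst (snd v) * J22 + snd (snd v) * a2" for v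
    using derivative_triple[OF has_derivative_linear[OF dP2], of v] J by simp
  obtain U1 \<psi> where U1: "open U1" "U1 \<subseteq> N" "\<zeta>0 \<in> U1" and \<psi>: "smooth_on U1 \<psi>"
    and pde: "\<And>z. z \<in> U1 \<Longrightarrow> D \<psi> z (a z, 1, 0) = 0"
    and \<psi>0: "\<And>x \<alpha>. (x, 0, \<alpha>) \<in> U1 \<Longrightarrow> \<psi> (x, 0, \<alpha>) = x"
    using first_integral_exists[OF N(1) a, of x0 \<alpha>0] N(2) unfolding \<zeta>0_def by blast
  \<comment> \<open>\<open>e\<close> sends a point to the foot of its characteristic, at the same
    parameter; \<open>U2\<close> keeps the points whose foot lies in \<open>N\<close>.\<close>
  define e where "e \<zeta> = (\<psi> \<zeta>, 0 :: real, snd (snd \<zeta>))" for \<zeta> :: "real \<times> real \<times> real"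
  have e: "smooth_on U1 e" unfolding e_def by (intro smooth_intros \<psi> U1)
  define U2 where "U2 = U1 \<inter> e -` N"
  have U2: "open U2" "U2 \<subseteq> U1"
    unfolding U2_def by (rule continuous_open_preimage[OF smooth_on_continuous[OF e] U1(1) N(1)]) auto
  have e0: "e \<zeta>0 = \<zeta>0" using \<psi>0 U1 by (simp add: e_def \<zeta>0_def)
  have \<zeta>0U2: "\<zeta>0 \<in> U2" using U1 N e0 by (simp add: U2_def)
  define X where "X \<zeta> = q (e \<zeta>) + c * fst (snd \<zeta>)" for \<zeta>
  have qe: "smooth_on U2 (\<lambda>\<zeta>. q (e \<zeta>))"
    by (rule smooth_on_compose[OF q smooth_on_subset[OF e U2(2)] U2(1) N(1)]) (simp add: U2_def)
  have X: "smooth_on U2 X" unfolding X_def by (intro smooth_intros qe U2)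
  have DX: "D X \<zeta> = (\<lambda>v. D q (e \<zeta>) (D \<psi> \<zeta> v, 0, snd (snd v)) + c * fst (snd v))" if "\<zeta> \<in> U2" for \<zeta>
  proof (rule derivative_at)
    have 1: "(e has_derivative (\<lambda>v. (D \<psi> \<zeta> v, 0, snd (snd v)))) (at \<zeta>)"
      unfolding e_def using that U2(2)
      by (auto intro!: derivative_eq_intros smooth_on_has_derivative[OF \<psi>])
    have "(q has_derivative D q (e \<zeta>)) (at (e \<zeta>))"
      using that by (intro smooth_on_has_derivative[OF q]) (simp add: U2_def)
    from has_derivative_compose[OF 1 this]
    show "(X has_derivative (\<lambda>v. D q (e \<zeta>) (D \<psi> \<zeta> v, 0, snd (snd v)) + c * fst (snd v))) (at \<zeta>)"
      unfolding X_def by (auto intro!: derivative_eq_intros)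
  qed
  have dX: "(X has_derivative D X \<zeta>) (at \<zeta>)" if "\<zeta> \<in> U2" for \<zeta>
    using smooth_on_has_derivative[OF X that] .
  have lX: "linear (D X \<zeta>)" if "\<zeta> \<in> U2" for \<zeta>
    using derivative_linear[OF X that] .
  have lq: "linear (D q \<zeta>)" if "\<zeta> \<in> N" for \<zeta> using derivative_linear[OF q that] .
  have X_transport: "D X \<zeta> (M1 \<zeta>, M2 \<zeta>, 0) = M2 \<zeta> * c" if \<zeta>: "\<zeta> \<in> U2" for \<zeta>
  proof -
    have "D X \<zeta> (a \<zeta>, 1, 0) = c"
      using pde[of \<zeta>] \<zeta> U2(2) linear_0[OF lq, of "e \<zeta>"]
      by (auto simp: DX[OF \<zeta>] U2_def zero_prod_def)
    moreover have "(M1 \<zeta>, M2 \<zeta>, 0) = M2 \<zeta> *\<^sub>R (a \<zeta>, 1, 0 :: real)"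
      using M2_nz[of \<zeta>] \<zeta> U2 U1 by (auto simp: a_def)
    ultimately show ?thesis by (simp only: linear_cmul[OF lX[OF \<zeta>]] real_scaleR_def)
  qed
  \<comment> \<open>\<open>\<psi>\<close> is known on the plane \<open>y = 0\<close>, and its
    derivative vanishes in the direction \<open>(a, 1, 0)\<close>. The plane and this direction span
    the space and so determine the derivative.\<close>
  have D\<psi>: "D \<psi> \<zeta>0 v = fst v - a \<zeta>0 * fst (snd v)" for v
  proof -
    have d: "(\<psi> has_derivative D \<psi> \<zeta>0) (at \<zeta>0)" using smooth_on_has_derivative[OF \<psi> U1(3)] .
    note l = has_derivative_linear[OF d]
    let ?i = "\<lambda>p :: real \<times> real. (fst p, 0 :: real, snd p)"
    have "(?i has_derivative (\<lambda>p. (fst p, 0, snd p))) (at (x0, \<alpha>0))"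
      by (auto intro!: derivative_eq_intros)
    from has_derivative_compose[OF this] d
    have "((\<lambda>p. \<psi> (?i p)) has_derivative (\<lambda>p. D \<psi> \<zeta>0 (?i p))) (at (x0, \<alpha>0))"
      by (simp add: \<zeta>0_def)
    moreover have "((\<lambda>p. \<psi> (?i p)) has_derivative fst) (at (x0, \<alpha>0))"
    proof (rule has_derivative_transform_within_open[of fst _ _ _ "?i -` U1"])
      show "open (?i -` U1)" by (intro open_vimage U1 continuous_intros)
    qed (use U1 \<psi>0 in \<open>auto simp: \<zeta>0_def intro!: derivative_eq_intros\<close>)
    ultimately have "(\<lambda>p. D \<psi> \<zeta>0 (?i p)) = fst" by (rule has_derivative_unique)
    from fun_cong[OF this, of "(fst v - a \<zeta>0 * fst (snd v), snd (snd v))"]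
    have 1: "D \<psi> \<zeta>0 (fst v - a \<zeta>0 * fst (snd v), 0, snd (snd v)) = fst v - a \<zeta>0 * fst (snd v)" by simp
    have "v = (fst v - a \<zeta>0 * fst (snd v), 0, snd (snd v)) + fst (snd v) *\<^sub>R (a \<zeta>0, 1, 0)"
      by (cases v) simp
    then have "D \<psi> \<zeta>0 v = D \<psi> \<zeta>0 (fst v - a \<zeta>0 * fst (snd v), 0, snd (snd v)) +
        fst (snd v) * D \<psi> \<zeta>0 (a \<zeta>0, 1, 0)"
      using linear_add[OF l] linear_cmul[OF l] by (metis real_scaleR_def)
    then show ?thesis using 1 pde[OF U1(3)] by simp
  qed
  have a0: "a \<zeta>0 = m1 / m2" by (simp add: a_def m)
  \<comment> \<open>Here \<open>c\<close> earns its value: composition with \<open>e\<close>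
    replaces the \<open>y\<close>-slope of \<open>q\<close> by
    \<open>- (m1 / m2) * J21 / m2\<close>, and adding \<open>c\<close> restores
    \<open>J22 / m2\<close>.\<close>
  have DX0: "D X \<zeta>0 v = D P2 \<zeta>0 v / m2" for v
    unfolding DX[OF \<zeta>0U2] e0 Dq D\<psi> a0 DP2_eq fst_conv snd_conv c
    using m2 by (simp add: field_simps)
  have X_line: "X (x, 0, \<alpha>) = q (x, 0, \<alpha>)" if "(x, 0, \<alpha>) \<in> U2" for x \<alpha>
    using \<psi>0 that U2(2) by (auto simp: X_def e_def)
  have X0: "X \<zeta>0 = 0" using X_line[of x0 \<alpha>0] \<zeta>0U2 zero by (simp add: \<zeta>0_def q_def)
  define B1 where "B1 \<zeta> = D X \<zeta> (1, 0, 0) / M2 \<zeta>" for \<zeta>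
  define B2 where "B2 \<zeta> = D X \<zeta> (0, 1, 0) / M2 \<zeta>" for \<zeta>
  have sub: "U2 \<subseteq> N" using U2 U1 by auto
  note smN = smooth_on_subset[OF _ sub]
  have B: "smooth_on U2 B1" "smooth_on U2 B2" unfolding B1_def B2_def using sub
    by (intro smooth_intros U2 smooth_on_derivative[OF X] smN M2 M2_nz; auto)+
  \<comment> \<open>As differences, the remainders satisfy the desired equations by construction;
    the content is that both are flat at \<open>\<zeta>0\<close>. They are formed in the old
    coordinates and pulled back by \<open>\<Psi>\<close>, under which a zero derivative stays
    zero.\<close>
  define T1 where "T1 \<zeta> = P1 \<zeta> * B1 \<zeta> + P2 \<zeta> * B2 \<zeta> - k * (snd (snd \<zeta>) - \<alpha>0) - \<tau> * X \<zeta> +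
    \<delta> * fst (snd \<zeta>)" for \<zeta>
  define T2 where "T2 \<zeta> = q \<zeta> - X \<zeta>" for \<zeta>
  have T1: "smooth_on U2 T1" unfolding T1_def by (intro smooth_intros U2 X B smN P1 P2)
  have T2: "smooth_on U2 T2" unfolding T2_def by (intro smooth_intros U2 X smN q)
  have T10: "T1 \<zeta>0 = 0" and T20: "T2 \<zeta>0 = 0"
    using zero X0 by (simp_all add: T1_def T2_def q_def) (simp_all add: \<zeta>0_def)
  have dB: "(B1 has_derivative D B1 \<zeta>0) (at \<zeta>0)" "(B2 has_derivative D B2 \<zeta>0) (at \<zeta>0)"
    using smooth_on_has_derivative \<zeta>0U2 B by blast+
  have DT1: "(T1 has_derivative (\<lambda>v. 0)) (at \<zeta>0)"
  proof -
    have "(T1 has_derivative (\<lambda>v. D P1 \<zeta>0 v * B1 \<zeta>0 + D P2 \<zeta>0 v * B2 \<zeta>0 - k * snd (snd v) - \<tau> * D X \<zeta>0 v +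
      \<delta> * fst (snd v))) (at \<zeta>0)"
      unfolding T1_def
      by (auto intro!: derivative_eq_intros dP1 dP2 dB dX[OF \<zeta>0U2] simp: zero)
    \<comment> \<open>The second row of the Cayley-Hamilton identity for the Jacobian: the state
      part of \<open>(J21 * D P1 + J22 * D P2) / m2\<^sup>2\<close> is \<open>\<tau>\<close> times
      that of \<open>D X\<close> minus \<open>\<delta>\<close> times the \<open>y\<close>-component.
      In the parameter direction \<open>J21 * a1 - J11 * a2\<close> is left over, which explains
      \<open>k\<close>.\<close>
    moreover have "D P1 \<zeta>0 v * B1 \<zeta>0 + D P2 \<zeta>0 v * B2 \<zeta>0 - k * snd (snd v) - \<tau> * D X \<zeta>0 v +
      \<delta> * fst (snd v) = 0" for v
      unfolding B1_def B2_def DX0 J m DP1_eq DP2_eq \<tau> \<delta> k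
      using m2 by (simp add: field_simps power2_eq_square)
    ultimately show ?thesis by simp
  qed
  have DT2: "(T2 has_derivative (\<lambda>v. 0)) (at \<zeta>0)"
  proof -
    have "(T2 has_derivative (\<lambda>v. D q \<zeta>0 v - D X \<zeta>0 v)) (at \<zeta>0)"
      unfolding T2_def using smooth_on_has_derivative[OF q N(2)] dX[OF \<zeta>0U2]
      by (auto intro!: derivative_eq_intros)
    then show ?thesis by (simp add: Dq DX0)
  qed
  have nzX: "D X \<zeta>0 (1, 0) \<noteq> 0"
    using DX0[of "(1, 0, 0)"] J nz m2 by (simp add: zero_prod_def)
  obtain U V0 g where U: "open U" "U \<subseteq> U2" "\<zeta>0 \<in> U" and V0: "open V0"
    and hom: "homeomorphism U V0 (\<lambda>z. (X z, snd z)) g" and g: "smooth_on V0 g"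
    by (rule inverse_in_first_variable[OF U2(1) X \<zeta>0U2 nzX]) (rule that; (assumption | blast))
  have gX: "g (X z, snd z) = z" "(X z, snd z) \<in> V0" if "z \<in> U" for z
    using hom that by (auto simp: homeomorphism_def)
  have Xg: "(X (g z), snd (g z)) = z" "g z \<in> U" if "z \<in> V0" for z
    using hom that by (auto simp: homeomorphism_def)
  \<comment> \<open>\<open>g\<close> inverts at the original parameter, so \<open>l\<close> first
    turns \<open>\<mu>\<close> back into \<open>\<alpha>0 + \<mu> / k\<close>.\<close>
  define l where "l z = (fst z, fst (snd z), \<alpha>0 + snd (snd z) / k)" for z :: "real \<times> real \<times> real"
  define V where "V = l -` V0"
  have "continuous_on UNIV l" unfolding l_def using nz by (intro continuous_intros) auto
  then have oV: "open V" unfolding V_def using V0 open_vimage by blast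
  define \<Psi> where "\<Psi> z = g (l z)" for z
  have "smooth_on V l" unfolding l_def using nz by (intro smooth_intros oV)
  then have \<Psi>: "smooth_on V \<Psi>" unfolding \<Psi>_def
    by (rule smooth_on_compose[OF g _ oV V0]) (simp add: V_def)
  have \<Psi>U: "\<Psi> z \<in> U" if "z \<in> V" for z using Xg(2) that by (simp add: V_def \<Psi>_def)
  have comp: "smooth_on V (\<lambda>z. T (\<Psi> z))" if "smooth_on U2 T" for T :: "real \<times> real \<times> real \<Rightarrow> real"
    by (rule smooth_on_compose[OF that \<Psi> oV U2(1)]) (use \<Psi>U U in auto)
  have to_V: "(X (x, y, \<alpha>), y, k * (\<alpha> - \<alpha>0)) \<in> V" "\<Psi> (X (x, y, \<alpha>), y, k * (\<alpha> - \<alpha>0)) = (x, y, \<alpha>)"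
    if "(x, y, \<alpha>) \<in> U" for x y \<alpha>
    using gX[OF that] nz by (simp_all add: V_def \<Psi>_def l_def)
  have of_V: "\<exists>x. \<Psi> (u, y, \<mu>) = (x, y, \<alpha>0 + \<mu> / k) \<and> (x, y, \<alpha>0 + \<mu> / k) \<in> U \<and>
      X (x, y, \<alpha>0 + \<mu> / k) = u" if "(u, y, \<mu>) \<in> V" for u y \<mu>
  proof -
    have "(u, y, \<alpha>0 + \<mu> / k) \<in> V0" using that by (simp add: V_def l_def)
    from Xg[OF this] have 1: "snd (g (u, y, \<alpha>0 + \<mu> / k)) = (y, \<alpha>0 + \<mu> / k)"
      "X (g (u, y, \<alpha>0 + \<mu> / k)) = u" "g (u, y, \<alpha>0 + \<mu> / k) \<in> U" by auto
    then have "g (u, y, \<alpha>0 + \<mu> / k) = (fst (g (u, y, \<alpha>0 + \<mu> / k)), y, \<alpha>0 + \<mu> / k)"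
      by (metis prod.collapse)
    then show ?thesis using 1(2,3) by (auto simp: \<Psi>_def l_def)
  qed
  have zV: "0 \<in> V" "\<Psi> 0 = \<zeta>0"
    using to_V[of x0 0 \<alpha>0] U(3) X0 by (simp_all add: \<zeta>0_def zero_prod_def)
  have D0: "D (\<lambda>z. T (\<Psi> z)) 0 = (\<lambda>v. 0)" if "(T has_derivative (\<lambda>v. 0)) (at \<zeta>0)"
    for T :: "real \<times> real \<times> real \<Rightarrow> real"
    using has_derivative_compose[OF smooth_on_has_derivative[OF \<Psi> zV(1)], of T "\<lambda>v. 0"] that zV(2)
    by (intro derivative_at) simp
  show ?thesis
  proof (rule that[of U V X \<Psi> "\<lambda>z. T1 (\<Psi> z)" "\<lambda>z. T2 (\<Psi> z)"])
    show "smooth_on U X" using smooth_on_subset[OF X U(2)] .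
    show "T2 (\<Psi> (x, 0, \<mu>)) = 0" if "(x, 0, \<mu>) \<in> V" for x \<mu>
      using of_V[OF that] X_line U(2) by (auto simp: T2_def)
    fix x y \<alpha> assume xU: "(x, y, \<alpha>) \<in> U"
    let ?z = "(x, y, \<alpha>)"
    have nz': "M2 ?z \<noteq> 0" using M2_nz sub U(2) xU by auto
    have "D X ?z (P1 ?z, P2 ?z, 0) = P1 ?z * D X ?z (1, 0, 0) + P2 ?z * D X ?z (0, 1, 0)"
      using derivative_triple[OF lX, of ?z "(P1 ?z, P2 ?z, 0)"] xU U(2) by auto
    then show "D X ?z (P1 ?z, P2 ?z, 0) = M2 ?z * (k * (\<alpha> - \<alpha>0) + \<tau> * X ?z - \<delta> * y +
        T1 (\<Psi> (X ?z, y, k * (\<alpha> - \<alpha>0))))"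
      using to_V[OF xU] nz' by (simp add: T1_def B1_def B2_def field_simps)
    show "P2 ?z = M2 ?z * (X ?z + T2 (\<Psi> (X ?z, y, k * (\<alpha> - \<alpha>0))))"
      using to_V[OF xU] nz' by (simp add: T2_def q_def)
  qed (use U sub oV \<Psi> X0 to_V of_V comp T1 T2 T10 T20 zV D0 DT1 DT2 X_transport in auto)
qed


section \<open>Remainders, linear algebra and the limit system\<close>

text \<open>A derivative that vanishes at 0 and is differentiable there grows at most linearly, and
  integration along a segment gives the estimate. The starting point is left free: the origin leads
  to a quadratic bound, a point of the plane \<open>y = 0\<close> to a bound with a factor
  \<open>y\<close>.\<close>

lemma increment_bound:
  fixes f :: "'a::euclidean_space \<Rightarrow> real"
  assumes "open W" "smooth_on W f" "0 \<in> W" "D f 0 = (\<lambda>v. 0)"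
  obtains C d where "C \<ge> 0" "d > 0"
    "\<And>x y R. R < d \<Longrightarrow> norm x \<le> R \<Longrightarrow> norm y \<le> R \<Longrightarrow>
      x \<in> W \<and> y \<in> W \<and> \<bar>f y - f x\<bar> \<le> C * R * norm (y - x)"
proof -
  obtain e where e: "e > 0" "ball 0 e \<subseteq> W" using assms(1,3) openE by blast
  \<comment> \<open>The operator norm bounds the linear part, and the \<open>+ 1\<close> absorbs the
    error of the first-order expansion, taken with tolerance 1.\<close>
  define C0 where "C0 i = onorm (D (\<lambda>z. D f z i) 0) + 1" for i
  have "\<exists>d>0. \<forall>z. norm z < d \<longrightarrow> \<bar>D f z i\<bar> \<le> C0 i * norm z" for i
  proof -
    have d: "((\<lambda>z. D f z i) has_derivative D (\<lambda>z. D f z i) 0) (at 0)"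
      by (rule smooth_on_has_derivative[OF smooth_on_derivative[OF assms(2)] assms(3)])
    obtain d where d0: "d > 0" "\<And>z. norm z < d \<Longrightarrow>
        norm (D f z i - D (\<lambda>z. D f z i) 0 z) \<le> 1 * norm z"
      using d assms(4) unfolding has_derivative_at_alt
      by (metis (no_types, lifting) diff_zero zero_less_one)
    have "\<bar>D f z i\<bar> \<le> C0 i * norm z" if "norm z < d" for z
      using d0(2)[OF that] onorm[OF has_derivative_bounded_linear[OF d], of z]
      by (simp add: C0_def algebra_simps)
    then show ?thesis using d0(1) by blast
  qed
  then have "\<forall>i. \<exists>d. d > 0 \<and> (\<forall>z. norm z < d \<longrightarrow> \<bar>D f z i\<bar> \<le> C0 i * norm z)" by blast
  from choice[OF this] obtain d0 where d0: "\<And>i. d0 i > 0"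
      "\<And>i z. norm z < d0 i \<Longrightarrow> \<bar>D f z i\<bar> \<le> C0 i * norm z" by blast
  define d where "d = Min (insert e (d0 ` Basis))"
  define C where "C = (\<Sum>i\<in>Basis. \<bar>C0 i\<bar>)"
  have d: "d > 0" "d \<le> e" using e d0(1) by (auto simp: d_def)
  have d_le: "d \<le> d0 i" if "i \<in> Basis" for i
    unfolding d_def by (rule Min_le) (use that in auto)
  have C0: "C \<ge> 0" by (simp add: C_def sum_nonneg)
  have Df: "\<bar>D f z v\<bar> \<le> C * norm z * norm v" if "norm z < d" for z v
  proof -
    have "z \<in> W" using that d(2) e(2) by auto
    then have "f differentiable at z"
      using smooth_on_has_derivative[OF assms(2)] by (auto simp: differentiable_def)
    then have "D f z v = (\<Sum>i\<in>Basis. (v \<bullet> i) *\<^sub>R D f z i)" by (rule derivative_eq_sum_Basis)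
    also have "norm \<dots> \<le> (\<Sum>i\<in>Basis. \<bar>C0 i\<bar> * (norm z * norm v))"
    proof (rule sum_norm_le)
      fix i :: 'a assume i: "i \<in> Basis"
      have "norm ((v \<bullet> i) *\<^sub>R D f z i) = \<bar>v \<bullet> i\<bar> * \<bar>D f z i\<bar>" by (simp add: abs_mult)
      also have "\<dots> \<le> norm v * (\<bar>C0 i\<bar> * norm z)"
      proof (intro mult_mono)
        have "\<bar>D f z i\<bar> \<le> C0 i * norm z" using d0(2) d_le[OF i] that by force
        also have "\<dots> \<le> \<bar>C0 i\<bar> * norm z" by (intro mult_right_mono) auto
        finally show "\<bar>D f z i\<bar> \<le> \<bar>C0 i\<bar> * norm z" .
      qed (use Basis_le_norm[OF i] in auto)
      finally show "norm ((v \<bullet> i) *\<^sub>R D f z i) \<le> \<bar>C0 i\<bar> * (norm z * norm v)"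
        by (simp add: mult_ac)
    qed
    also have "\<dots> = C * norm z * norm v" unfolding C_def sum_distrib_right by (simp add: mult.assoc)
    finally show ?thesis by simp
  qed
  have "x \<in> W \<and> y \<in> W \<and> \<bar>f y - f x\<bar> \<le> C * R * norm (y - x)"
    if R: "R < d" "norm x \<le> R" "norm y \<le> R" for x y R
  proof -
    have sub: "cball 0 R \<subseteq> W" using R(1) d(2) e(2) by auto
    have seg: "closed_segment x y \<subseteq> cball 0 R"
      using R by (intro closed_segment_subset) (auto simp: dist_norm)
    have "norm (f y - f x) \<le> C * R * norm (y - x) * measure lborel (cbox 0 (1 :: real))"
    proof (rule has_integral_bound)
      show "((\<lambda>s. D f (x + s *\<^sub>R (y - x)) (y - x)) has_integral f y - f x) (cbox 0 1)"
        unfolding cbox_interval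
        by (rule difference_eq_integral[OF assms(1,2)]) (use seg sub in auto)
      show "0 \<le> C * R * norm (y - x)" using C0 order_trans[OF norm_ge_zero R(2)] by simp
      fix s :: real assume "s \<in> cbox 0 1"
      then have "x + s *\<^sub>R (y - x) \<in> closed_segment x y"
        by (auto simp: in_segment algebra_simps)
      then have "x + s *\<^sub>R (y - x) \<in> cball 0 R" using seg by blast
      then have le: "norm (x + s *\<^sub>R (y - x)) \<le> R" by simp
      then have "\<bar>D f (x + s *\<^sub>R (y - x)) (y - x)\<bar> \<le> C * norm (x + s *\<^sub>R (y - x)) * norm (y - x)"
        using R(1) by (intro Df) simp
      also have "\<dots> \<le> C * R * norm (y - x)"
        using C0 le by (intro mult_right_mono mult_left_mono) auto
      finally show "norm (D f (x + s *\<^sub>R (y - x)) (y - x)) \<le> C * R * norm (y - x)" by simp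
    qed
    moreover have "x \<in> cball 0 R" "y \<in> cball 0 R" using R by (auto simp: dist_norm)
    ultimately show ?thesis using sub by auto
  qed
  then show ?thesis using that[of C d] C0 d(1) by blast
qed

lemma norm_triple_le: "norm (x, y, z) \<le> \<bar>x\<bar> + \<bar>y\<bar> + \<bar>z :: real\<bar>" for x y z :: real
proof -
  have "norm (x, y, z) \<le> norm x + norm (y, z)" unfolding norm_Pair by (rule sqrt_sum_squares_le_sum) auto
  also have "norm (y, z) \<le> norm y + norm z" unfolding norm_Pair by (rule sqrt_sum_squares_le_sum) auto
  finally show ?thesis by simp
qed

lemma quadratic_remainder_bigo:
  fixes f :: "real \<times> real \<times> real \<Rightarrow> real"
  assumes "open W" "smooth_on W f" "0 \<in> W" "D f 0 = (\<lambda>v. 0)" "f 0 = 0"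
  shows "(\<lambda>(x, y, \<mu>). f (x, y, \<mu>)) \<in> O[nhds (0, 0, 0)](\<lambda>(x, y, \<mu>).
    x\<^sup>2 + \<bar>x * y\<bar> + y\<^sup>2 + \<bar>x * \<mu>\<bar> + \<bar>y * \<mu>\<bar> + \<mu>\<^sup>2)"
proof -
  obtain C d where C: "C \<ge> 0" "d > 0" "\<And>x y R. R < d \<Longrightarrow> norm x \<le> R \<Longrightarrow> norm y \<le> R \<Longrightarrow>
      x \<in> W \<and> y \<in> W \<and> \<bar>f y - f x\<bar> \<le> C * R * norm (y - x)"
    using increment_bound[OF assms(1-4)] by blast
  have "eventually (\<lambda>z. norm z < d) (nhds (0, 0, 0 :: real))"
    using C(2) unfolding eventually_nhds_metric by (auto simp: dist_norm zero_prod_def)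
  then show ?thesis
  proof (intro bigoI[of _ C], eventually_elim)
    fix z :: "real \<times> real \<times> real" assume z: "norm z < d"
    obtain x y \<mu> where xy: "z = (x, y, \<mu>)" by (cases z)
    have "\<bar>f z\<bar> \<le> C * norm z * norm z"
      using C(3)[of "norm z" 0 z] z assms(5) by simp
    also have "\<dots> = C * (x\<^sup>2 + y\<^sup>2 + \<mu>\<^sup>2)"
      by (simp add: xy norm_Pair power2_eq_square[symmetric] mult.assoc)
    also have "\<dots> \<le> C * (x\<^sup>2 + \<bar>x * y\<bar> + y\<^sup>2 + \<bar>x * \<mu>\<bar> + \<bar>y * \<mu>\<bar> + \<mu>\<^sup>2)"
      using C(1) by (intro mult_left_mono) auto
    finally show "norm (case z of (x, y, \<mu>) \<Rightarrow> f (x, y, \<mu>)) \<le> C * norm (case z of (x, y, \<mu>) \<Rightarrow>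
        x\<^sup>2 + \<bar>x * y\<bar> + y\<^sup>2 + \<bar>x * \<mu>\<bar> + \<bar>y * \<mu>\<bar> + \<mu>\<^sup>2)"
      by (simp add: xy)
  qed
qed

text \<open>Comparison with the value at \<open>(x, 0, \<mu>)\<close> instead of the origin gives a
  factor \<open>y\<close>, and the vanishing derivative gives the other factor. All terms of the
  bound obtained contain \<open>y\<close>, so \<open>\<mu>\<^sup>2\<close> is absent.\<close>

lemma quadratic_remainder_bigo_vanishing:
  fixes f :: "real \<times> real \<times> real \<Rightarrow> real"
  assumes "open W" "smooth_on W f" "0 \<in> W" "D f 0 = (\<lambda>v. 0)"
    and zero: "\<And>x \<mu>. (x, 0, \<mu>) \<in> W \<Longrightarrow> f (x, 0, \<mu>) = 0"
  shows "(\<lambda>(x, y, \<mu>). f (x, y, \<mu>)) \<in> O[nhds (0, 0, 0)](\<lambda>(x, y, \<mu>).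
    x\<^sup>2 + \<bar>x * y\<bar> + y\<^sup>2 + \<bar>x * \<mu>\<bar> + \<bar>y * \<mu>\<bar>)"
proof -
  obtain C d where C: "C \<ge> 0" "d > 0" "\<And>x y R. R < d \<Longrightarrow> norm x \<le> R \<Longrightarrow> norm y \<le> R \<Longrightarrow>
      x \<in> W \<and> y \<in> W \<and> \<bar>f y - f x\<bar> \<le> C * R * norm (y - x)"
    using increment_bound[OF assms(1-4)] by blast
  have "eventually (\<lambda>z. norm z < d) (nhds (0, 0, 0 :: real))"
    using C(2) unfolding eventually_nhds_metric by (auto simp: dist_norm zero_prod_def)
  then show ?thesis
  proof (intro bigoI[of _ C], eventually_elim)
    fix z :: "real \<times> real \<times> real" assume z: "norm z < d"
    obtain x y \<mu> where xy: "z = (x, y, \<mu>)" by (cases z)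
    have le: "norm (x, 0 :: real, \<mu>) \<le> norm z" by (simp add: xy norm_Pair)
    have d_eq: "norm (z - (x, 0, \<mu>)) = \<bar>y\<bar>" by (simp add: xy norm_Pair)
    have "\<bar>f z\<bar> \<le> C * norm z * \<bar>y\<bar>"
      using C(3)[OF z le order.refl] zero[of x \<mu>] by (auto simp: d_eq)
    also have "\<dots> \<le> C * (\<bar>x\<bar> + \<bar>y\<bar> + \<bar>\<mu>\<bar>) * \<bar>y\<bar>"
      unfolding xy by (intro mult_right_mono mult_left_mono norm_triple_le C(1)) auto
    also have "\<dots> = C * (\<bar>x * y\<bar> + y\<^sup>2 + \<bar>y * \<mu>\<bar>)"
      by (simp add: abs_mult algebra_simps power2_eq_square)
    also have "\<dots> \<le> C * (x\<^sup>2 + \<bar>x * y\<bar> + y\<^sup>2 + \<bar>x * \<mu>\<bar> + \<bar>y * \<mu>\<bar>)"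
      using C(1) by (intro mult_left_mono) auto
    finally show "norm (case z of (x, y, \<mu>) \<Rightarrow> f (x, y, \<mu>)) \<le> C * norm (case z of (x, y, \<mu>) \<Rightarrow>
        x\<^sup>2 + \<bar>x * y\<bar> + y\<^sup>2 + \<bar>x * \<mu>\<bar> + \<bar>y * \<mu>\<bar>)"
      by (simp add: xy)
  qed
qed

section \<open>Determinants and eigenvalues of planar Jacobians\<close>

lemma det_columns2: "det (columns2 X Y) = X $ 1 * Y $ 2 - X $ 2 * Y $ 1"
  by (simp add: columns2_def det_2 transpose_def)

lemma matrix_vector_mult_2:
  fixes M :: "'a::comm_semiring_1^2^2"
  shows "(M *v v) $ i = M $ i $ 1 * v $ 1 + M $ i $ 2 * v $ 2"
  by (simp add: matrix_vector_mult_def sum_2)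

lemma eigenpair_2:
  fixes M :: "'a::field^2^2"
  assumes "eigenpair M l v"
  shows "v $ 1 \<noteq> 0 \<or> v $ 2 \<noteq> 0" "M $ 1 $ 1 * v $ 1 + M $ 1 $ 2 * v $ 2 = l * v $ 1"
    "M $ 2 $ 1 * v $ 1 + M $ 2 $ 2 * v $ 2 = l * v $ 2"
proof -
  have "v \<noteq> 0" "M *v v = l *s v" using assms by (auto simp: eigenpair_def)
  then show "v $ 1 \<noteq> 0 \<or> v $ 2 \<noteq> 0" by (auto simp: vec_eq_iff forall_2)
  have "(M *v v) $ i = (l *s v) $ i" for i using \<open>M *v v = l *s v\<close> by simp
  from this[of 1] this[of 2] show "M $ 1 $ 1 * v $ 1 + M $ 1 $ 2 * v $ 2 = l * v $ 1"
    "M $ 2 $ 1 * v $ 1 + M $ 2 $ 2 * v $ 2 = l * v $ 2"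
    by (simp_all add: matrix_vector_mult_2)
qed

text \<open>The adjugate of \<open>M - l\<close> turns the eigenvector equation into a determinant
  times \<open>v\<close>, and a nonzero coordinate of \<open>v\<close> can be cancelled.\<close>

lemma eigenvalue_char_poly_2:
  fixes M :: "'a::field^2^2"
  assumes "eigenpair M l v"
  shows "(M $ 1 $ 1 - l) * (M $ 2 $ 2 - l) = M $ 1 $ 2 * M $ 2 $ 1"
proof -
  note e = eigenpair_2[OF assms]
  have "((M $ 1 $ 1 - l) * (M $ 2 $ 2 - l) - M $ 1 $ 2 * M $ 2 $ 1) * v $ 1 = 0"
    "((M $ 1 $ 1 - l) * (M $ 2 $ 2 - l) - M $ 1 $ 2 * M $ 2 $ 1) * v $ 2 = 0"
    using e(2,3) by algebra+
  then show ?thesis using e(1) by auto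
qed

text \<open>Subtracting the characteristic equations and cancelling \<open>l - l'\<close> gives the
  trace; either equation then gives the determinant. The field is arbitrary so as to cover a focus
  through its complexified Jacobian.\<close>

lemma distinct_eigenvalues_trace_det_2:
  fixes M :: "'a::field^2^2"
  assumes "eigenpair M l v" "eigenpair M l' v'" "l \<noteq> l'"
  shows "M $ 1 $ 1 + M $ 2 $ 2 = l + l'"
    "M $ 1 $ 1 * M $ 2 $ 2 - M $ 1 $ 2 * M $ 2 $ 1 = l * l'"
proof -
  note e = eigenvalue_char_poly_2[OF assms(1)] eigenvalue_char_poly_2[OF assms(2)]
  have "(l - l') * (M $ 1 $ 1 + M $ 2 $ 2 - (l + l')) = 0" using e by algebra
  then show tr: "M $ 1 $ 1 + M $ 2 $ 2 = l + l'" using assms(3) by simp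
  show "M $ 1 $ 1 * M $ 2 $ 2 - M $ 1 $ 2 * M $ 2 $ 1 = l * l'" using e(1) tr by algebra
qed

text \<open>Everything the construction takes from the type of the bifurcation. Up to the factor
  \<open>m2\<close>, \<open>M $ 2 $ 1\<close> is the slope of \<open>q\<close> in \<open>x\<close>
  and decides whether \<open>X\<close> is a coordinate; the others become the conditions on
  \<open>\<delta>\<close> and \<open>\<tau>\<close>.\<close>

lemma boundary_jacobian_conditions:
  fixes Zp :: vfield
  assumes "boundary_focus Zp z \<alpha> \<or> boundary_node Zp z \<alpha> \<or> boundary_saddle Zp z \<alpha>"
  defines "M \<equiv> jacobian_at Zp z \<alpha>"
  defines "tr \<equiv> M $ 1 $ 1 + M $ 2 $ 2" and "dt \<equiv> M $ 1 $ 1 * M $ 2 $ 2 - M $ 1 $ 2 * M $ 2 $ 1"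
  shows "M $ 2 $ 1 \<noteq> 0" "dt \<noteq> 0" "tr\<^sup>2 \<noteq> 4 * dt"
    "tr \<noteq> 0 \<or> neutral_boundary_saddle Zp z \<alpha>"
proof -
  have trace: "trace M = tr" by (simp add: trace_def sum_2 tr_def)
  have real_case: "M $ 2 $ 1 \<noteq> 0 \<and> dt = l * l' \<and> tr = l + l'"
    if "eigenpair M l v" "eigenpair M l' v'" "l \<noteq> l'" "transversal_to_line v" "transversal_to_line v'"
    for l l' v v'
  proof -
    \<comment> \<open>Otherwise the second row of the eigenvector equation reads
      \<open>M $ 2 $ 2 * v $ 2 = l * v $ 2\<close>, and transversality makes both eigenvalues equal
      to \<open>M $ 2 $ 2\<close>.\<close>
    have "M $ 2 $ 1 \<noteq> 0"
    proof
      assume "M $ 2 $ 1 = 0"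
      then have "M $ 2 $ 2 = l" "M $ 2 $ 2 = l'"
        using eigenpair_2(3)[OF that(1)] eigenpair_2(3)[OF that(2)] that(4,5)
        by (auto simp: transversal_to_line_def)
      with that(3) show False by simp
    qed
    then show ?thesis using distinct_eigenvalues_trace_det_2[OF that(1-3)] by (simp add: tr_def dt_def)
  qed
  have disc: "(l + l')\<^sup>2 \<noteq> 4 * (l * l')" if "l \<noteq> l'" for l l' :: real
  proof -
    have "(l + l')\<^sup>2 - 4 * (l * l') = (l - l')\<^sup>2" by algebra
    then show ?thesis using that by auto
  qed
  have "M $ 2 $ 1 \<noteq> 0 \<and> dt \<noteq> 0 \<and> tr\<^sup>2 \<noteq> 4 * dt \<and> (tr \<noteq> 0 \<or> neutral_boundary_saddle Zp z \<alpha>)"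
    using assms(1)
  proof (elim disjE)
    assume "boundary_focus Zp z \<alpha>"
    then obtain A B vp vm where AB: "A \<noteq> 0" "B \<noteq> 0"
      and e: "eigenpair (map_matrix complex_of_real M) (Complex A B) vp"
        "eigenpair (map_matrix complex_of_real M) (Complex A (- B)) vm"
      by (auto simp: boundary_focus_def M_def Let_def)
    have ne: "Complex A B \<noteq> Complex A (- B)" using AB by simp
    have "complex_of_real tr = Complex A B + Complex A (- B)"
      "complex_of_real dt = Complex A B * Complex A (- B)"
      using distinct_eigenvalues_trace_det_2[OF e ne] by (simp_all add: tr_def dt_def map_matrix_def)
    then have tr: "tr = 2 * A" and dt: "dt = A\<^sup>2 + B\<^sup>2"
      by (simp_all add: complex_eq_iff power2_eq_square)
    have pos: "B\<^sup>2 > 0" "A\<^sup>2 > 0" using AB by simp_all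
    \<comment> \<open>A triangular real matrix has a square as discriminant, while that of a focus
      is \<open>- 4 * B\<^sup>2\<close>.\<close>
    have "M $ 2 $ 1 \<noteq> 0"
    proof
      assume "M $ 2 $ 1 = 0"
      then have "tr\<^sup>2 - 4 * dt = (M $ 1 $ 1 - M $ 2 $ 2)\<^sup>2" unfolding tr_def dt_def by algebra
      moreover have "tr\<^sup>2 - 4 * dt = - 4 * B\<^sup>2" unfolding tr dt by algebra
      ultimately show False using pos(1) zero_le_power2[of "M $ 1 $ 1 - M $ 2 $ 2"] by linarith
    qed
    moreover have "tr\<^sup>2 \<noteq> 4 * dt"
      using pos(1) unfolding tr dt by (simp add: power_mult_distrib)
    moreover have "dt \<noteq> 0" using pos unfolding dt by linarith
    ultimately show ?thesis using tr AB by simp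
  next
    assume "boundary_node Zp z \<alpha>"
    then obtain l l' v v' where e: "eigenpair M l v" "eigenpair M l' v'" "l \<noteq> l'"
        "transversal_to_line v" "transversal_to_line v'" and q: "l / l' > 0"
      by (auto simp: boundary_node_def M_def Let_def)
    then have "l \<noteq> 0" "l' \<noteq> 0" "l + l' \<noteq> 0" by (auto simp: zero_less_divide_iff)
    then show ?thesis using real_case[OF e] disc[OF e(3)] by simp
  next
    assume s: "boundary_saddle Zp z \<alpha>"
    then obtain l l' v v' where e: "eigenpair M l v" "eigenpair M l' v'"
        "transversal_to_line v" "transversal_to_line v'" and q: "l / l' < 0"
      by (auto simp: boundary_saddle_def M_def Let_def)
    have ne: "l \<noteq> l'" "l \<noteq> 0" "l' \<noteq> 0" using q by (auto simp: divide_less_0_iff)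
    have "tr \<noteq> 0 \<or> neutral_boundary_saddle Zp z \<alpha>"
      using s trace by (auto simp: neutral_boundary_saddle_def M_def)
    then show ?thesis using real_case[OF e(1,2) ne(1) e(3,4)] disc[OF ne(1)] ne by simp
  qed
  then show "M $ 2 $ 1 \<noteq> 0" "dt \<noteq> 0" "tr\<^sup>2 \<noteq> 4 * dt" "tr \<noteq> 0 \<or> neutral_boundary_saddle Zp z \<alpha>"
    by auto
qed

section \<open>The normal form and its limit system\<close>

lemma has_derivative_vector_2:
  fixes f g :: "'a::real_normed_vector \<Rightarrow> real"
  assumes "(f has_derivative f') F" "(g has_derivative g') F"
  shows "((\<lambda>x. vector [f x, g x] :: real^2) has_derivative (\<lambda>v. vector [f' v, g' v])) F"
proof -
  have eq: "vector [a, b] = a *\<^sub>R vector [1, 0] + b *\<^sub>R (vector [0, 1] :: real^2)" for a b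
    by (simp add: vec_eq_iff forall_2)
  have "((\<lambda>x. f x *\<^sub>R vector [1, 0] + g x *\<^sub>R (vector [0, 1] :: real^2)) has_derivative
      (\<lambda>v. f' v *\<^sub>R vector [1, 0] + g' v *\<^sub>R vector [0, 1])) F"
    by (intro has_derivative_add has_derivative_scaleR_left assms)
  then show ?thesis unfolding eq[symmetric] .
qed

lemma has_vector_derivative_vector_2:
  assumes "(f has_real_derivative f') (at x)" "(g has_real_derivative g') (at x)"
  shows "((\<lambda>x. vector [f x, g x] :: real^2) has_vector_derivative vector [f', g']) (at x)"
proof -
  have "((\<lambda>x. f x *\<^sub>R (vector [1, 0] :: real^2) + g x *\<^sub>R vector [0, 1]) has_vector_derivative
      (f' *\<^sub>R vector [1, 0] + g' *\<^sub>R vector [0, 1])) (at x)"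
    using assms by (auto intro!: derivative_eq_intros)
  moreover have "(a *\<^sub>R (vector [1, 0] :: real^2) + b *\<^sub>R vector [0, 1]) = vector [a, b]" for a b
    by (simp add: vec_eq_iff forall_2)
  ultimately show ?thesis by simp
qed

lemma sliding_field_normal_form:
  "sliding_field (X_plus \<tau> \<delta> \<theta>1 \<theta>2) (X_minus \<tau> \<gamma>) x \<mu> =
    (\<mu> + \<gamma> * x + \<theta>1 x 0 \<mu> - (\<tau> - \<gamma>) * \<theta>2 x 0 \<mu>) / (1 - x - \<theta>2 x 0 \<mu>)"
  by (simp add: sliding_field_def det_columns2 X_plus_def X_minus_def algebra_simps)

text \<open>The parameter and \<open>x\<close> columns at the origin are \<open>(1, 0)\<close> and
  \<open>(\<tau>, 1)\<close>, with determinant 1, and the second component of \<open>X_minus\<close>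
  is 1. What remains is the slope of the sliding field, which equals
  \<open>\<gamma>\<close>.\<close>

lemma normal_form_BEB:
  assumes "\<theta>1 0 0 0 = 0" "\<theta>2 0 0 0 = 0" "\<gamma> \<noteq> 0"
    and x: "((\<lambda>x. \<theta>1 x 0 0) has_real_derivative 0) (at 0)" "((\<lambda>x. \<theta>2 x 0 0) has_real_derivative 0) (at 0)"
    and \<mu>: "((\<lambda>\<mu>. \<theta>1 0 0 \<mu>) has_real_derivative 0) (at 0)" "((\<lambda>\<mu>. \<theta>2 0 0 \<mu>) has_real_derivative 0) (at 0)"
  shows "BEB (X_plus \<tau> \<delta> \<theta>1 \<theta>2) (X_minus \<tau> \<gamma>) 0 0"
proof -
  have "((\<lambda>\<mu>. vector [\<mu> + \<theta>1 0 0 \<mu>, \<theta>2 0 0 \<mu>] :: real^2) has_vector_derivative vector [1 + 0, 0]) (at 0)"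
    by (intro has_vector_derivative_vector_2) (auto intro!: derivative_eq_intros \<mu>)
  then have p: "partial_param (X_plus \<tau> \<delta> \<theta>1 \<theta>2) 0 0 = vector [1, 0]"
    by (simp add: partial_param_def X_plus_def vector_derivative_at)
  have "((\<lambda>x. vector [\<tau> * x + \<theta>1 x 0 0, x + \<theta>2 x 0 0] :: real^2) has_vector_derivative vector [\<tau> + 0, 1 + 0]) (at 0)"
    by (intro has_vector_derivative_vector_2) (auto intro!: derivative_eq_intros x)
  then have q: "partial_x (X_plus \<tau> \<delta> \<theta>1 \<theta>2) 0 0 = vector [\<tau>, 1]"
    by (simp add: partial_x_def X_plus_def vector_derivative_at)
  have "((\<lambda>x. sliding_field (X_plus \<tau> \<delta> \<theta>1 \<theta>2) (X_minus \<tau> \<gamma>) x 0) has_real_derivative \<gamma>) (at 0)"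
    unfolding sliding_field_normal_form
    using assms(1,2) by (auto intro!: derivative_eq_intros x)
  then have "deriv (\<lambda>x. sliding_field (X_plus \<tau> \<delta> \<theta>1 \<theta>2) (X_minus \<tau> \<gamma>) x 0) 0 = \<gamma>"
    by (rule DERIV_imp_deriv)
  moreover have "X_plus \<tau> \<delta> \<theta>1 \<theta>2 0 0 = 0"
    using assms(1,2) by (simp add: X_plus_def vec_eq_iff forall_2)
  ultimately show ?thesis
    using assms(3) by (simp add: BEB_def switching_line_def p q det_columns2 X_minus_def)
qed

lemma normal_form_tendsto:
  assumes "((\<lambda>\<epsilon>. p \<epsilon>) \<longlongrightarrow> P) F"
  shows "((\<lambda>\<epsilon>. normal_form \<tau> \<delta> \<gamma> \<theta>1 \<theta>2 z (p \<epsilon>) \<mu>) \<longlongrightarrow> normal_form \<tau> \<delta> \<gamma> \<theta>1 \<theta>2 z P \<mu>) F"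
proof (rule vec_tendstoI)
  fix i :: 2
  show "((\<lambda>\<epsilon>. normal_form \<tau> \<delta> \<gamma> \<theta>1 \<theta>2 z (p \<epsilon>) \<mu> $ i) \<longlongrightarrow> normal_form \<tau> \<delta> \<gamma> \<theta>1 \<theta>2 z P \<mu> $ i) F"
  proof (cases "i = 1")
    case True
    show ?thesis unfolding True normal_form_def Let_def vector_2
      by (intro tendsto_add tendsto_mult tendsto_const assms)
  next
    case False
    then have i: "i = 2" using exhaust_2[of i] by simp
    show ?thesis unfolding i normal_form_def Let_def vector_2
      by (intro tendsto_add tendsto_mult tendsto_const assms)
  qed
qed

lemma normal_form_tendsto_X_plus:
  assumes "(\<phi> \<longlongrightarrow> 1) at_top" "z $ 2 > 0"
  shows "((\<lambda>\<epsilon>. normal_form \<tau> \<delta> \<gamma> \<theta>1 \<theta>2 z (\<phi> (z $ 2 / \<epsilon>)) \<mu>) \<longlongrightarrow> X_plus \<tau> \<delta> \<theta>1 \<theta>2 z \<mu>) (at_right 0)"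
proof -
  have "filterlim (\<lambda>\<epsilon>. z $ 2 * inverse \<epsilon>) at_top (at_right 0)"
    by (rule filterlim_tendsto_pos_mult_at_top[OF tendsto_const assms(2) filterlim_inverse_at_top_right])
  then have "((\<lambda>\<epsilon>. \<phi> (z $ 2 / \<epsilon>)) \<longlongrightarrow> 1) (at_right 0)"
    unfolding divide_inverse by (rule filterlim_compose[OF assms(1)])
  moreover have "normal_form \<tau> \<delta> \<gamma> \<theta>1 \<theta>2 z 1 \<mu> = X_plus \<tau> \<delta> \<theta>1 \<theta>2 z \<mu>"
    by (simp add: normal_form_def X_plus_def Let_def vec_eq_iff forall_2)
  ultimately show ?thesis using normal_form_tendsto by metis
qed

lemma normal_form_tendsto_X_minus:
  assumes "(\<phi> \<longlongrightarrow> 0) at_bot" "z $ 2 < 0"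
  shows "((\<lambda>\<epsilon>. normal_form \<tau> \<delta> \<gamma> \<theta>1 \<theta>2 z (\<phi> (z $ 2 / \<epsilon>)) \<mu>) \<longlongrightarrow> X_minus \<tau> \<gamma> z \<mu>) (at_right 0)"
proof -
  have "filterlim (\<lambda>\<epsilon>. z $ 2 * inverse \<epsilon>) at_bot (at_right 0)"
    by (rule filterlim_tendsto_neg_mult_at_bot[OF tendsto_const assms(2) filterlim_inverse_at_top_right])
  then have "((\<lambda>\<epsilon>. \<phi> (z $ 2 / \<epsilon>)) \<longlongrightarrow> 0) (at_right 0)"
    unfolding divide_inverse by (rule filterlim_compose[OF assms(1)])
  moreover have "normal_form \<tau> \<delta> \<gamma> \<theta>1 \<theta>2 z 0 \<mu> = X_minus \<tau> \<gamma> z \<mu>"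
    by (simp add: normal_form_def X_minus_def Let_def)
  ultimately show ?thesis using normal_form_tendsto by metis
qed

text \<open>The notion is phrased with \<open>inv_into\<close>, so an explicit inverse has to be
  identified with it on \<open>T\<close> before its smoothness can be used.\<close>

lemma diffeomorphism_betweenI:
  assumes "open S" "open T" "smooth_on S f" "smooth_on T g" "\<And>x. x \<in> S \<Longrightarrow> f x \<in> T \<and> g (f x) = x"
    "\<And>y. y \<in> T \<Longrightarrow> g y \<in> S \<and> f (g y) = y"
  shows "diffeomorphism_between S T f"
proof -
  have bij: "bij_betw f S T"
    using assms(5,6) by (intro bij_betw_byWitness[where f' = g]) auto
  have "g y = inv_into S f y" if "y \<in> T" for y
    using bij assms(6)[OF that] bij_betw_imp_inj_on[OF bij] by (metis inv_into_f_f)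
  then have "smooth_on T (inv_into S f)"
    using smooth_on_cong[OF assms(2) _ assms(4)] by blast
  then show ?thesis using assms bij by (simp add: diffeomorphism_between_def)
qed


section \<open>Transformation into the normal form\<close>

lemma smooth_field_component:
  fixes Z :: vfield
  assumes "open I" "smooth_on (UNIV \<times> I) (\<lambda>(z, \<alpha>). Z z \<alpha>)"
  shows "smooth_on {\<zeta>. snd (snd \<zeta>) \<in> I} (\<lambda>\<zeta>. Z (vector [fst \<zeta>, fst (snd \<zeta>)]) (snd (snd \<zeta>)) $ i)"
proof -
  let ?N = "{\<zeta> :: real \<times> real \<times> real. snd (snd \<zeta>) \<in> I}"
  have oN: "open ?N"
    using open_vimage[OF assms(1), of "\<lambda>\<zeta> :: real \<times> real \<times> real. snd (snd \<zeta>)"]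
    by (simp add: vimage_def continuous_intros)
  have "smooth_on ?N (\<lambda>\<zeta>. (vector [fst \<zeta>, fst (snd \<zeta>)] :: real^2, snd (snd \<zeta>)))"
    by (intro smooth_intros oN)
  from smooth_on_compose[OF assms(2) this oN]
  have "smooth_on ?N (\<lambda>\<zeta>. Z (vector [fst \<zeta>, fst (snd \<zeta>)]) (snd (snd \<zeta>)))"
    using assms(1) by (simp add: open_Times)
  then show ?thesis by (intro smooth_intros oN)
qed

text \<open>The bifurcation conditions use a Jacobian and derivatives along coordinate lines, the
  construction of coordinates uses scalar components on triples. All of these are values of the one
  total derivative \<open>L\<close>.\<close>

lemma field_derivatives:
  fixes Z :: vfield and x0 y0 \<alpha>0 :: real
  assumes "open I" "smooth_on (UNIV \<times> I) (\<lambda>(z, \<alpha>). Z z \<alpha>)" "\<alpha>0 \<in> I"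
  defines "P \<equiv> (\<lambda>i \<zeta>. Z (vector [fst \<zeta>, fst (snd \<zeta>)]) (snd (snd \<zeta>)) $ i)"
  shows "jacobian_at Z (vector [x0, y0]) \<alpha>0 $ i $ 1 = D (P i) (x0, y0, \<alpha>0) (1, 0, 0)"
    and "jacobian_at Z (vector [x0, y0]) \<alpha>0 $ i $ 2 = D (P i) (x0, y0, \<alpha>0) (0, 1, 0)"
    and "partial_x Z (vector [x0, y0]) \<alpha>0 $ i = D (P i) (x0, y0, \<alpha>0) (1, 0, 0)"
    and "partial_param Z (vector [x0, y0]) \<alpha>0 $ i = D (P i) (x0, y0, \<alpha>0) (0, 0, 1)"
proof -
  let ?z0 = "vector [x0, y0] :: real^2"
  define L where "L = D (\<lambda>(z, \<alpha>). Z z \<alpha>) (?z0, \<alpha>0)"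
  have L: "((\<lambda>p. Z (fst p) (snd p)) has_derivative L) (at (?z0, \<alpha>0))"
    using smooth_on_has_derivative[OF assms(2), of "(?z0, \<alpha>0)"] assms(3)
    by (simp add: L_def case_prod_unfold)
  note lin = has_derivative_linear[OF L]
  have scale: "L (h *\<^sub>R v) = h *\<^sub>R L v" for h v using linear_cmul[OF lin] .
  have "((\<lambda>\<zeta>. (vector [fst \<zeta>, fst (snd \<zeta>)] :: real^2, snd (snd \<zeta>))) has_derivative
      (\<lambda>v. (vector [fst v, fst (snd v)], snd (snd v)))) (at (x0, y0, \<alpha>0))"
    by (intro has_derivative_Pair has_derivative_vector_2) (auto intro!: derivative_eq_intros)
  from has_derivative_compose[OF this, of "\<lambda>p. Z (fst p) (snd p)" L] L
  have "((\<lambda>\<zeta>. Z (vector [fst \<zeta>, fst (snd \<zeta>)]) (snd (snd \<zeta>))) has_derivative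
      (\<lambda>v. L (vector [fst v, fst (snd v)], snd (snd v)))) (at (x0, y0, \<alpha>0))" by simp
  from has_derivative_compose[OF this bounded_linear_imp_has_derivative[OF bounded_linear_vec_nth]]
  have DP: "D (P i) (x0, y0, \<alpha>0) = (\<lambda>v. L (vector [fst v, fst (snd v)], snd (snd v)) $ i)"
    unfolding P_def by (rule derivative_at)
  have "((\<lambda>w. (w, \<alpha>0)) has_derivative (\<lambda>v. (v, 0))) (at ?z0)"
    by (auto intro!: derivative_eq_intros)
  from has_derivative_compose[OF this, of "\<lambda>p. Z (fst p) (snd p)" L] L
  have "((\<lambda>w. Z w \<alpha>0) has_derivative (\<lambda>v. L (v, 0))) (at ?z0)" by simp
  then have J: "jacobian_at Z ?z0 \<alpha>0 $ i $ j = L (axis j 1, 0) $ i" for j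
    by (simp add: jacobian_at_def jacobian_def matrix_def derivative_at)
  have ax: "axis 1 1 = (vector [1, 0] :: real^2)" "axis 2 1 = (vector [0, 1] :: real^2)"
    by (auto simp: vec_eq_iff forall_2 axis_def)
  show "jacobian_at Z ?z0 \<alpha>0 $ i $ 1 = D (P i) (x0, y0, \<alpha>0) (1, 0, 0)"
    "jacobian_at Z ?z0 \<alpha>0 $ i $ 2 = D (P i) (x0, y0, \<alpha>0) (0, 1, 0)"
    by (simp_all add: J DP ax)
  have v0: "vector [0, 0] = (0 :: real^2)" by (simp add: vec_eq_iff forall_2)
  have "((\<lambda>x. (vector [x, y0] :: real^2, \<alpha>0)) has_derivative (\<lambda>h. (vector [h, 0], 0))) (at x0)"
    by (intro has_derivative_Pair has_derivative_vector_2) (auto intro!: derivative_eq_intros)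
  from has_derivative_compose[OF this, of "\<lambda>p. Z (fst p) (snd p)" L] L
  have "((\<lambda>x. Z (vector [x, y0]) \<alpha>0) has_derivative (\<lambda>h. L (vector [h, 0], 0))) (at x0)" by simp
  moreover have "L (vector [h, 0], 0) = h *\<^sub>R L (vector [1, 0], 0)" for h
  proof -
    have "(vector [h, 0], 0 :: real) = h *\<^sub>R (vector [1, 0] :: real^2, 0 :: real)"
      by (simp add: vec_eq_iff forall_2)
    then show ?thesis by (simp only: scale)
  qed
  then have "(\<lambda>h. L (vector [h, 0], 0)) = (\<lambda>h. h *\<^sub>R L (vector [1, 0], 0))" by (rule ext)
  ultimately have "((\<lambda>x. Z (vector [x, y0]) \<alpha>0) has_vector_derivative L (vector [1, 0], 0)) (at x0)"
    unfolding has_vector_derivative_def by (rule has_derivative_eq_rhs)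
  then show "partial_x Z ?z0 \<alpha>0 $ i = D (P i) (x0, y0, \<alpha>0) (1, 0, 0)"
    by (simp add: partial_x_def DP vector_derivative_at)
  have "((\<lambda>a. (?z0, a)) has_derivative (\<lambda>h. (0, h))) (at \<alpha>0)"
    by (auto intro!: derivative_eq_intros)
  from has_derivative_compose[OF this, of "\<lambda>p. Z (fst p) (snd p)" L] L
  have "((\<lambda>a. Z ?z0 a) has_derivative (\<lambda>h. L (0, h))) (at \<alpha>0)" by simp
  moreover have "(\<lambda>h. L (0, h)) = (\<lambda>h. h *\<^sub>R L (0, 1))"
    by (rule ext) (simp add: scale[symmetric])
  ultimately have "((\<lambda>a. Z ?z0 a) has_vector_derivative L (0, 1)) (at \<alpha>0)"
    unfolding has_vector_derivative_def by (rule has_derivative_eq_rhs)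
  then show "partial_param Z ?z0 \<alpha>0 $ i = D (P i) (x0, y0, \<alpha>0) (0, 0, 1)"
    by (simp add: partial_param_def DP vector_derivative_at v0)
qed

text \<open>At the equilibrium \<open>Zp\<close> and hence the numerator vanish, so the derivatives
  \<open>n1\<close>, \<open>n2\<close> of \<open>Zm\<close> and that of the denominator are
  multiplied by zero.\<close>

lemma sliding_field_derivative:
  fixes Zp Zm :: vfield
  assumes "((\<lambda>x. Zp (vector [x, 0]) \<alpha> $ 1) has_real_derivative p1) (at x0)"
    "((\<lambda>x. Zp (vector [x, 0]) \<alpha> $ 2) has_real_derivative p2) (at x0)"
    "((\<lambda>x. Zm (vector [x, 0]) \<alpha> $ 1) has_real_derivative n1) (at x0)"
    "((\<lambda>x. Zm (vector [x, 0]) \<alpha> $ 2) has_real_derivative n2) (at x0)"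
    and zero: "Zp (vector [x0, 0]) \<alpha> = 0" and m: "Zm (vector [x0, 0]) \<alpha> = vector [m1, m2]" "m2 \<noteq> 0"
  shows "deriv (\<lambda>x. sliding_field Zp Zm x \<alpha>) x0 = (p1 * m2 - p2 * m1) / m2"
proof (rule DERIV_imp_deriv)
  show "((\<lambda>x. sliding_field Zp Zm x \<alpha>) has_real_derivative (p1 * m2 - p2 * m1) / m2) (at x0)"
    unfolding sliding_field_def det_columns2
    by (rule derivative_eq_intros assms refl)+
      (use m in \<open>simp_all add: zero m field_simps\<close>)
qed

theorem theorem2p8:
  fixes Zp Zm :: "real^2 \<Rightarrow> real \<Rightarrow> real^2"
    and \<phi> :: "real \<Rightarrow> real" and \<epsilon>0 :: real and I :: "real set"
    and z_bf :: "real^2" and \<alpha>_bf :: real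
  assumes "\<epsilon>0 > 0"
    and "open I" and "\<alpha>_bf \<in> I"
    and "smooth_on (UNIV \<times> I) (\<lambda>(z, \<alpha>). Zp z \<alpha>)"
    and "smooth_on (UNIV \<times> I) (\<lambda>(z, \<alpha>). Zm z \<alpha>)"
    and "smooth_on UNIV \<phi>" and "\<And>s. deriv \<phi> s > 0"
    and "(\<phi> \<longlongrightarrow> 1) at_top" and "(\<phi> \<longlongrightarrow> 0) at_bot"
    and "BEB Zp Zm z_bf \<alpha>_bf"
    and "boundary_focus Zp z_bf \<alpha>_bf \<or> boundary_node Zp z_bf \<alpha>_bf \<or> boundary_saddle Zp z_bf \<alpha>_bf"
  shows "\<exists>\<tau> \<delta> \<gamma> \<theta>1 \<theta>2 U I\<^sub>\<alpha> W H h g.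
    (\<tau> \<noteq> 0 \<or> neutral_boundary_saddle Zp z_bf \<alpha>_bf) \<and>
    \<delta> \<noteq> 0 \<and> \<delta> \<noteq> \<tau>\<^sup>2 / 4 \<and>
    z_bf \<in> U \<and> \<alpha>_bf \<in> I\<^sub>\<alpha> \<and> is_interval I\<^sub>\<alpha> \<and> I\<^sub>\<alpha> \<subseteq> I \<and>
    smoothly_transforms \<phi> \<epsilon>0 (combined_field Zp Zm) (normal_form \<tau> \<delta> \<gamma> \<theta>1 \<theta>2)
      (sgn (Zm z_bf \<alpha>_bf $ 2)) U I\<^sub>\<alpha> W H h g \<and>
    H z_bf \<alpha>_bf = 0 \<and> g \<alpha>_bf = 0 \<and> deriv g \<alpha>_bf \<noteq> 0 \<and>
    smooth_on W (\<lambda>(z, \<mu>). \<theta>1 (z $ 1) (z $ 2) \<mu>) \<and>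
    smooth_on W (\<lambda>(z, \<mu>). \<theta>2 (z $ 1) (z $ 2) \<mu>) \<and>
    (\<lambda>(x, y, \<mu>). \<theta>1 x y \<mu>) \<in> O[nhds (0, 0, 0)](\<lambda>(x, y, \<mu>).
       x\<^sup>2 + \<bar>x * y\<bar> + y\<^sup>2 + \<bar>x * \<mu>\<bar> + \<bar>y * \<mu>\<bar> + \<mu>\<^sup>2) \<and>
    (\<lambda>(x, y, \<mu>). \<theta>2 x y \<mu>) \<in> O[nhds (0, 0, 0)](\<lambda>(x, y, \<mu>).
       x\<^sup>2 + \<bar>x * y\<bar> + y\<^sup>2 + \<bar>x * \<mu>\<bar> + \<bar>y * \<mu>\<bar>) \<and>
    (\<forall>(z, \<mu>)\<in>W. z $ 2 > 0 \<longrightarrow>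
       ((\<lambda>\<epsilon>. normal_form \<tau> \<delta> \<gamma> \<theta>1 \<theta>2 z (\<phi> (z $ 2 / \<epsilon>)) \<mu>) \<longlongrightarrow> X_plus \<tau> \<delta> \<theta>1 \<theta>2 z \<mu>) (at_right 0)) \<and>
    (\<forall>(z, \<mu>)\<in>W. z $ 2 < 0 \<longrightarrow>
       ((\<lambda>\<epsilon>. normal_form \<tau> \<delta> \<gamma> \<theta>1 \<theta>2 z (\<phi> (z $ 2 / \<epsilon>)) \<mu>) \<longlongrightarrow> X_minus \<tau> \<gamma> z \<mu>) (at_right 0)) \<and>
    BEB (X_plus \<tau> \<delta> \<theta>1 \<theta>2) (X_minus \<tau> \<gamma>) 0 0 \<and>
    (\<forall>x \<mu>. (vector [x, 0], \<mu>) \<in> W \<and>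
       vector [x, 0] \<in> sliding_set (X_plus \<tau> \<delta> \<theta>1 \<theta>2) (X_minus \<tau> \<gamma>) \<mu> \<longrightarrow>
       sliding_field (X_plus \<tau> \<delta> \<theta>1 \<theta>2) (X_minus \<tau> \<gamma>) x \<mu> =
       (\<mu> + \<gamma> * x + \<theta>1 x 0 \<mu> - (\<tau> - \<gamma>) * \<theta>2 x 0 \<mu>) / (1 - x - \<theta>2 x 0 \<mu>))"
proof -
  define x0 where "x0 = z_bf $ 1"
  have z_bf: "z_bf = vector [x0, 0]"
    using assms(10) by (simp add: x0_def BEB_def switching_line_def vec_eq_iff forall_2)
  define \<sigma> where "\<sigma> = sgn (Zm z_bf \<alpha>_bf $ 2)"
  define P where "P = (\<lambda>i \<zeta>. Zp (vector [fst \<zeta>, fst (snd \<zeta>)]) (snd (snd \<zeta>)) $ i)"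
  define M where "M = (\<lambda>i \<zeta>. Zm (vector [fst \<zeta>, fst (snd \<zeta>)]) (snd (snd \<zeta>)) $ i)"
  define \<zeta>0 where "\<zeta>0 = (x0, 0 :: real, \<alpha>_bf)"
  define N0 where "N0 = {\<zeta> :: real \<times> real \<times> real. snd (snd \<zeta>) \<in> I}"
  have oN0: "open N0"
    using open_vimage[OF assms(2), of "\<lambda>\<zeta> :: real \<times> real \<times> real. snd (snd \<zeta>)"]
    by (simp add: vimage_def continuous_intros N0_def)
  have P: "smooth_on N0 (P i)" and M: "smooth_on N0 (M i)" for i
    unfolding P_def M_def N0_def
    by (rule smooth_field_component[OF assms(2) assms(4)], rule smooth_field_component[OF assms(2) assms(5)])
  \<comment> \<open>On \<open>N\<close> the second component of \<open>Zm\<close> keeps the sign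
    \<open>\<sigma>\<close> it has at the bifurcation point, which will make the time factor
    positive.\<close>
  define N where "N = N0 \<inter> (\<lambda>\<zeta>. \<sigma> * M 2 \<zeta>) -` {0<..}"
  have oN: "open N" unfolding N_def
    by (intro continuous_open_preimage oN0 continuous_intros smooth_on_continuous[OF M])
  have NN0: "N \<subseteq> N0" by (simp add: N_def)
  have m2_nz: "M 2 \<zeta>0 \<noteq> 0" using assms(10) by (simp add: M_def \<zeta>0_def BEB_def z_bf)
  have \<sigma>: "\<sigma> = sgn (M 2 \<zeta>0)" by (simp add: \<sigma>_def M_def \<zeta>0_def z_bf)
  have \<sigma>2: "\<sigma> * \<sigma> = 1" using m2_nz by (simp add: \<sigma> sgn_mult[symmetric] sgn_if)
  have \<zeta>0N0: "\<zeta>0 \<in> N0" using assms(3) by (simp add: \<zeta>0_def N0_def)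
  have \<zeta>0N: "\<zeta>0 \<in> N"
    using \<zeta>0N0 m2_nz by (simp add: N_def \<sigma> sgn_if)
  have Zp0: "Zp (vector [x0, 0]) \<alpha>_bf = 0" using assms(10) by (simp add: BEB_def z_bf)
  have zero: "P 1 \<zeta>0 = 0" "P 2 \<zeta>0 = 0" using Zp0 by (simp_all add: P_def \<zeta>0_def)
  define J where "J i j = jacobian_at Zp z_bf \<alpha>_bf $ i $ j" for i j
  define a1 where "a1 = partial_param Zp z_bf \<alpha>_bf $ 1"
  define a2 where "a2 = partial_param Zp z_bf \<alpha>_bf $ 2"
  define m1 where "m1 = M 1 \<zeta>0"
  define m2 where "m2 = M 2 \<zeta>0"
  have P_eq: "(\<lambda>\<zeta>. Zp (vector [fst \<zeta>, fst (snd \<zeta>)]) (snd (snd \<zeta>)) $ i) = P i" for i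
    by (simp add: P_def)
  note fd = field_derivatives[OF assms(2,4,3), of x0 0, unfolded P_eq, folded z_bf \<zeta>0_def]
  have DP: "D (P 1) \<zeta>0 (1, 0, 0) = J 1 1" "D (P 1) \<zeta>0 (0, 1, 0) = J 1 2" "D (P 1) \<zeta>0 (0, 0, 1) = a1"
    "D (P 2) \<zeta>0 (1, 0, 0) = J 2 1" "D (P 2) \<zeta>0 (0, 1, 0) = J 2 2" "D (P 2) \<zeta>0 (0, 0, 1) = a2"
    by (simp_all add: J_def a1_def a2_def fd)
  have m2': "m2 \<noteq> 0" using m2_nz by (simp add: m2_def)
  define \<tau> where "\<tau> = (J 1 1 + J 2 2) / m2"
  define \<delta> where "\<delta> = (J 1 1 * J 2 2 - J 1 2 * J 2 1) / m2\<^sup>2"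
  define c where "c = (J 2 2 + m1 / m2 * J 2 1) / m2"
  define k where "k = (J 2 1 * a1 - J 1 1 * a2) / m2\<^sup>2"
  define \<gamma> where "\<gamma> = \<tau> - c"
  note jc = boundary_jacobian_conditions[OF assms(11), folded J_def]
  have px: "partial_x Zp z_bf \<alpha>_bf $ i = J i 1" for i by (simp add: J_def fd)
  \<comment> \<open>\<open>k\<close> is the determinant in the BEB condition divided by
    \<open>m2\<^sup>2\<close>.\<close>
  have k_nz: "k \<noteq> 0"
    using assms(10) m2' unfolding k_def BEB_def det_columns2 px a1_def[symmetric] a2_def[symmetric]
    by (simp add: mult.commute)
  have \<delta>_nz: "\<delta> \<noteq> 0" using jc(2) m2' by (simp add: \<delta>_def)
  have disc: "\<delta> \<noteq> \<tau>\<^sup>2 / 4"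
  proof
    assume "\<delta> = \<tau>\<^sup>2 / 4"
    then have "\<tau>\<^sup>2 = 4 * \<delta>" by simp
    then have "(J 1 1 + J 2 2)\<^sup>2 / m2\<^sup>2 = 4 * (J 1 1 * J 2 2 - J 1 2 * J 2 1) / m2\<^sup>2"
      unfolding \<delta>_def \<tau>_def power_divide times_divide_eq_right .
    then show False using jc(3) m2' unfolding divide_cancel_right by simp
  qed
  have \<tau>_nz: "\<tau> \<noteq> 0 \<or> neutral_boundary_saddle Zp z_bf \<alpha>_bf" using jc(4) m2' by (auto simp: \<tau>_def)
  have slice: "((\<lambda>x. f (x, 0, \<alpha>_bf)) has_real_derivative D f \<zeta>0 (1, 0, 0)) (at x0)"
    if "smooth_on N0 f" for f :: "real \<times> real \<times> real \<Rightarrow> real"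
  proof -
    have d: "(f has_derivative D f \<zeta>0) (at (x0, (0, \<alpha>_bf)))"
      using smooth_on_has_derivative[OF that \<zeta>0N0] by (simp add: \<zeta>0_def)
    have "D f \<zeta>0 (h, 0) = D f \<zeta>0 (1, 0, 0) * h" for h
      using linear_cmul[OF has_derivative_linear[OF d], of h "(1, 0, 0)"] by (simp add: zero_prod_def)
    then show ?thesis using has_derivative_fst_slice[OF d] by (simp add: has_field_derivative_def)
  qed
  \<comment> \<open>So \<open>\<gamma>\<close> is the derivative of the original sliding field
    divided by \<open>m2\<close>, and the third BEB condition makes it nonzero.\<close>
  have "\<gamma> = (J 1 1 * m2 - J 2 1 * m1) / m2 / m2"
    using m2' by (simp add: \<gamma>_def \<tau>_def c_def field_simps)
  moreover have "deriv (\<lambda>x. sliding_field Zp Zm x \<alpha>_bf) x0 = (J 1 1 * m2 - J 2 1 * m1) / m2"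
  proof (rule sliding_field_derivative[where ?n1.0 = "D (M 1) \<zeta>0 (1, 0, 0)" and ?n2.0 = "D (M 2) \<zeta>0 (1, 0, 0)"])
    have P': "((\<lambda>x. Zp (vector [x, 0]) \<alpha>_bf $ i) has_real_derivative J i 1) (at x0)" for i
    proof -
      have "D (P i) \<zeta>0 (1, 0, 0) = J i 1" by (simp add: J_def fd)
      moreover have "(\<lambda>x. P i (x, 0, \<alpha>_bf)) = (\<lambda>x. Zp (vector [x, 0]) \<alpha>_bf $ i)" by (simp add: P_def)
      ultimately show ?thesis using slice[OF P[of i]] by simp
    qed
    show "((\<lambda>x. Zp (vector [x, 0]) \<alpha>_bf $ 1) has_real_derivative J 1 1) (at x0)"
      "((\<lambda>x. Zp (vector [x, 0]) \<alpha>_bf $ 2) has_real_derivative J 2 1) (at x0)" by (rule P')+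
    have M': "((\<lambda>x. Zm (vector [x, 0]) \<alpha>_bf $ i) has_real_derivative D (M i) \<zeta>0 (1, 0, 0)) (at x0)" for i
    proof -
      have "(\<lambda>x. M i (x, 0, \<alpha>_bf)) = (\<lambda>x. Zm (vector [x, 0]) \<alpha>_bf $ i)" by (simp add: M_def)
      then show ?thesis using slice[OF M[of i]] by simp
    qed
    show "((\<lambda>x. Zm (vector [x, 0]) \<alpha>_bf $ 1) has_real_derivative D (M 1) \<zeta>0 (1, 0, 0)) (at x0)"
      "((\<lambda>x. Zm (vector [x, 0]) \<alpha>_bf $ 2) has_real_derivative D (M 2) \<zeta>0 (1, 0, 0)) (at x0)" by (rule M')+
    show "Zm (vector [x0, 0]) \<alpha>_bf = vector [m1, m2]"
      by (simp add: vec_eq_iff forall_2 m1_def m2_def M_def \<zeta>0_def)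
  qed (fact Zp0 m2')+
  ultimately have \<gamma>_nz: "\<gamma> \<noteq> 0"
    using assms(10) m2' by (auto simp: BEB_def z_bf)
  have M2_nz: "M 2 \<zeta> \<noteq> 0" if "\<zeta> \<in> N" for \<zeta> using that by (auto simp: N_def)
  note smN = smooth_on_subset[OF _ NN0]
  obtain U V X \<Psi> t1 t2 where U: "open U" "U \<subseteq> N" "\<zeta>0 \<in> U" and V: "open V"
    and X: "smooth_on U X" and \<Psi>: "smooth_on V \<Psi>" and X0: "X \<zeta>0 = 0"
    and to_V: "\<And>x y \<alpha>. (x, y, \<alpha>) \<in> U \<Longrightarrow> (X (x, y, \<alpha>), y, k * (\<alpha> - \<alpha>_bf)) \<in> V \<and>
      \<Psi> (X (x, y, \<alpha>), y, k * (\<alpha> - \<alpha>_bf)) = (x, y, \<alpha>)"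
    and of_V: "\<And>u y \<mu>. (u, y, \<mu>) \<in> V \<Longrightarrow> \<exists>x. \<Psi> (u, y, \<mu>) = (x, y, \<alpha>_bf + \<mu> / k) \<and>
      (x, y, \<alpha>_bf + \<mu> / k) \<in> U \<and> X (x, y, \<alpha>_bf + \<mu> / k) = u"
    and t: "smooth_on V t1" "smooth_on V t2" and t1: "t1 0 = 0" "D t1 0 = (\<lambda>v. 0)"
    and t2: "t2 0 = 0" "D t2 0 = (\<lambda>v. 0)" "\<And>x \<mu>. (x, 0, \<mu>) \<in> V \<Longrightarrow> t2 (x, 0, \<mu>) = 0"
    and eq1: "\<And>x y \<alpha>. (x, y, \<alpha>) \<in> U \<Longrightarrow> D X (x, y, \<alpha>) (P 1 (x, y, \<alpha>), P 2 (x, y, \<alpha>), 0) =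
      M 2 (x, y, \<alpha>) * (k * (\<alpha> - \<alpha>_bf) + \<tau> * X (x, y, \<alpha>) - \<delta> * y + t1 (X (x, y, \<alpha>), y, k * (\<alpha> - \<alpha>_bf)))"
    and eq2: "\<And>x y \<alpha>. (x, y, \<alpha>) \<in> U \<Longrightarrow> P 2 (x, y, \<alpha>) =
      M 2 (x, y, \<alpha>) * (X (x, y, \<alpha>) + t2 (X (x, y, \<alpha>), y, k * (\<alpha> - \<alpha>_bf)))"
    and eq3: "\<And>\<zeta>. \<zeta> \<in> U \<Longrightarrow> D X \<zeta> (M 1 \<zeta>, M 2 \<zeta>, 0) = M 2 \<zeta> * c"
    using normal_form_coordinates[OF oN \<zeta>0N[unfolded \<zeta>0_def] smN[OF P] smN[OF P] smN[OF M] smN[OF M]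
      zero[unfolded \<zeta>0_def] M2_nz DP[unfolded \<zeta>0_def] m1_def[symmetric, unfolded \<zeta>0_def]
      m2_def[symmetric, unfolded \<zeta>0_def] \<tau>_def \<delta>_def c_def k_def jc(1) k_nz, folded \<zeta>0_def]
    by blast
  \<comment> \<open>\<open>\<pi>\<close> and \<open>E\<close> are mutually inverse linear
    identifications: the coordinates were constructed on triples, the transformation is stated for
    pairs of state and parameter.\<close>
  define \<pi> where "\<pi> = (\<lambda>p :: (real^2) \<times> real. (fst p $ 1, fst p $ 2, snd p))"
  define E where "E = (\<lambda>\<zeta> :: real \<times> real \<times> real. (vector [fst \<zeta>, fst (snd \<zeta>)] :: real^2, snd (snd \<zeta>)))"
  have E\<pi>: "E (\<pi> p) = p" for p by (cases p) (simp add: E_def \<pi>_def vec_eq_iff forall_2)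
  have \<pi>E: "\<pi> (E \<zeta>) = \<zeta>" for \<zeta> by (simp add: E_def \<pi>_def)
  have \<pi>_smooth: "smooth_on S \<pi>" if "open S" for S unfolding \<pi>_def
    by (intro smooth_intros that)
  have E_smooth: "smooth_on S E" if "open S" for S unfolding E_def
    by (intro smooth_intros that)
  have \<pi>_open: "open (\<pi> -` S)" if "open S" for S
    by (rule open_vimage[OF that smooth_on_continuous[OF \<pi>_smooth[OF open_UNIV]]])
  \<comment> \<open>The transformation is stated on a product of neighbourhoods, with an interval of
    parameters, so the open set \<open>U\<close> is shrunk to contain such a product.\<close>
  have "(z_bf, \<alpha>_bf) \<in> \<pi> -` U" using U(3) by (simp add: \<pi>_def z_bf \<zeta>0_def)
  then obtain A B where A: "open A" "z_bf \<in> A" and B: "open B" "\<alpha>_bf \<in> B" and AB: "A \<times> B \<subseteq> \<pi> -` U"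
    using open_prod_elim[OF \<pi>_open[OF U(1)]] by (metis mem_Sigma_iff)
  obtain e where e: "e > 0" "ball \<alpha>_bf e \<subseteq> B" using B openE by blast
  define K where "K = ball \<alpha>_bf e"
  have K: "open K" "\<alpha>_bf \<in> K" "is_interval K" using e by (auto simp: K_def is_interval_ball_real)
  have inU: "\<pi> (z, \<alpha>) \<in> U" if "z \<in> A" "\<alpha> \<in> K" for z \<alpha>
  proof -
    have "\<alpha> \<in> B" using that(2) e(2) by (auto simp: K_def)
    then show ?thesis using AB that(1) by blast
  qed
  have KI: "K \<subseteq> I"
  proof
    fix \<alpha> assume "\<alpha> \<in> K"
    then have "\<pi> (z_bf, \<alpha>) \<in> N0" using inU[OF A(2)] U(2) NN0 by blast
    then show "\<alpha> \<in> I" by (simp add: N0_def \<pi>_def)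
  qed
  define H where "H z \<alpha> = (vector [X (\<pi> (z, \<alpha>)), z $ 2] :: real^2)" for z \<alpha>
  define g where "g \<alpha> = k * (\<alpha> - \<alpha>_bf)" for \<alpha>
  define h where "h z \<alpha> = \<sigma> * M 2 (\<pi> (z, \<alpha>))" for z \<alpha>
  define F where "F p = (H (fst p) (snd p), g (snd p))" for p
  define G where "G p = E (\<Psi> (\<pi> p))" for p
  \<comment> \<open>This is the image of \<open>A \<times> K\<close> under \<open>F\<close>, written
    as a preimage under its inverse \<open>G\<close> so that continuity of \<open>G\<close> makes it
    open.\<close>
  define W where "W = (\<pi> -` V) \<inter> G -` (A \<times> K)"
  have oAK: "open (A \<times> K)" using A K by (simp add: open_Times)
  have \<Psi>\<pi>: "smooth_on (\<pi> -` V) (\<lambda>p. \<Psi> (\<pi> p))"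
    by (rule smooth_on_compose[OF \<Psi> \<pi>_smooth _ V]) (use \<pi>_open[OF V] in auto)
  have G: "smooth_on (\<pi> -` V) G" unfolding G_def
    by (rule smooth_on_compose[OF E_smooth[OF open_UNIV] \<Psi>\<pi> \<pi>_open[OF V]]) auto
  have oW: "open W" unfolding W_def
    by (rule continuous_open_preimage[OF smooth_on_continuous[OF G] \<pi>_open[OF V] oAK])
  have X\<pi>: "smooth_on (A \<times> K) (\<lambda>p. X (\<pi> p))"
    by (rule smooth_on_compose[OF X \<pi>_smooth[OF oAK] oAK U(1)]) (use inU in auto)
  have F: "smooth_on (A \<times> K) F" unfolding F_def H_def g_def prod.collapse
    by (intro smooth_intros oAK X\<pi>)
  have \<pi>F: "\<pi> (F p) = (X (\<pi> p), fst p $ 2, k * (snd p - \<alpha>_bf))" for p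
    by (simp add: \<pi>_def F_def H_def g_def)
  have FW: "F p \<in> W \<and> G (F p) = p" if p: "p \<in> A \<times> K" for p
  proof -
    have "(fst p $ 1, fst p $ 2, snd p) \<in> U" using inU p by (auto simp: \<pi>_def)
    from to_V[OF this] have "\<pi> (F p) \<in> V" "\<Psi> (\<pi> (F p)) = \<pi> p"
      unfolding \<pi>F by (simp_all add: \<pi>_def)
    then show ?thesis using p by (simp add: W_def G_def E\<pi>)
  qed
  have WF: "G p \<in> A \<times> K \<and> F (G p) = p" if p: "p \<in> W" for p
  proof -
    have "(fst p $ 1, fst p $ 2, snd p) \<in> V" using p by (simp add: W_def \<pi>_def)
    from of_V[OF this] obtain x where x: "\<Psi> (\<pi> p) = (x, fst p $ 2, \<alpha>_bf + snd p / k)"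
      "X (x, fst p $ 2, \<alpha>_bf + snd p / k) = fst p $ 1" by (auto simp: \<pi>_def)
    have "\<pi> (F (G p)) = \<pi> p" unfolding \<pi>F G_def \<pi>E x(1)
      using k_nz by (simp add: x(2)) (simp add: E_def \<pi>_def)
    then have "F (G p) = p" by (metis E\<pi>)
    then show ?thesis using p by (simp add: W_def)
  qed
  have diffeo: "diffeomorphism_between (A \<times> K) W F"
    by (rule diffeomorphism_betweenI[OF oAK oW F smooth_on_subset[OF G] FW WF]) (simp add: W_def)
  have diffeo_g: "diffeomorphism_between K (g ` K) g"
  proof (rule diffeomorphism_betweenI[where g = "\<lambda>\<mu>. \<alpha>_bf + \<mu> / k"])
    have "g ` K = (\<lambda>\<mu>. \<alpha>_bf + \<mu> / k) -` K"
    proof (intro set_eqI iffI)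
      fix \<mu> assume "\<mu> \<in> (\<lambda>\<mu>. \<alpha>_bf + \<mu> / k) -` K"
      then show "\<mu> \<in> g ` K" using k_nz by (intro image_eqI[of _ _ "\<alpha>_bf + \<mu> / k"]) (auto simp: g_def)
    qed (use k_nz in \<open>auto simp: g_def\<close>)
    moreover have "open ((\<lambda>\<mu>. \<alpha>_bf + \<mu> / k) -` K)"
      using k_nz by (intro open_vimage K continuous_intros) auto
    ultimately show o: "open (g ` K)" by simp
    show "smooth_on K g" unfolding g_def by (intro smooth_intros K)
    show "smooth_on (g ` K) (\<lambda>\<mu>. \<alpha>_bf + \<mu> / k)" using k_nz by (intro smooth_intros o)
  qed (use K k_nz in \<open>auto simp: g_def\<close>)
  define \<theta>1 where "\<theta>1 x y \<mu> = t1 (x, y, \<mu>)" for x y \<mu>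
  define \<theta>2 where "\<theta>2 x y \<mu> = t2 (x, y, \<mu>)" for x y \<mu>
  have \<gamma>c: "\<tau> - \<gamma> = c" by (simp add: \<gamma>_def)
  \<comment> \<open>Both sides are affine in \<open>p\<close>: \<open>eq1\<close> and
    \<open>eq2\<close> serve the part from \<open>Zp\<close>, \<open>eq3\<close> that from
    \<open>Zm\<close>. The identity holds for every \<open>p\<close>; as \<open>H\<close> keeps
    \<open>z $ 2\<close>, the same value of \<open>\<phi>\<close> can be put in on both sides for
    each \<open>\<epsilon>\<close>.\<close>
  have field_eq: "frechet_derivative (\<lambda>w. H w \<alpha>) (at z) (combined_field Zp Zm z p \<alpha>) =
      (\<sigma> * h z \<alpha>) *\<^sub>R normal_form \<tau> \<delta> \<gamma> \<theta>1 \<theta>2 (H z \<alpha>) p (g \<alpha>)"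
    if z: "z \<in> A" and \<alpha>: "\<alpha> \<in> K" for z \<alpha> p
  proof -
    let ?\<zeta> = "(z $ 1, z $ 2, \<alpha>)"
    have \<zeta>: "?\<zeta> \<in> U" using inU[OF z \<alpha>] by (simp add: \<pi>_def)
    have dX: "(X has_derivative D X ?\<zeta>) (at ?\<zeta>)" using smooth_on_has_derivative[OF X \<zeta>] .
    have "((\<lambda>w. \<pi> (w, \<alpha>)) has_derivative (\<lambda>v. (v $ 1, v $ 2, 0))) (at z)"
      unfolding \<pi>_def fst_conv snd_conv
      by (intro has_derivative_Pair bounded_linear_imp_has_derivative bounded_linear_vec_nth has_derivative_const)
    from has_derivative_compose[OF this, of X "D X ?\<zeta>"] dX
    have "((\<lambda>w. X (\<pi> (w, \<alpha>))) has_derivative (\<lambda>v. D X ?\<zeta> (v $ 1, v $ 2, 0))) (at z)"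
      by (simp add: \<pi>_def)
    then have "((\<lambda>w. H w \<alpha>) has_derivative (\<lambda>v. vector [D X ?\<zeta> (v $ 1, v $ 2, 0), v $ 2])) (at z)"
      unfolding H_def
      by (intro has_derivative_vector_2 bounded_linear_imp_has_derivative bounded_linear_vec_nth)
    then have DH: "D (\<lambda>w. H w \<alpha>) z = (\<lambda>v. vector [D X ?\<zeta> (v $ 1, v $ 2, 0), v $ 2])"
      by (rule derivative_at)
    have vz: "vector [z $ 1, z $ 2] = z" by (simp add: vec_eq_iff forall_2)
    have comp: "combined_field Zp Zm z p \<alpha> $ i = p * P i ?\<zeta> + (1 - p) * M i ?\<zeta>" for i
      by (simp add: combined_field_def P_def M_def vz)
    have lX: "linear (D X ?\<zeta>)" using has_derivative_linear[OF dX] .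
    have "(p * P 1 ?\<zeta> + (1 - p) * M 1 ?\<zeta>, p * P 2 ?\<zeta> + (1 - p) * M 2 ?\<zeta>, 0) =
        p *\<^sub>R (P 1 ?\<zeta>, P 2 ?\<zeta>, 0) + (1 - p) *\<^sub>R (M 1 ?\<zeta>, M 2 ?\<zeta>, 0 :: real)" by simp
    then have "D X ?\<zeta> (p * P 1 ?\<zeta> + (1 - p) * M 1 ?\<zeta>, p * P 2 ?\<zeta> + (1 - p) * M 2 ?\<zeta>, 0) =
        p * D X ?\<zeta> (P 1 ?\<zeta>, P 2 ?\<zeta>, 0) + (1 - p) * D X ?\<zeta> (M 1 ?\<zeta>, M 2 ?\<zeta>, 0)"
      by (simp only: linear_add[OF lX] linear_cmul[OF lX] real_scaleR_def)
    also have "\<dots> = M 2 ?\<zeta> * (c + p * (- c + g \<alpha> + \<tau> * X ?\<zeta> - \<delta> * z $ 2 + \<theta>1 (X ?\<zeta>) (z $ 2) (g \<alpha>)))"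
      unfolding eq1[OF \<zeta>] eq3[OF \<zeta>] \<theta>1_def g_def by (simp add: algebra_simps)
    finally have 1: "D X ?\<zeta> (p * P 1 ?\<zeta> + (1 - p) * M 1 ?\<zeta>, p * P 2 ?\<zeta> + (1 - p) * M 2 ?\<zeta>, 0) =
      M 2 ?\<zeta> * (c + p * (- c + g \<alpha> + \<tau> * X ?\<zeta> - \<delta> * z $ 2 + \<theta>1 (X ?\<zeta>) (z $ 2) (g \<alpha>)))" .
    have 2: "p * P 2 ?\<zeta> + (1 - p) * M 2 ?\<zeta> =
        M 2 ?\<zeta> * (1 + p * (- 1 + X ?\<zeta> + \<theta>2 (X ?\<zeta>) (z $ 2) (g \<alpha>)))"
      unfolding eq2[OF \<zeta>] \<theta>2_def g_def by (simp add: algebra_simps)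
    have \<sigma>h: "\<sigma> * h z \<alpha> = M 2 ?\<zeta>" using \<sigma>2 by (simp add: h_def \<pi>_def mult.assoc[symmetric])
    have \<gamma>c': "\<gamma> - \<tau> = - c" by (simp add: \<gamma>_def)
    show ?thesis unfolding DH comp 1 unfolding 2 \<sigma>h normal_form_def Let_def \<gamma>c \<gamma>c'
      by (simp add: H_def \<pi>_def vec_eq_iff forall_2)
  qed
  have h_pos: "h z \<alpha> > 0" if "z \<in> A" "\<alpha> \<in> K" for z \<alpha>
    using inU[OF that] U(2) by (auto simp: h_def N_def)
  have h_smooth: "smooth_on (A \<times> K) (\<lambda>(z, \<alpha>). h z \<alpha>)"
  proof -
    have "smooth_on (A \<times> K) (\<lambda>p. M 2 (\<pi> p))"
      by (rule smooth_on_compose[OF M \<pi>_smooth[OF oAK] oAK oN0]) (use inU U(2) NN0 in auto)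
    then have "smooth_on (A \<times> K) (\<lambda>p. \<sigma> * M 2 (\<pi> p))" by (intro smooth_intros oAK)
    then show ?thesis by (simp add: h_def case_prod_unfold)
  qed
  have transforms: "smoothly_transforms \<phi> \<epsilon>0 (combined_field Zp Zm) (normal_form \<tau> \<delta> \<gamma> \<theta>1 \<theta>2)
      (sgn (Zm z_bf \<alpha>_bf $ 2)) A K W H h g"
    unfolding smoothly_transforms_def \<sigma>_def[symmetric]
  proof (intro conjI ballI)
    show "diffeomorphism_between (A \<times> K) W (\<lambda>(z, \<alpha>). (H z \<alpha>, g \<alpha>))"
      using diffeo by (simp add: F_def[abs_def] case_prod_unfold)
    show "frechet_derivative (\<lambda>w. H w \<alpha>) (at z) (combined_field Zp Zm z (\<phi> (z $ 2 / \<epsilon>)) \<alpha>) =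
        (\<sigma> * h z \<alpha>) *\<^sub>R normal_form \<tau> \<delta> \<gamma> \<theta>1 \<theta>2 (H z \<alpha>) (\<phi> (H z \<alpha> $ 2 / \<epsilon>)) (g \<alpha>)"
      if "z \<in> A" "\<alpha> \<in> K" for \<epsilon> z \<alpha>
      using field_eq[OF that] by (simp add: H_def)
  qed (use diffeo_g h_smooth h_pos in auto)
  have V0: "0 \<in> V" using to_V[of x0 0 \<alpha>_bf] U(3) X0 by (simp add: \<zeta>0_def zero_prod_def)
  have \<theta>_smooth: "smooth_on W (\<lambda>(z, \<mu>). s (z $ 1, z $ 2, \<mu>))" if "smooth_on V s"
    for s :: "real \<times> real \<times> real \<Rightarrow> real"
  proof -
    have "smooth_on W (\<lambda>p. s (\<pi> p))"
      by (rule smooth_on_compose[OF that \<pi>_smooth[OF oW] oW V]) (simp add: W_def)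
    then show ?thesis by (simp add: \<pi>_def case_prod_unfold)
  qed
  have flat: "((\<lambda>x. s (x, 0, 0)) has_real_derivative 0) (at 0)" "((\<lambda>\<mu>. s (0, 0, \<mu>)) has_real_derivative 0) (at 0)"
    if "smooth_on V s" "D s 0 = (\<lambda>v. 0)" for s :: "real \<times> real \<times> real \<Rightarrow> real"
  proof -
    have d: "(s has_derivative (\<lambda>v. 0)) (at (0, 0, 0))"
      using smooth_on_has_derivative[OF that(1) V0] that(2) by (simp add: zero_prod_def)
    have "((\<lambda>x. (x, 0 :: real, 0 :: real)) has_derivative (\<lambda>h. (h, 0, 0))) (at (0 :: real))"
      "((\<lambda>\<mu>. (0 :: real, 0 :: real, \<mu>)) has_derivative (\<lambda>h. (0, 0, h))) (at (0 :: real))"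
      by (intro has_derivative_Pair has_derivative_ident has_derivative_const)+
    from has_derivative_compose[OF this(1) d] has_derivative_compose[OF this(2) d]
    show "((\<lambda>x. s (x, 0, 0)) has_real_derivative 0) (at 0)" "((\<lambda>\<mu>. s (0, 0, \<mu>)) has_real_derivative 0) (at 0)"
      by (simp_all add: has_field_derivative_def lambda_zero[symmetric])
  qed
  have beb: "BEB (X_plus \<tau> \<delta> \<theta>1 \<theta>2) (X_minus \<tau> \<gamma>) 0 0"
    by (rule normal_form_BEB) (use t1 t2 \<gamma>_nz flat t in \<open>auto simp: \<theta>1_def \<theta>2_def zero_prod_def\<close>)
  have g': "deriv g \<alpha>_bf = k" unfolding g_def
    by (rule DERIV_imp_deriv) (auto intro!: derivative_eq_intros)
  have H0: "H z_bf \<alpha>_bf = 0" using X0 by (simp add: H_def \<pi>_def z_bf \<zeta>0_def vec_eq_iff forall_2)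
  show ?thesis
  proof (rule exI[of _ \<tau>], rule exI[of _ \<delta>], rule exI[of _ \<gamma>], rule exI[of _ \<theta>1], rule exI[of _ \<theta>2], rule exI[of _ A],
      rule exI[of _ K], rule exI[of _ W], rule exI[of _ H], rule exI[of _ h], rule exI[of _ g], intro conjI)
    show "(\<lambda>(x, y, \<mu>). \<theta>1 x y \<mu>) \<in> O[nhds (0, 0, 0)](\<lambda>(x, y, \<mu>).
        x\<^sup>2 + \<bar>x * y\<bar> + y\<^sup>2 + \<bar>x * \<mu>\<bar> + \<bar>y * \<mu>\<bar> + \<mu>\<^sup>2)"
      unfolding \<theta>1_def by (rule quadratic_remainder_bigo[OF V t(1) V0 t1(2,1)])
    show "(\<lambda>(x, y, \<mu>). \<theta>2 x y \<mu>) \<in> O[nhds (0, 0, 0)](\<lambda>(x, y, \<mu>).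
        x\<^sup>2 + \<bar>x * y\<bar> + y\<^sup>2 + \<bar>x * \<mu>\<bar> + \<bar>y * \<mu>\<bar>)"
      unfolding \<theta>2_def by (rule quadratic_remainder_bigo_vanishing[OF V t(2) V0 t2(2,3)])
    show "smooth_on W (\<lambda>(z, \<mu>). \<theta>1 (z $ 1) (z $ 2) \<mu>)" "smooth_on W (\<lambda>(z, \<mu>). \<theta>2 (z $ 1) (z $ 2) \<mu>)"
      unfolding \<theta>1_def \<theta>2_def by (intro \<theta>_smooth t)+
    show "deriv g \<alpha>_bf \<noteq> 0" using g' k_nz by simp
  qed (use \<tau>_nz \<delta>_nz disc A K KI transforms H0 beb normal_form_tendsto_X_plus[OF assms(8)]
      normal_form_tendsto_X_minus[OF assms(9)] sliding_field_normal_form in \<open>auto simp: g_def\<close>)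
qed

end
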